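(* If $v$ is an extended pointwise almost periodic continuous $\mathbb{R}$-action on a compact surface $S$, then $v$ is extended recurrent and $|\mathrm{Sing}(v)\cap\overline{O_{\mathrm{ex}}(x)}|<\infty$ for each $x\in S$.
   Context: $S$ is a compact surface and $v$ is a continuous $\mathbb{R}$-action (flow) on $S$. For $x\in S$, $O(x)$, $O^+(x)$, $O^-(x)$ denote the orbit, positive orbit and negative orbit of $x$, and $\omega(x)$, $\alpha(x)$ its omega and alpha limit sets. $\mathrm{Sing}(v)$ is the set of singularities (fixed points) of $v$. Saddle: a singular point $x$ is a (topological) saddle if it has a neighborhood on which the flow is locally homeomorphic (by a homeomorphism carrying orbits to orbits and preserving their direction) to the flow on a neighborhood of a saddle of a $C^1$ $\mathbb{R}$-action. We say "$\omega(x)$ is a saddle" if $\omega(x)=\{p\}$ with $p$ a saddle, and then write $W^u(\omega(x))=W^u(p)$; similarly for $\alpha$ and $W^s$. Extended orbits: put $W^u(y)=\{z\in S\mid \alpha(z)=\{y\}\}$ and $W^s(y)=\{z\in S\mid \omega(z)=\{y\}\}$. Define $O^+_0(x)=O^+(x)$, $O^+_{i+1}(x)=O^+_i(x)\cup\bigcup\{W^u(\omega(x'))\mid x'\in O^+_i(x),\ \omega(x')\text{ is a saddle}\}$ for every ordinal $i$, and $O^+_\mu(x)=\bigcup_{\nu<\mu}O^+_\nu(x)$ for every limit ordinal $\mu$. The extended positive orbit is $O^+_{\mathrm{ex}}(x)=\bigcup_{\nu\text{ ordinal}}O^+_\nu(x)$. The extended negative orbit $O^-_{\mathrm{ex}}(x)$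 is defined symmetrically, starting from $O^-(x)$ and using $W^s(\alpha(x'))$ when $\alpha(x')$ is a saddle. The extended orbit is $O_{\mathrm{ex}}(x)=O^+_{\mathrm{ex}}(x)\cup O^-_{\mathrm{ex}}(x)$. Extended recurrence: $x$ is extended positive recurrent if either $x\in\omega(x)$ (positive recurrent) or $x\in\overline{O^+_{\mathrm{ex}}(x)-O^+(x)}$; $x$ is extended negative recurrent if either $x\in\alpha(x)$ or $x\in\overline{O^-_{\mathrm{ex}}(x)-O^-(x)}$; $x$ is extended recurrent if it is both. The action $v$ is extended recurrent if every point of $S$ is. The action $v$ is extended pointwise almost periodic (extended p.a.p.) if the set $\{\overline{O_{\mathrm{ex}}(x)}\mid x\in S\}$ of closures of extended orbits is a decomposition of $S$, i.e. any two of its members are equal or disjoint (they cover $S$). *)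

theory Defs
  imports "HOL-Analysis.Analysis"
begin

section \<open>Compact surfaces and continuous flows\<close>

text \<open>
  A surface is a subset of an ambient Hausdorff space, with the subspace topology. It may be
  disconnected, and it may have boundary (charts take values in the closed upper half plane).
  Since a compact \<open>S\<close> is closed in the ambient space, \<^const>\<open>closure\<close> of a subset of \<open>S\<close> is its
  closure in \<open>S\<close>. Second countability is automatic for compact locally Euclidean spaces.
\<close>

definition compact_surface :: "'a::t2_space set \<Rightarrow> bool" where
  "compact_surface S \<longleftrightarrow> compact S \<and>
     (\<forall>x\<in>S. \<exists>U V. openin (top_of_set S) U \<and> x \<in> U \<and>
        openin (top_of_set {z :: real^2. 0 \<le> z $ 2}) V \<and> U homeomorphic V)"

definition continuous_action :: "'a::topological_space set \<Rightarrow> (real \<Rightarrow> 'a \<Rightarrow> 'a) \<Rightarrow> bool" where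
  "continuous_action S v \<longleftrightarrow>
     (\<forall>t. \<forall>x\<in>S. v t x \<in> S) \<and>
     (\<forall>x\<in>S. v 0 x = x) \<and>
     (\<forall>s t. \<forall>x\<in>S. v (s + t) x = v s (v t x)) \<and>
     continuous_on (UNIV \<times> S) (\<lambda>(t, x). v t x)"

definition Sing :: "'a set \<Rightarrow> (real \<Rightarrow> 'a \<Rightarrow> 'a) \<Rightarrow> 'a set" where
  "Sing S v = {x \<in> S. \<forall>t. v t x = x}"

definition pos_orbit :: "(real \<Rightarrow> 'a \<Rightarrow> 'a) \<Rightarrow> 'a \<Rightarrow> 'a set" where
  "pos_orbit v x = (\<lambda>t. v t x) ` {0..}"

definition neg_orbit :: "(real \<Rightarrow> 'a \<Rightarrow> 'a) \<Rightarrow> 'a \<Rightarrow> 'a set" where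
  "neg_orbit v x = (\<lambda>t. v t x) ` {..0}"

definition omega_limit :: "(real \<Rightarrow> 'a::topological_space \<Rightarrow> 'a) \<Rightarrow> 'a \<Rightarrow> 'a set" where
  "omega_limit v x = (\<Inter>t. closure ((\<lambda>s. v s x) ` {t..}))"

definition alpha_limit :: "(real \<Rightarrow> 'a::topological_space \<Rightarrow> 'a) \<Rightarrow> 'a \<Rightarrow> 'a set" where
  "alpha_limit v x = (\<Inter>t. closure ((\<lambda>s. v s x) ` {..t}))"


section \<open>Saddles\<close>

text \<open>
  A saddle of a \<open>C\<^sup>1\<close> action of the real line on the plane: a singular point at which the
  linearization of the flow has one expanding and one contracting real direction. As the
  action itself, not a generating vector field, is assumed to be \<open>C\<^sup>1\<close>, the linearization
  is read off from the time-one map: if the action is the flow of a \<open>C\<^sup>1\<close> vector field \<open>X\<close>, the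
  eigenvalues \<open>l < 1 < m\<close> below are the exponentials of the eigenvalues of \<open>DX(q)\<close>, which are
  real and of opposite signs.
\<close>

definition C1_map :: "('a::real_normed_vector \<Rightarrow> 'b::real_normed_vector) \<Rightarrow> bool" where
  "C1_map f \<longleftrightarrow> (\<exists>D. (\<forall>p. (f has_derivative blinfun_apply (D p)) (at p)) \<and> continuous_on UNIV D)"

definition C1_saddle :: "(real \<Rightarrow> real^2 \<Rightarrow> real^2) \<Rightarrow> real^2 \<Rightarrow> bool" where
  "C1_saddle \<psi> q \<longleftrightarrow>
     continuous_action UNIV \<psi> \<and> C1_map (\<lambda>(t, z). \<psi> t z) \<and> q \<in> Sing UNIV \<psi> \<and>
     (\<exists>L l m a b. (\<psi> 1 has_derivative L) (at q) \<and>
        a \<noteq> 0 \<and> b \<noteq> 0 \<and> L a = l *\<^sub>R a \<and> L b = m *\<^sub>R b \<and> 0 < l \<and> l < 1 \<and> 1 < m)"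

text \<open>
  \<open>h\<close> carries the orbit arcs of \<open>\<phi>\<close> that stay in \<open>U\<close> to orbit arcs of \<open>\<psi>\<close> with the same
  direction. The reparametrization of time \<open>\<tau>\<close> may depend on the arc.
\<close>

definition carries_orbits ::
  "(real \<Rightarrow> 'a \<Rightarrow> 'a) \<Rightarrow> 'a set \<Rightarrow> (real \<Rightarrow> 'b \<Rightarrow> 'b) \<Rightarrow> ('a \<Rightarrow> 'b) \<Rightarrow> bool" where
  "carries_orbits \<phi> U \<psi> h \<longleftrightarrow>
     (\<forall>y\<in>U. \<forall>T\<ge>0. (\<forall>s\<in>{0..T}. \<phi> s y \<in> U) \<longrightarrow>
        (\<exists>\<tau>. \<tau> 0 = 0 \<and> continuous_on {0..T} \<tau> \<and> strict_mono_on {0..T} \<tau> \<and>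
             (\<forall>s\<in>{0..T}. h (\<phi> s y) = \<psi> (\<tau> s) (h y))))"

text \<open>
  Since \<open>V\<close> is open in the plane, a saddle is always an interior point of the surface.
\<close>

definition saddle :: "'a::topological_space set \<Rightarrow> (real \<Rightarrow> 'a \<Rightarrow> 'a) \<Rightarrow> 'a \<Rightarrow> bool" where
  "saddle S v p \<longleftrightarrow> p \<in> Sing S v \<and>
     (\<exists>\<psi> q U V h k. C1_saddle \<psi> q \<and>
        openin (top_of_set S) U \<and> p \<in> U \<and> open V \<and> q \<in> V \<and>
        homeomorphism U V h k \<and> h p = q \<and>
        carries_orbits v U \<psi> h \<and> carries_orbits \<psi> V v k)"

definition Wu :: "'a::topological_space set \<Rightarrow> (real \<Rightarrow> 'a \<Rightarrow> 'a) \<Rightarrow> 'a \<Rightarrow> 'a set" where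
  "Wu S v y = {z \<in> S. alpha_limit v z = {y}}"

definition Ws :: "'a::topological_space set \<Rightarrow> (real \<Rightarrow> 'a \<Rightarrow> 'a) \<Rightarrow> 'a \<Rightarrow> 'a set" where
  "Ws S v y = {z \<in> S. omega_limit v z = {y}}"


section \<open>Extended orbits\<close>

text \<open>
  \<open>stages F A\<close> is the family of all sets \<open>A\<^sub>\<nu>\<close>, \<open>\<nu>\<close> an ordinal, of the transfinite iteration
  \<open>A\<^sub>0 = A\<close>, \<open>A\<^sub>\<nu>\<^sub>+\<^sub>1 = F A\<^sub>\<nu>\<close>, with unions at limits. HOL has no type of all ordinals, so the
  family is generated directly by the three clauses. For inflationary \<open>F\<close>, as used
  here, the stages form a chain, so that the union of any nonempty subfamily
  is again a stage, as required in the limit clause.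
\<close>

inductive_set stages :: "('a set \<Rightarrow> 'a set) \<Rightarrow> 'a set \<Rightarrow> 'a set set"
  for F :: "'a set \<Rightarrow> 'a set" and A :: "'a set" where
  base: "A \<in> stages F A"
| succ: "B \<in> stages F A \<Longrightarrow> F B \<in> stages F A"
| limit: "C \<noteq> {} \<Longrightarrow> (\<And>B. B \<in> C \<Longrightarrow> B \<in> stages F A) \<Longrightarrow> \<Union>C \<in> stages F A"

definition pos_step :: "'a::topological_space set \<Rightarrow> (real \<Rightarrow> 'a \<Rightarrow> 'a) \<Rightarrow> 'a set \<Rightarrow> 'a set" where
  "pos_step S v A = A \<union> \<Union>{Wu S v p | x' p. x' \<in> A \<and> omega_limit v x' = {p} \<and> saddle S v p}"

definition neg_step :: "'a::topological_space set \<Rightarrow> (real \<Rightarrow> 'a \<Rightarrow> 'a) \<Rightarrow> 'a set \<Rightarrow> 'a set" where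
  "neg_step S v A = A \<union> \<Union>{Ws S v p | x' p. x' \<in> A \<and> alpha_limit v x' = {p} \<and> saddle S v p}"

definition ext_pos_orbit :: "'a::topological_space set \<Rightarrow> (real \<Rightarrow> 'a \<Rightarrow> 'a) \<Rightarrow> 'a \<Rightarrow> 'a set" where
  "ext_pos_orbit S v x = \<Union>(stages (pos_step S v) (pos_orbit v x))"

definition ext_neg_orbit :: "'a::topological_space set \<Rightarrow> (real \<Rightarrow> 'a \<Rightarrow> 'a) \<Rightarrow> 'a \<Rightarrow> 'a set" where
  "ext_neg_orbit S v x = \<Union>(stages (neg_step S v) (neg_orbit v x))"

definition ext_orbit :: "'a::topological_space set \<Rightarrow> (real \<Rightarrow> 'a \<Rightarrow> 'a) \<Rightarrow> 'a \<Rightarrow> 'a set" where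
  "ext_orbit S v x = ext_pos_orbit S v x \<union> ext_neg_orbit S v x"


section \<open>Extended recurrence and extended pointwise almost periodicity\<close>

definition ext_pos_recurrent_pt :: "'a::topological_space set \<Rightarrow> (real \<Rightarrow> 'a \<Rightarrow> 'a) \<Rightarrow> 'a \<Rightarrow> bool" where
  "ext_pos_recurrent_pt S v x \<longleftrightarrow>
     x \<in> omega_limit v x \<or> x \<in> closure (ext_pos_orbit S v x - pos_orbit v x)"

definition ext_neg_recurrent_pt :: "'a::topological_space set \<Rightarrow> (real \<Rightarrow> 'a \<Rightarrow> 'a) \<Rightarrow> 'a \<Rightarrow> bool" where
  "ext_neg_recurrent_pt S v x \<longleftrightarrow>
     x \<in> alpha_limit v x \<or> x \<in> closure (ext_neg_orbit S v x - neg_orbit v x)"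

definition ext_recurrent :: "'a::topological_space set \<Rightarrow> (real \<Rightarrow> 'a \<Rightarrow> 'a) \<Rightarrow> bool" where
  "ext_recurrent S v \<longleftrightarrow> (\<forall>x\<in>S. ext_pos_recurrent_pt S v x \<and> ext_neg_recurrent_pt S v x)"

definition ext_pap :: "'a::topological_space set \<Rightarrow> (real \<Rightarrow> 'a \<Rightarrow> 'a) \<Rightarrow> bool" where
  "ext_pap S v \<longleftrightarrow> partition_on S {closure (ext_orbit S v x) | x. x \<in> S}"

end

theory Submission
  imports Defs
begin

text \<open>
  Let \<open>C\<close> be the member of the decomposition that contains \<open>x\<close>. A singularity in \<open>C\<close> that is not
  a saddle would be all of \<open>C\<close>, and saddles are isolated singularities; so \<open>Sing \<inter> C\<close> is finite.

  Suppose that \<open>x\<close> is not extended positive recurrent. The forward orbit of every point of \<open>C\<close>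
  accumulates at a saddle in \<open>C\<close>, so it crosses the entrance sections of small isolating blocks
  at these saddles. Let \<open>Y\<close> be the closure of the extended positive orbit of the first such
  crossing point. The one-sided germ of the section at that point is disjoint from \<open>Y\<close>, and the
  first return map carries it to germs at other points of \<open>Y\<close>, where a germ at a stable
  separatrix is continued along the unstable one on the same side. The map is injective on germs
  and never returns to the initial germ. The germs are therefore distinct, they lie in gaps of
  \<open>Y\<close> whose lengths tend to 0, and from some point on the return map sends one whole gap into the
  next. This gives an open interval of the section that wanders and is attracted to \<open>Y\<close>; by the
  decomposition property it is contained in \<open>C\<close>. Each orbit meets it at most once, so none of
  its points has an orbit dense in \<open>C\<close>; hence they all lie on unstable separatrices of the finitely
  many saddles, which is impossible for an interval. Negative recurrence follows by reversing time.

  No transversals are needed away from the saddles, and of the surface only compactness is used: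
  saddles carry planar charts by definition.
\<close>

section \<open>The linearization at a planar saddle\<close>

text \<open>A saddle is known only up to orbit equivalence, which forgets lengths, times and angles.
  What survives is order: which coordinate grows or shrinks inside two cones, and the uniqueness of
  points that never leave a block in the future or in the past. Everything in \<open>S\<close> rests
  on these facts; in particular the sides with \<open>\<bar>snd\<bar> = 1\<close> serve as sections
  although transversality has no meaning there. The return map is undefined where a stable
  separatrix meets a section, although the points beside it return. This is why one-sided germs are
  iterated instead of points. Continuity can also fail where the first return is a corner of a
  block; injectivity leaves only finitely many such points. Counting gaps is the elementary part of
  Denjoy's argument: disjoint intervals of a fixed length in a bounded set are finite in number. The
  contradiction does not come from the interval being wandering, which a merely continuous map
  allows, but from the class \<open>C\<close>. Non-recurrence supplies the start: \<open>x0\<close>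
  is not periodic and lies outside the closed invariant set \<open>T0\<close>, so its section germ
  avoids \<open>Y\<close> and no germ based in \<open>Or\<close> is carried back to
  \<open>x0\<close>.\<close>

text \<open>
  Only the action is \<open>C\<^sup>1\<close>, so its generating vector field \<open>X\<close> below is merely continuous and has no
  linearization to work with. Its signs near the saddle are read off from the displacement of the
  time-one map, which equals a derivative along the orbit by the mean value theorem.
\<close>

locale planar_saddle =
  fixes \<phi> :: "real \<Rightarrow> real \<times> real \<Rightarrow> real \<times> real"
    and D :: "real \<times> real \<times> real \<Rightarrow> (real \<times> real \<times> real) \<Rightarrow>\<^sub>L (real \<times> real)"
    and l m :: real
  assumes act: "continuous_action UNIV \<phi>"
    and D: "\<And>t z. ((\<lambda>(t, z). \<phi> t z) has_derivative blinfun_apply (D (t, z))) (at (t, z))"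
    and contD: "continuous_on UNIV D"
    and fixed: "\<And>t. \<phi> t 0 = 0"
    and lin: "\<And>a b. blinfun_apply (D (1, 0)) (0, (a, b)) = (m * a, l * b)"
    and lm: "0 < l" "l < 1" "1 < m"
begin

lemma flow0 [simp]: "\<phi> 0 z = z" and flow_add: "\<phi> (s + t) z = \<phi> s (\<phi> t z)"
  using act unfolding continuous_action_def by blast+

definition X :: "real \<times> real \<Rightarrow> real \<times> real" where "X z = blinfun_apply (D (0, z)) (1, 0)"

lemma D_space: "(\<phi> s has_derivative (\<lambda>w. blinfun_apply (D (s, z)) (0, w))) (at z)"
proof -
  have "((\<lambda>z. (s, z)) has_derivative (\<lambda>w. (0, w))) (at z)"
    by (intro derivative_eq_intros) auto
  from has_derivative_compose[OF this D] show ?thesis by simp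
qed

lemma D_scale: "blinfun_apply (D x) (h, 0) = h *\<^sub>R blinfun_apply (D x) (1, 0)"
  "blinfun_apply (D x) (0, h *\<^sub>R w) = h *\<^sub>R blinfun_apply (D x) (0, w)"
  by (subst blinfun.scaleR_right[symmetric], simp)+

lemma D_time: "((\<lambda>s. \<phi> s z) has_vector_derivative blinfun_apply (D (s, z)) (1, 0)) (at s)"
proof -
  have "((\<lambda>s. (s, z)) has_derivative (\<lambda>h. (h, 0))) (at s)"
    by (intro derivative_eq_intros) auto
  from has_derivative_compose[OF this D]
  have "((\<lambda>s. \<phi> s z) has_derivative (\<lambda>h. blinfun_apply (D (s, z)) (h, 0))) (at s)" by simp
  moreover have "(\<lambda>h. blinfun_apply (D (s, z)) (h, 0)) = (\<lambda>h. h *\<^sub>R blinfun_apply (D (s, z)) (1, 0))"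
    by (rule ext) (rule D_scale)
  ultimately show ?thesis unfolding has_vector_derivative_def by metis
qed

lemma orbit_X: "((\<lambda>s. \<phi> s z) has_vector_derivative X (\<phi> s z)) (at s)"
proof -
  have "((\<lambda>h. \<phi> h (\<phi> s z)) has_vector_derivative X (\<phi> s z)) (at (s - s))"
    using D_time[of "\<phi> s z" 0] by (simp add: X_def)
  moreover have "((\<lambda>h. h - s) has_vector_derivative 1) (at s)"
    by (auto intro!: derivative_eq_intros)
  ultimately have "(((\<lambda>h. \<phi> h (\<phi> s z)) \<circ> (\<lambda>h. h - s)) has_vector_derivative 1 *\<^sub>R X (\<phi> s z)) (at s)"
    by (intro vector_diff_chain_at)
  moreover have "((\<lambda>h. \<phi> h (\<phi> s z)) \<circ> (\<lambda>h. h - s)) = (\<lambda>h. \<phi> h z)"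
    by (auto simp: o_def simp flip: flow_add)
  ultimately show ?thesis by simp
qed

text \<open>Differentiating \<open>\<phi> (s + h) z = \<phi> s (\<phi> h z)\<close> in
  \<open>h\<close> at 0 in two ways shows that the flow preserves its own velocity field. This
  stands in for differentiability of \<open>X\<close>.\<close>

lemma X_push: "X (\<phi> s z) = blinfun_apply (D (s, z)) (0, X z)"
proof -
  have "((\<lambda>h. \<phi> h z) has_vector_derivative X z) (at 0)" using D_time[of z 0] by (simp add: X_def)
  then have "((\<lambda>h. \<phi> h z) has_derivative (\<lambda>h. h *\<^sub>R X z)) (at 0)" by (simp add: has_vector_derivative_def)
  from has_derivative_compose[OF this, of "\<phi> s"] D_space[of s z]
  have "((\<lambda>h. \<phi> s (\<phi> h z)) has_derivative (\<lambda>h. blinfun_apply (D (s, z)) (0, h *\<^sub>R X z))) (at 0)" by simp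
  then have 1: "((\<lambda>h. \<phi> (s + h) z) has_vector_derivative blinfun_apply (D (s, z)) (0, X z)) (at 0)"
    by (simp add: has_vector_derivative_def flow_add D_scale(2))
  have "((\<lambda>h. \<phi> h z) has_vector_derivative X (\<phi> s z)) (at (s + 0))" using orbit_X by simp
  moreover have "((\<lambda>h. s + h) has_vector_derivative 1) (at 0)"
    by (auto intro!: derivative_eq_intros)
  ultimately have "(((\<lambda>h. \<phi> h z) \<circ> (\<lambda>h. s + h)) has_vector_derivative 1 *\<^sub>R X (\<phi> s z)) (at 0)"
    by (intro vector_diff_chain_at)
  then have "((\<lambda>h. \<phi> (s + h) z) has_vector_derivative X (\<phi> s z)) (at 0)" by (simp add: o_def)
  with 1 show ?thesis using vector_derivative_unique_at by blast
qed

section \<open>The linearized flow at the fixed point\<close>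

abbreviation M :: "real \<Rightarrow> real \<times> real \<Rightarrow> real \<times> real" where
  "M s w \<equiv> blinfun_apply (D (s, 0)) (0, w)"

lemma M_add: "M (s + t) w = M s (M t w)"
proof -
  have "(\<phi> t has_derivative M t) (at 0)" "(\<phi> s has_derivative M s) (at (\<phi> t 0))"
    using D_space[of t 0] D_space[of s 0] by (simp_all add: fixed)
  from has_derivative_compose[OF this] have "((\<lambda>z. \<phi> (s + t) z) has_derivative (\<lambda>w. M s (M t w))) (at 0)"
    by (simp add: flow_add)
  moreover have "((\<lambda>z. \<phi> (s + t) z) has_derivative M (s + t)) (at 0)" using D_space[of "s + t" 0] by simp
  ultimately show ?thesis using has_derivative_unique by metis
qed

lemma M_0: "M 0 w = w"
proof -
  have "(\<phi> 0 has_derivative M 0) (at 0)" using D_space[of 0 0] by simp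
  moreover have "(\<phi> 0 has_derivative (\<lambda>w. w)) (at 0)"
    by (rule has_derivative_transform[OF _ _ has_derivative_ident]) auto
  ultimately show ?thesis using has_derivative_unique by metis
qed

lemma M_linear: "M s (x + y) = M s x + M s y" "M s (r *\<^sub>R x) = r *\<^sub>R M s x"
  by (subst blinfun.add_right[symmetric], simp) (rule D_scale)

text \<open>\<open>M s\<close> commutes with \<open>M 1\<close>, whose eigenvalues \<open>m\<close>
  and \<open>l\<close> differ, so it preserves each eigenline.\<close>

lemma M_unstable: "M s (a, 0) = (a * fst (M s (1, 0)), 0)"
proof -
  have e: "M 1 (M s (1, 0)) = M s (M 1 (1, 0))" by (simp add: add.commute flip: M_add)
  have "M s (M 1 (1, 0)) = M s (m *\<^sub>R (1, 0))" by (simp add: lin)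
  also have "\<dots> = m *\<^sub>R M s (1, 0)" by (rule M_linear)
  finally have "M 1 (M s (1, 0)) = m *\<^sub>R M s (1, 0)" using e by simp
  moreover obtain x y where xy: "M s (1, 0) = (x, y)" by fastforce
  ultimately have "l * y = m * y" by (simp add: lin)
  then have "y = 0" using lm by auto
  moreover have "M s (a, 0) = a *\<^sub>R M s (1, 0)" using M_linear(2)[of s a "(1, 0)"] by simp
  ultimately show ?thesis by (simp add: xy)
qed

lemma M_stable: "M s (0, a) = (0, a * snd (M s (0, 1)))"
proof -
  have e: "M 1 (M s (0, 1)) = M s (M 1 (0, 1))" by (simp add: add.commute flip: M_add)
  have "M s (M 1 (0, 1)) = M s (l *\<^sub>R (0, 1))" by (simp add: lin)
  also have "\<dots> = l *\<^sub>R M s (0, 1)" by (rule M_linear)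
  finally have "M 1 (M s (0, 1)) = l *\<^sub>R M s (0, 1)" using e by simp
  moreover obtain x y where xy: "M s (0, 1) = (x, y)" by fastforce
  ultimately have "m * x = l * x" using lin[of x y] by (metis scaleR_Pair fst_conv real_scaleR_def)
  then have "x = 0" using lm by (metis less_irrefl less_trans mult_right_cancel)
  moreover have "M s (0, a) = a *\<^sub>R M s (0, 1)" using M_linear(2)[of s a "(0, 1)"] by simp
  ultimately show ?thesis by (simp add: xy)
qed

lemma M_diag: "M s (a, b) = (a * fst (M s (1, 0)), b * snd (M s (0, 1)))"
proof -
  have "M s (a, b) = M s ((a, 0) + (0, b))" by simp
  also have "\<dots> = M s (a, 0) + M s (0, b)" by (rule M_linear)
  also have "\<dots> = (a * fst (M s (1, 0)), 0) + (0, b * snd (M s (0, 1)))"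
    using M_stable[of s b] M_unstable[of s a] by metis
  finally show ?thesis by simp
qed

lemma cont_M: "continuous_on A (\<lambda>s. M s w)"
proof -
  have "continuous_on A (\<lambda>s. D (s, 0))"
    by (rule continuous_on_compose2[OF contD]) (auto intro!: continuous_intros)
  then show ?thesis by (intro continuous_intros)
qed

lemma positive_of_multiplicative:
  fixes g :: "real \<Rightarrow> real"
  assumes "continuous_on UNIV g" "g 0 = 1" "\<And>s. g s * g (- s) = 1"
  shows "g s > 0"
proof (rule ccontr)
  assume "\<not> g s > 0"
  then have s: "g s \<le> 0" by simp
  have "connected (range g)" using assms(1) by (intro connected_continuous_image) auto
  then have "0 \<in> range g" using connectedD_interval[of "range g" "g s" "g 0" 0] s assms(2) by auto
  then show False using assms(3) by (metis imageE mult_zero_left zero_neq_one)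
qed

text \<open>The mean value theorem will supply an unknown time in \<open>{0..1}\<close>, so the
  factors relating \<open>X\<close> to the displacement need a bound uniform in \<open>s\<close>.
  They are positive because \<open>M s\<close> and \<open>M (- s)\<close> are inverse to each other
  and both factors start at 1.\<close>

lemma diag_bound: obtains c where "0 < c" "\<And>s. s \<in> {0..1} \<Longrightarrow> c \<le> fst (M s (1, 0)) \<and> c \<le> snd (M s (0, 1))"
proof -
  let ?g = "\<lambda>s. fst (M s (1, 0))" and ?h = "\<lambda>s. snd (M s (0, 1))"
  have g: "continuous_on A ?g" and h: "continuous_on A ?h" for A
    by (intro continuous_intros cont_M)+
  have "M s (M (- s) w) = w" for s w using M_add[of s "- s" w] M_0 by simp
  then have "M s (a * ?g (- s), b * ?h (- s)) = (a, b)" for s a b by (metis M_diag)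
  then have inv: "?g s * ?g (- s) = 1" "?h s * ?h (- s) = 1" for s
    using M_diag[of s "1 * ?g (- s)" "1 * ?h (- s)"] by (metis mult.commute mult_1 prod.inject)+
  have pos: "?g s > 0" "?h s > 0" for s
    by (rule positive_of_multiplicative[OF g]; simp add: M_0 inv)
       (rule positive_of_multiplicative[OF h]; simp add: M_0 inv)
  obtain a where a: "a \<in> {0..1}" "\<forall>y\<in>{0..1}. ?g a \<le> ?g y"
    using continuous_attains_inf[OF _ _ g, of "{0..1}"] by auto
  obtain b where b: "b \<in> {0..1}" "\<forall>y\<in>{0..1}. ?h b \<le> ?h y"
    using continuous_attains_inf[OF _ _ h, of "{0..1}"] by auto
  show thesis
    by (rule that[of "min (?g a) (?h b)"]) (use a b pos in \<open>auto simp: min_le_iff_disj\<close>)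
qed

lemma uniform_D:
  assumes "0 < e" obtains \<rho> where "0 < \<rho>"
    "\<And>s z. s \<in> {0..1} \<Longrightarrow> norm z < \<rho> \<Longrightarrow> norm (D (s, z) - D (s, 0)) < e"
proof -
  have "compact ({0..1::real} \<times> cball (0::real\<times>real) 1)" by (intro compact_Times) auto
  then have "uniformly_continuous_on ({0..1} \<times> cball 0 1) D"
    by (intro compact_uniformly_continuous continuous_on_subset[OF contD]) auto
  then obtain d where d: "0 < d" "\<And>x x'. x \<in> {0..1} \<times> cball 0 1 \<Longrightarrow> x' \<in> {0..1} \<times> cball 0 1 \<Longrightarrow>
      dist x' x < d \<Longrightarrow> dist (D x') (D x) < e"
    using assms unfolding uniformly_continuous_on_def by metis
  show thesis
  proof (rule that[of "min d 1"])
    fix s :: real and z :: "real \<times> real" assume "s \<in> {0..1}" "norm z < min d 1"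
    then show "norm (D (s, z) - D (s, 0)) < e"
      using d(2)[of "(s, 0)" "(s, z)"] by (auto simp: dist_Pair_Pair dist_norm)
  qed (use d in auto)
qed

text \<open>The nonlinear part of the time-one map has a derivative of norm at most \<open>e\<close>
  near 0, hence is \<open>e\<close>-Lipschitz there. A bound on differences, not only on values, is
  what allows two orbits to be compared in \<open>flow_separation\<close>.\<close>

lemma strict_diff:
  assumes "0 < e" obtains \<rho> where "0 < \<rho>"
    "\<And>z z'. norm z < \<rho> \<Longrightarrow> norm z' < \<rho> \<Longrightarrow>
       norm (\<phi> 1 z - \<phi> 1 z' - (m * (fst z - fst z'), l * (snd z - snd z'))) \<le> e * norm (z - z')"
proof -
  obtain \<rho> where \<rho>: "0 < \<rho>" "\<And>s z. s \<in> {0..1} \<Longrightarrow> norm z < \<rho> \<Longrightarrow> norm (D (s, z) - D (s, 0)) < e"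
    using uniform_D[OF assms] by blast
  have L: "M 1 w = (m * fst w, l * snd w)" for w by (cases w) (simp add: lin)
  let ?g = "\<lambda>z. \<phi> 1 z - M 1 z"
  have "norm (?g z - ?g z') \<le> e * norm (z - z')" if z: "norm z < \<rho>" "norm z' < \<rho>" for z z'
  proof (rule differentiable_bound[of "ball 0 \<rho>"])
    fix x :: "real \<times> real" assume x: "x \<in> ball 0 \<rho>"
    let ?g' = "\<lambda>w. blinfun_apply (D (1, x)) (0, w) - M 1 w"
    show "(?g has_derivative ?g') (at x within ball 0 \<rho>)"
      by (intro derivative_intros has_derivative_at_withinI[OF D_space]
          bounded_linear_imp_has_derivative
          bounded_linear_compose[OF blinfun.bounded_linear_right bounded_linear_Pair])
        (auto intro: bounded_linear_intros)
    show "onorm ?g' \<le> e"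
    proof (rule onorm_le)
      fix w
      have "norm (?g' w) = norm (blinfun_apply (D (1, x) - D (1, 0)) (0, w))"
        by (simp add: blinfun.diff_left)
      also have "\<dots> \<le> norm (D (1, x) - D (1, 0)) * norm (0::real, w)" by (rule norm_blinfun)
      also have "\<dots> \<le> e * norm w" using \<rho>(2)[of 1 x] x assms
        by (intro mult_mono) (auto simp: norm_Pair)
      finally show "norm (?g' w) \<le> e * norm w" .
    qed
  qed (use z in auto)
  moreover have "?g z - ?g z' = \<phi> 1 z - \<phi> 1 z' - (m * (fst z - fst z'), l * (snd z - snd z'))" for z z'
    by (simp add: L prod_eq_iff algebra_simps)
  ultimately show thesis using that[OF \<rho>(1)] by simp
qed

lemma norm_le_coords: "norm (z :: real \<times> real) \<le> \<bar>fst z\<bar> + \<bar>snd z\<bar>"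
  by (cases z) (simp add: norm_Pair sqrt_sum_squares_le_sum_abs)

lemma fst_le_norm: "\<bar>fst (z :: real \<times> real)\<bar> \<le> norm z" and snd_le_norm: "\<bar>snd (z :: real \<times> real)\<bar> \<le> norm z"
  using norm_fst_le[of "fst z" "snd z"] norm_snd_le[of "snd z" "fst z"] by simp_all

text \<open>The displacement of a coordinate equals its velocity at some intermediate time
  \<open>s\<close>, and there \<open>X (\<phi> s z)\<close> is close to \<open>M s (X z)\<close> by
  \<open>X_push\<close>. Each coordinate gets its own time, since planar curves have no mean value
  equality.\<close>

lemma X_mean_value:
  assumes \<rho>: "\<And>s z. s \<in> {0..1} \<Longrightarrow> norm z < \<rho> \<Longrightarrow> norm (D (s, z) - D (s, 0)) < e" "norm z < \<rho>" "0 < e"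
  shows "\<exists>s\<in>{0..1}. \<bar>fst (\<phi> 1 z) - fst z - fst (M s (1, 0)) * fst (X z)\<bar> \<le> e * norm (X z)"
    "\<exists>s\<in>{0..1}. \<bar>snd (\<phi> 1 z) - snd z - snd (M s (0, 1)) * snd (X z)\<bar> \<le> e * norm (X z)"
proof -
  have est: "norm (X (\<phi> s z) - M s (X z)) \<le> e * norm (X z)" if "s \<in> {0..1}" for s
  proof -
    have "norm (X (\<phi> s z) - M s (X z)) = norm (blinfun_apply (D (s, z) - D (s, 0)) (0, X z))"
      by (simp add: X_push blinfun.diff_left)
    also have "\<dots> \<le> norm (D (s, z) - D (s, 0)) * norm (0::real, X z)" by (rule norm_blinfun)
    also have "\<dots> \<le> e * norm (X z)" using \<rho>(1)[OF that \<rho>(2)] \<rho>(3)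
      by (intro mult_mono) (auto simp: norm_Pair)
    finally show ?thesis .
  qed
  have Mf: "fst (M s w) = fst (M s (1, 0)) * fst w" "snd (M s w) = snd (M s (0, 1)) * snd w" for s w
    using M_diag[of s "fst w" "snd w"] by (simp_all add: mult.commute)
  have df: "((\<lambda>s. fst (\<phi> s z)) has_real_derivative fst (X (\<phi> s z))) (at s)"
     and ds: "((\<lambda>s. snd (\<phi> s z)) has_real_derivative snd (X (\<phi> s z))) (at s)" for s
    unfolding has_real_derivative_iff_has_vector_derivative
    using bounded_linear.has_vector_derivative[OF bounded_linear_fst orbit_X]
      bounded_linear.has_vector_derivative[OF bounded_linear_snd orbit_X] by blast+
  obtain s where s: "0 < s" "s < 1" "fst (\<phi> 1 z) - fst (\<phi> 0 z) = (1 - 0) * fst (X (\<phi> s z))"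
    using MVT2[of 0 1 "\<lambda>s. fst (\<phi> s z)" "\<lambda>s. fst (X (\<phi> s z))"] df by auto
  show "\<exists>s\<in>{0..1}. \<bar>fst (\<phi> 1 z) - fst z - fst (M s (1, 0)) * fst (X z)\<bar> \<le> e * norm (X z)"
    using s est[of s] fst_le_norm[of "X (\<phi> s z) - M s (X z)"] Mf(1)[of s "X z"]
    by (intro bexI[of _ s]) auto
  obtain s where s: "0 < s" "s < 1" "snd (\<phi> 1 z) - snd (\<phi> 0 z) = (1 - 0) * snd (X (\<phi> s z))"
    using MVT2[of 0 1 "\<lambda>s. snd (\<phi> s z)" "\<lambda>s. snd (X (\<phi> s z))"] ds by auto
  show "\<exists>s\<in>{0..1}. \<bar>snd (\<phi> 1 z) - snd z - snd (M s (0, 1)) * snd (X z)\<bar> \<le> e * norm (X z)"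
    using s est[of s] snd_le_norm[of "X (\<phi> s z) - M s (X z)"] Mf(2)[of s "X z"]
    by (intro bexI[of _ s]) auto
qed

text \<open>The displacement of the time-one map is nearly
  \<open>((m - 1) * fst z, (l - 1) * snd z)\<close>, and \<open>X_mean_value\<close> says that each
  of its coordinates is nearly a positive multiple of that of \<open>X z\<close>. Inside a cone the
  error is small against the dominant coordinate, so the sign carries over.\<close>

lemma X_signs:
  obtains \<rho> where "0 < \<rho>"
    "\<And>z. norm z < \<rho> \<Longrightarrow> \<bar>fst z\<bar> < 2 * \<bar>snd z\<bar> \<Longrightarrow> snd z * snd (X z) < 0"
    "\<And>z. norm z < \<rho> \<Longrightarrow> \<bar>snd z\<bar> < 2 * \<bar>fst z\<bar> \<Longrightarrow> 0 < fst z * fst (X z)"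
proof -
  obtain c where c: "0 < c" "\<And>s. s \<in> {0..1} \<Longrightarrow> c \<le> fst (M s (1, 0)) \<and> c \<le> snd (M s (0, 1))"
    using diag_bound by blast
  \<comment> \<open>\<open>N\<close> will bound \<open>norm (X z) / norm z\<close>. The cap
    \<open>c/4\<close> on \<open>e\<close> lets the error \<open>2 * (e * norm (X z))\<close> be
    absorbed into \<open>c * norm (X z)\<close> when this bound is derived. The factor 6 is 3 from
    \<open>norm z \<le> 3 * \<bar>b\<bar>\<close> inside a cone, times 2 in order to lose at most
    half of \<open>m - 1\<close> or \<open>1 - l\<close>.\<close>
  define N where "N = 2 * (m + 1) / c"
  have N: "0 < N" using c lm by (auto simp: N_def)
  define e where "e = min (min (c/4) (1/2)) (min ((1 - l) / (6 * (1 + N))) ((m - 1) / (6 * (1 + N))))"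
  have e: "0 < e" "e \<le> c/4" "e \<le> 1/2" "e \<le> (1 - l) / (6 * (1 + N))" "e \<le> (m - 1) / (6 * (1 + N))"
    unfolding e_def using c(1) lm N by (simp, linarith+)
  have e4: "6 * (e * (1 + N)) \<le> 1 - l" "6 * (e * (1 + N)) \<le> m - 1"
    using e(4,5) N by (simp_all add: pos_le_divide_eq mult_ac)
  obtain \<rho>1 where r1: "0 < \<rho>1" "\<And>s z. s \<in> {0..1} \<Longrightarrow> norm z < \<rho>1 \<Longrightarrow> norm (D (s, z) - D (s, 0)) < e"
    using uniform_D[OF e(1)] by blast
  obtain \<rho>2 where r2: "0 < \<rho>2" "\<And>z z'. norm z < \<rho>2 \<Longrightarrow> norm z' < \<rho>2 \<Longrightarrow>
       norm (\<phi> 1 z - \<phi> 1 z' - (m * (fst z - fst z'), l * (snd z - snd z'))) \<le> e * norm (z - z')"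
    using strict_diff[OF e(1)] by blast
  have main: "(\<exists>k\<ge>c. \<bar>k * fst (X z) - (m - 1) * fst z\<bar> \<le> e * (1 + N) * norm z) \<and>
      (\<exists>k\<ge>c. \<bar>k * snd (X z) - (l - 1) * snd z\<bar> \<le> e * (1 + N) * norm z)"
    if z: "norm z < min \<rho>1 \<rho>2" for z
  proof -
    obtain s where s: "s \<in> {0..1}" "\<bar>fst (\<phi> 1 z) - fst z - fst (M s (1, 0)) * fst (X z)\<bar> \<le> e * norm (X z)"
      using X_mean_value(1)[of \<rho>1 e z] r1(2) e(1) z by auto
    obtain t where t: "t \<in> {0..1}" "\<bar>snd (\<phi> 1 z) - snd z - snd (M t (0, 1)) * snd (X z)\<bar> \<le> e * norm (X z)"
      using X_mean_value(2)[of \<rho>1 e z] r1(2) e(1) z by auto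
    define k1 where "k1 = fst (M s (1, 0))"
    define k2 where "k2 = snd (M t (0, 1))"
    have k: "c \<le> k1" "c \<le> k2" using c(2) s(1) t(1) by (auto simp: k1_def k2_def)
    have d: "norm (\<phi> 1 z - (m * fst z, l * snd z)) \<le> e * norm z"
      using r2(2)[of z 0] z r2(1) by (simp add: fixed)
    have d1: "\<bar>fst (\<phi> 1 z) - m * fst z\<bar> \<le> e * norm z" and d2: "\<bar>snd (\<phi> 1 z) - l * snd z\<bar> \<le> e * norm z"
      using d fst_le_norm[of "\<phi> 1 z - (m * fst z, l * snd z)"] snd_le_norm[of "\<phi> 1 z - (m * fst z, l * snd z)"]
      by auto
    have q1: "\<bar>k1 * fst (X z) - (m - 1) * fst z\<bar> \<le> e * norm z + e * norm (X z)"
      using s(2) d1 unfolding k1_def[symmetric] left_diff_distrib by linarith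
    have q2: "\<bar>k2 * snd (X z) - (l - 1) * snd z\<bar> \<le> e * norm z + e * norm (X z)"
      using t(2) d2 unfolding k2_def[symmetric] left_diff_distrib by linarith
    have "c * \<bar>fst (X z)\<bar> \<le> k1 * \<bar>fst (X z)\<bar>" "c * \<bar>snd (X z)\<bar> \<le> k2 * \<bar>snd (X z)\<bar>"
      using k by (auto intro: mult_right_mono)
    moreover have "k1 * \<bar>fst (X z)\<bar> = \<bar>k1 * fst (X z)\<bar>" "k2 * \<bar>snd (X z)\<bar> = \<bar>k2 * snd (X z)\<bar>"
      using k c by (auto simp: abs_mult)
    moreover have "\<bar>(m - 1) * fst z\<bar> \<le> (m - 1) * norm z" "\<bar>(l - 1) * snd z\<bar> \<le> (1 - l) * norm z"
      using lm fst_le_norm[of z] snd_le_norm[of z] by (auto simp: abs_mult intro!: mult_left_mono)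
    ultimately have "c * \<bar>fst (X z)\<bar> + c * \<bar>snd (X z)\<bar> \<le> (m - 1) * norm z + (1 - l) * norm z + 2 * (e * norm z) + 2 * (e * norm (X z))"
      using q1 q2 by linarith
    moreover have "c * norm (X z) \<le> c * \<bar>fst (X z)\<bar> + c * \<bar>snd (X z)\<bar>"
      using norm_le_coords[of "X z"] c(1) by (simp flip: distrib_left)
    moreover have "e * norm (X z) \<le> c/4 * norm (X z)" "e * norm z \<le> 1/2 * norm z" "l * norm z \<ge> 0"
      using e lm by (intro mult_right_mono mult_nonneg_nonneg; simp)+
    ultimately have "c/2 * norm (X z) \<le> (m + 1) * norm z"
      by (simp add: algebra_simps)
    then have "norm (X z) \<le> N * norm z" using c(1) by (simp add: N_def field_simps)
    then have "e * norm (X z) \<le> e * (N * norm z)" using e(1) by (intro mult_left_mono) auto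
    then have "e * norm z + e * norm (X z) \<le> e * (1 + N) * norm z" by (simp add: algebra_simps)
    then show ?thesis using q1 q2 k by (meson order_trans)
  qed
  have small: "e * (1 + N) * norm z \<le> 3 * (e * (1 + N)) * \<bar>b\<bar>" if "norm z \<le> 3 * \<bar>b\<bar>" for z :: "real \<times> real" and b
    using mult_left_mono[OF that, of "e * (1 + N)"] e(1) N by (simp add: mult_ac)
  show thesis
  proof (rule that[of "min \<rho>1 \<rho>2"])
    show "0 < min \<rho>1 \<rho>2" using r1 r2 by simp
  next
    fix z :: "real \<times> real" assume z: "norm z < min \<rho>1 \<rho>2" "\<bar>fst z\<bar> < 2 * \<bar>snd z\<bar>"
    define b where "b = snd z"
    obtain k where k: "k \<ge> c" "\<bar>k * snd (X z) - (l - 1) * b\<bar> \<le> e * (1 + N) * norm z"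
      using main[OF z(1)] b_def by auto
    have b0: "b \<noteq> 0" using z(2) by (auto simp: b_def)
    have "norm z \<le> 3 * \<bar>b\<bar>" using norm_le_coords[of z] z(2) by (simp add: b_def)
    from small[OF this] have "\<bar>k * snd (X z) - (l - 1) * b\<bar> \<le> 3 * (e * (1 + N)) * \<bar>b\<bar>" using k by linarith
    also have "\<dots> \<le> (1 - l)/2 * \<bar>b\<bar>" using e4(1) by (intro mult_right_mono) auto
    finally have "\<bar>k * snd (X z) - (l - 1) * b\<bar> * \<bar>b\<bar> \<le> (1 - l)/2 * \<bar>b\<bar> * \<bar>b\<bar>" by (intro mult_right_mono) auto
    then have "\<bar>(k * snd (X z) - (l - 1) * b) * b\<bar> \<le> (1 - l)/2 * (b * b)" by (simp add: abs_mult)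
    then have "(k * snd (X z) - (l - 1) * b) * b \<le> (1 - l)/2 * (b * b)" by linarith
    moreover have "(k * snd (X z) - (l - 1) * b) * b = k * (b * snd (X z)) + (1 - l) * (b * b)"
      "(1 - l)/2 * (b * b) = (1 - l) * (b * b) / 2" by (simp_all add: algebra_simps)
    ultimately have "k * (b * snd (X z)) \<le> - ((1 - l)/2 * (b * b))" by linarith
    moreover have "0 < (1 - l)/2 * (b * b)" proof (rule mult_pos_pos)
      show "0 < b * b" using b0 by (meson not_real_square_gt_zero)
    qed (use lm in simp)
    ultimately have "k * (b * snd (X z)) < 0" by linarith
    then show "snd z * snd (X z) < 0" using k(1) c(1) unfolding b_def[symmetric]
      by (metis less_le_trans mult_less_0_iff not_less_iff_gr_or_eq)
  next
    fix z :: "real \<times> real" assume z: "norm z < min \<rho>1 \<rho>2" "\<bar>snd z\<bar> < 2 * \<bar>fst z\<bar>"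
    define b where "b = fst z"
    obtain k where k: "k \<ge> c" "\<bar>k * fst (X z) - (m - 1) * b\<bar> \<le> e * (1 + N) * norm z"
      using main[OF z(1)] b_def by auto
    have b0: "b \<noteq> 0" using z(2) by (auto simp: b_def)
    have "norm z \<le> 3 * \<bar>b\<bar>" using norm_le_coords[of z] z(2) by (simp add: b_def)
    from small[OF this] have "\<bar>k * fst (X z) - (m - 1) * b\<bar> \<le> 3 * (e * (1 + N)) * \<bar>b\<bar>" using k by linarith
    also have "\<dots> \<le> (m - 1)/2 * \<bar>b\<bar>" using e4(2) by (intro mult_right_mono) auto
    finally have "\<bar>k * fst (X z) - (m - 1) * b\<bar> * \<bar>b\<bar> \<le> (m - 1)/2 * \<bar>b\<bar> * \<bar>b\<bar>" by (intro mult_right_mono) auto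
    then have "\<bar>(k * fst (X z) - (m - 1) * b) * b\<bar> \<le> (m - 1)/2 * (b * b)" by (simp add: abs_mult)
    then have "- ((k * fst (X z) - (m - 1) * b) * b) \<le> (m - 1)/2 * (b * b)" by linarith
    moreover have "(k * fst (X z) - (m - 1) * b) * b = k * (b * fst (X z)) - (m - 1) * (b * b)"
      "(m - 1)/2 * (b * b) = (m - 1) * (b * b) / 2" by (simp_all add: algebra_simps)
    ultimately have "(m - 1)/2 * (b * b) \<le> k * (b * fst (X z))" by linarith
    moreover have "0 < (m - 1)/2 * (b * b)" proof (rule mult_pos_pos)
      show "0 < b * b" using b0 by (meson not_real_square_gt_zero)
    qed (use lm in simp)
    ultimately have "0 < k * (b * fst (X z))" by linarith
    then show "0 < fst z * fst (X z)" using k(1) c(1) unfolding b_def[symmetric]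
      by (metis less_le_trans zero_less_mult_pos)
  qed
qed

text \<open>The squares of the coordinates are differentiable where absolute values are not, and
  \<open>X_signs\<close> gives the sign of their derivatives along the orbit. With slope 2 the two
  open cones overlap, so every point other than 0 lies in at least one of them.\<close>

lemma flow_monotone:
  "\<exists>\<rho>>0.
    (\<forall>z T. 0 < T \<longrightarrow> (\<forall>s\<in>{0..T}. norm (\<phi> s z) < \<rho> \<and> \<bar>fst (\<phi> s z)\<bar> < 2 * \<bar>snd (\<phi> s z)\<bar>) \<longrightarrow>
       \<bar>snd (\<phi> T z)\<bar> < \<bar>snd z\<bar>) \<and>
    (\<forall>z T. 0 < T \<longrightarrow> (\<forall>s\<in>{0..T}. norm (\<phi> s z) < \<rho> \<and> \<bar>snd (\<phi> s z)\<bar> < 2 * \<bar>fst (\<phi> s z)\<bar>) \<longrightarrow>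
       \<bar>fst z\<bar> < \<bar>fst (\<phi> T z)\<bar>)"
proof -
  obtain \<rho> where \<rho>: "0 < \<rho>"
    "\<And>z. norm z < \<rho> \<Longrightarrow> \<bar>fst z\<bar> < 2 * \<bar>snd z\<bar> \<Longrightarrow> snd z * snd (X z) < 0"
    "\<And>z. norm z < \<rho> \<Longrightarrow> \<bar>snd z\<bar> < 2 * \<bar>fst z\<bar> \<Longrightarrow> 0 < fst z * fst (X z)"
    using X_signs by blast
  have df: "((\<lambda>s. fst (\<phi> s z)) has_real_derivative fst (X (\<phi> s z))) (at s)"
   and ds: "((\<lambda>s. snd (\<phi> s z)) has_real_derivative snd (X (\<phi> s z))) (at s)" for s z
    unfolding has_real_derivative_iff_has_vector_derivative
    using bounded_linear.has_vector_derivative[OF bounded_linear_fst orbit_X]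
      bounded_linear.has_vector_derivative[OF bounded_linear_snd orbit_X] by blast+
  show ?thesis
  proof (intro exI[of _ \<rho>] conjI \<rho>(1) allI impI)
    fix z and T :: real
    assume T: "0 < T" "\<forall>s\<in>{0..T}. norm (\<phi> s z) < \<rho> \<and> \<bar>fst (\<phi> s z)\<bar> < 2 * \<bar>snd (\<phi> s z)\<bar>"
    have "(snd (\<phi> T z))\<^sup>2 < (snd (\<phi> 0 z))\<^sup>2"
    proof (rule DERIV_neg_imp_decreasing[OF T(1)])
      fix s assume "0 \<le> s" "s \<le> T"
      then have "snd (\<phi> s z) * snd (X (\<phi> s z)) < 0" using T(2) \<rho>(2) by auto
      moreover have "((\<lambda>s. (snd (\<phi> s z))\<^sup>2) has_real_derivative 2 * (snd (\<phi> s z) * snd (X (\<phi> s z)))) (at s)"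
        by (auto intro!: derivative_eq_intros ds)
      ultimately show "\<exists>y. ((\<lambda>s. (snd (\<phi> s z))\<^sup>2) has_real_derivative y) (at s) \<and> y < 0" by force
    qed
    then show "\<bar>snd (\<phi> T z)\<bar> < \<bar>snd z\<bar>" using abs_le_square_iff[of "snd z" "snd (\<phi> T z)"] by force
  next
    fix z and T :: real
    assume T: "0 < T" "\<forall>s\<in>{0..T}. norm (\<phi> s z) < \<rho> \<and> \<bar>snd (\<phi> s z)\<bar> < 2 * \<bar>fst (\<phi> s z)\<bar>"
    have "(fst (\<phi> 0 z))\<^sup>2 < (fst (\<phi> T z))\<^sup>2"
    proof (rule DERIV_pos_imp_increasing[OF T(1)])
      fix s assume "0 \<le> s" "s \<le> T"
      then have "0 < fst (\<phi> s z) * fst (X (\<phi> s z))" using T(2) \<rho>(3) by auto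
      moreover have "((\<lambda>s. (fst (\<phi> s z))\<^sup>2) has_real_derivative 2 * (fst (\<phi> s z) * fst (X (\<phi> s z)))) (at s)"
        by (auto intro!: derivative_eq_intros df)
      ultimately show "\<exists>y. ((\<lambda>s. (fst (\<phi> s z))\<^sup>2) has_real_derivative y) (at s) \<and> 0 < y" by force
    qed
    then show "\<bar>fst z\<bar> < \<bar>fst (\<phi> T z)\<bar>" using abs_le_square_iff[of "fst (\<phi> T z)" "fst z"] by force
  qed
qed

text \<open>A cone argument for the difference of two orbits under the time-one map. A mostly
  horizontal difference stays mostly horizontal and grows by the factor \<open>a\<close> at each
  step, which is impossible for orbits that remain near 0. Backwards in time, a mostly vertical
  difference stays mostly vertical and grows by \<open>1 / b\<close>.\<close>

lemma flow_separation:
  "\<exists>\<rho>>0.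
    (\<forall>z z'. (\<forall>t\<ge>0. norm (\<phi> t z) < \<rho> \<and> norm (\<phi> t z') < \<rho>) \<longrightarrow> \<bar>fst z - fst z'\<bar> \<le> \<bar>snd z - snd z'\<bar>) \<and>
    (\<forall>z z'. (\<forall>t\<le>0. norm (\<phi> t z) < \<rho> \<and> norm (\<phi> t z') < \<rho>) \<longrightarrow> \<bar>snd z - snd z'\<bar> \<le> \<bar>fst z - fst z'\<bar>)"
proof -
  \<comment> \<open>The error is at most \<open>2 * e\<close> times the larger coordinate of the
    difference, so this choice leaves the rates \<open>a\<close> and \<open>b\<close>, the midpoints
    between 1 and the two eigenvalues.\<close>
  define e where "e = min ((m - 1)/4) ((1 - l)/4)"
  have e: "0 < e" "e \<le> (m - 1)/4" "e \<le> (1 - l)/4" using lm min.cobounded1 min.cobounded2 by (auto simp: e_def simp del: le_divide_eq_numeral1)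
  obtain \<rho> where r: "0 < \<rho>" "\<And>z z'. norm z < \<rho> \<Longrightarrow> norm z' < \<rho> \<Longrightarrow>
       norm (\<phi> 1 z - \<phi> 1 z' - (m * (fst z - fst z'), l * (snd z - snd z'))) \<le> e * norm (z - z')"
    using strict_diff[OF e(1)] by blast
  define a where "a = (m + 1)/2"
  define b where "b = (l + 1)/2"
  have ab: "1 < a" "0 < b" "b < 1" using lm by (auto simp: a_def b_def)
  have step: "\<bar>fst (\<phi> 1 z) - fst (\<phi> 1 z')\<bar> \<ge> m * \<bar>fst z - fst z'\<bar> - e * (\<bar>fst z - fst z'\<bar> + \<bar>snd z - snd z'\<bar>)
      \<and> \<bar>snd (\<phi> 1 z) - snd (\<phi> 1 z')\<bar> \<le> l * \<bar>snd z - snd z'\<bar> + e * (\<bar>fst z - fst z'\<bar> + \<bar>snd z - snd z'\<bar>)"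
    if z: "norm z < \<rho>" "norm z' < \<rho>" for z z'
  proof -
    let ?w = "\<phi> 1 z - \<phi> 1 z' - (m * (fst z - fst z'), l * (snd z - snd z'))"
    have "e * norm (z - z') \<le> e * (\<bar>fst z - fst z'\<bar> + \<bar>snd z - snd z'\<bar>)"
      using norm_le_coords[of "z - z'"] e(1) by (intro mult_left_mono) auto
    then have n: "norm ?w \<le> e * (\<bar>fst z - fst z'\<bar> + \<bar>snd z - snd z'\<bar>)" using r(2)[OF z] by linarith
    have "\<bar>fst ?w\<bar> \<le> norm ?w" "\<bar>snd ?w\<bar> \<le> norm ?w" by (rule fst_le_norm, rule snd_le_norm)
    moreover have "\<bar>m * (fst z - fst z')\<bar> = m * \<bar>fst z - fst z'\<bar>" "\<bar>l * (snd z - snd z')\<bar> = l * \<bar>snd z - snd z'\<bar>"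
      using lm by (auto simp: abs_mult)
    moreover have aux: "R - E \<le> \<bar>P\<bar> \<and> \<bar>P\<bar> \<le> R + E" if "\<bar>P - Q\<bar> \<le> n" "n \<le> E" "\<bar>Q\<bar> = R" for P Q R E n :: real
      using that by linarith
    ultimately show ?thesis
      using aux[of "fst (\<phi> 1 z) - fst (\<phi> 1 z')" "m * (fst z - fst z')" _ _ "m * \<bar>fst z - fst z'\<bar>", OF _ n]
        aux[of "snd (\<phi> 1 z) - snd (\<phi> 1 z')" "l * (snd z - snd z')" _ _ "l * \<bar>snd z - snd z'\<bar>", OF _ n]
      by simp
  qed
  have cone: "a * \<bar>fst z - fst z'\<bar> \<le> \<bar>fst (\<phi> 1 z) - fst (\<phi> 1 z')\<bar> \<and>
      \<bar>snd (\<phi> 1 z) - snd (\<phi> 1 z')\<bar> \<le> b * \<bar>fst z - fst z'\<bar>"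
    if z: "norm z < \<rho>" "norm z' < \<rho>" "\<bar>snd z - snd z'\<bar> \<le> \<bar>fst z - fst z'\<bar>" for z z'
  proof -
    have "e * (\<bar>fst z - fst z'\<bar> + \<bar>snd z - snd z'\<bar>) \<le> e * (2 * \<bar>fst z - fst z'\<bar>)"
      using z e(1) by (intro mult_left_mono) auto
    moreover have "e * (2 * \<bar>fst z - fst z'\<bar>) \<le> (m - 1)/4 * (2 * \<bar>fst z - fst z'\<bar>)"
      "e * (2 * \<bar>fst z - fst z'\<bar>) \<le> (1 - l)/4 * (2 * \<bar>fst z - fst z'\<bar>)" using e by (intro mult_right_mono; simp)+
    moreover have "l * \<bar>snd z - snd z'\<bar> \<le> l * \<bar>fst z - fst z'\<bar>" using lm z by (intro mult_left_mono) auto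
    ultimately show ?thesis using step[OF z(1,2)] by (simp add: a_def b_def field_simps)
  qed
  have cone': "\<bar>snd (\<phi> 1 z) - snd (\<phi> 1 z')\<bar> \<le> b * \<bar>snd z - snd z'\<bar>"
    if z: "norm z < \<rho>" "norm z' < \<rho>" "\<bar>fst z - fst z'\<bar> \<le> \<bar>snd z - snd z'\<bar>" for z z'
  proof -
    have "e * (\<bar>fst z - fst z'\<bar> + \<bar>snd z - snd z'\<bar>) \<le> e * (2 * \<bar>snd z - snd z'\<bar>)"
      using z e(1) by (intro mult_left_mono) auto
    moreover have "e * (2 * \<bar>snd z - snd z'\<bar>) \<le> (1 - l)/4 * (2 * \<bar>snd z - snd z'\<bar>)"
      using e by (intro mult_right_mono) auto
    ultimately show ?thesis using step[OF z(1,2)] by (simp add: b_def field_simps)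
  qed
  show ?thesis
  proof (intro exI[of _ \<rho>] conjI r(1) allI impI)
    fix z z' assume stay: "\<forall>t\<ge>0. norm (\<phi> t z) < \<rho> \<and> norm (\<phi> t z') < \<rho>"
    show "\<bar>fst z - fst z'\<bar> \<le> \<bar>snd z - snd z'\<bar>"
    proof (rule ccontr)
      assume n: "\<not> ?thesis"
      have "a ^ n * \<bar>fst z - fst z'\<bar> \<le> \<bar>fst (\<phi> n z) - fst (\<phi> n z')\<bar> \<and>
          \<bar>snd (\<phi> n z) - snd (\<phi> n z')\<bar> \<le> \<bar>fst (\<phi> n z) - fst (\<phi> n z')\<bar>" for n :: nat
      proof (induction n)
        case 0 then show ?case using n by simp
      next
        case (Suc n)
        have [simp]: "\<phi> (1 + real n) z = \<phi> 1 (\<phi> n z)" for z by (simp add: flow_add)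
        have c: "a * \<bar>fst (\<phi> n z) - fst (\<phi> n z')\<bar> \<le> \<bar>fst (\<phi> (Suc n) z) - fst (\<phi> (Suc n) z')\<bar>"
          "\<bar>snd (\<phi> (Suc n) z) - snd (\<phi> (Suc n) z')\<bar> \<le> b * \<bar>fst (\<phi> n z) - fst (\<phi> n z')\<bar>"
          using cone[of "\<phi> n z" "\<phi> n z'"] stay[rule_format, of n] Suc by simp_all
        have "a * (a ^ n * \<bar>fst z - fst z'\<bar>) \<le> a * \<bar>fst (\<phi> n z) - fst (\<phi> n z')\<bar>"
          using Suc ab by (intro mult_left_mono) auto
        moreover have "b * \<bar>fst (\<phi> n z) - fst (\<phi> n z')\<bar> \<le> a * \<bar>fst (\<phi> n z) - fst (\<phi> n z')\<bar>"
          using ab by (intro mult_right_mono) auto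
        ultimately show ?case using c by (simp add: mult.assoc)
      qed
      moreover have "\<bar>fst (\<phi> n z) - fst (\<phi> n z')\<bar> < 2 * \<rho>" for n :: nat
        using stay[rule_format, of n] fst_le_norm[of "\<phi> n z"] fst_le_norm[of "\<phi> n z'"] by linarith
      ultimately have bd: "a ^ n * \<bar>fst z - fst z'\<bar> < 2 * \<rho>" for n by (meson le_less_trans)
      have "0 < \<bar>fst z - fst z'\<bar>" using n by linarith
      then obtain n where "2 * \<rho> / \<bar>fst z - fst z'\<bar> < a ^ n" using real_arch_pow[OF ab(1)] by blast
      then show False using bd[of n] \<open>0 < \<bar>fst z - fst z'\<bar>\<close> by (simp add: pos_divide_less_eq)
    qed
  next
    fix z z' assume stay: "\<forall>t\<le>0. norm (\<phi> t z) < \<rho> \<and> norm (\<phi> t z') < \<rho>"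
    show "\<bar>snd z - snd z'\<bar> \<le> \<bar>fst z - fst z'\<bar>"
    proof (rule ccontr)
      assume n: "\<not> ?thesis"
      define y where "y n = \<phi> (- real n) z" for n
      define y' where "y' n = \<phi> (- real n) z'" for n
      have y1: "\<phi> 1 (y (Suc n)) = y n" "\<phi> 1 (y' (Suc n)) = y' n" for n
        by (simp_all add: y_def y'_def flip: flow_add)
      have st: "norm (y n) < \<rho>" "norm (y' n) < \<rho>" for n using stay[rule_format, of "- real n"] by (auto simp: y_def y'_def)
      have "\<bar>snd z - snd z'\<bar> \<le> b ^ n * \<bar>snd (y n) - snd (y' n)\<bar> \<and>
          \<bar>fst (y n) - fst (y' n)\<bar> < \<bar>snd (y n) - snd (y' n)\<bar>" for n
      proof (induction n)
        case 0 then show ?case using n by (simp add: y_def y'_def)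
      next
        case (Suc n)
        \<comment> \<open>Were the difference not mostly vertical one step earlier in time, the
          forward cone property would make it mostly horizontal at step \<open>n\<close>.\<close>
        have f: "\<bar>fst (y (Suc n)) - fst (y' (Suc n))\<bar> < \<bar>snd (y (Suc n)) - snd (y' (Suc n))\<bar>"
        proof (rule ccontr)
          assume "\<not> ?thesis"
          then have "a * \<bar>fst (y (Suc n)) - fst (y' (Suc n))\<bar> \<le> \<bar>fst (y n) - fst (y' n)\<bar>"
            "\<bar>snd (y n) - snd (y' n)\<bar> \<le> b * \<bar>fst (y (Suc n)) - fst (y' (Suc n))\<bar>"
            using cone[OF st(1) st(2), of "Suc n" "Suc n"] by (simp_all add: y1)
          moreover have "b * \<bar>fst (y (Suc n)) - fst (y' (Suc n))\<bar> \<le> a * \<bar>fst (y (Suc n)) - fst (y' (Suc n))\<bar>"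
            using ab by (intro mult_right_mono) auto
          ultimately show False using Suc by linarith
        qed
        then have "\<bar>snd (y n) - snd (y' n)\<bar> \<le> b * \<bar>snd (y (Suc n)) - snd (y' (Suc n))\<bar>"
          using cone'[OF st(1) st(2), of "Suc n" "Suc n"] by (simp add: y1)
        then have "b ^ n * \<bar>snd (y n) - snd (y' n)\<bar> \<le> b ^ n * (b * \<bar>snd (y (Suc n)) - snd (y' (Suc n))\<bar>)"
          using ab by (intro mult_left_mono) auto
        then show ?case using Suc f by (simp add: mult_ac)
      qed
      moreover have "b ^ n * \<bar>snd (y n) - snd (y' n)\<bar> \<le> b ^ n * (2 * \<rho>)" for n
      proof (rule mult_left_mono)
        show "\<bar>snd (y n) - snd (y' n)\<bar> \<le> 2 * \<rho>"
          using st[of n] snd_le_norm[of "y n"] snd_le_norm[of "y' n"] by linarith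
      qed (use ab in auto)
      ultimately have bd: "\<bar>snd z - snd z'\<bar> \<le> b ^ n * (2 * \<rho>)" for n by (meson order_trans)
      have "0 < \<bar>snd z - snd z'\<bar> / (2 * \<rho>)" using n r(1) by auto
      then obtain n where "b ^ n < \<bar>snd z - snd z'\<bar> / (2 * \<rho>)" using real_arch_pow_inv[OF _ ab(3)] by blast
      then show False using bd[of n] r(1) by (simp add: pos_less_divide_eq)
    qed
  qed
qed

end

section \<open>Saddle charts\<close>

text \<open>Cramer's rule, with \<open>d\<close> the determinant of the two vectors. The vector
  \<open>b\<close>, later the expanding eigenvector, becomes the first axis.\<close>

lemma two_dim_coords:
  fixes a b :: "real^2"
  assumes "\<And>c. b \<noteq> c *\<^sub>R a" "a \<noteq> 0"
  obtains H :: "real^2 \<Rightarrow> real \<times> real" where "linear H" "\<And>x y. H (x *\<^sub>R b + y *\<^sub>R a) = (x, y)"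
    "\<And>z. fst (H z) *\<^sub>R b + snd (H z) *\<^sub>R a = z"
proof -
  define d where "d = a $ 1 * b $ 2 - a $ 2 * b $ 1"
  have d: "d \<noteq> 0"
  proof
    assume "d = 0"
    then have d0: "a $ 1 * b $ 2 = a $ 2 * b $ 1" by (simp add: d_def)
    have "a $ 1 \<noteq> 0 \<or> a $ 2 \<noteq> 0" using assms(2) by (auto simp: vec_eq_iff forall_2)
    then have "\<exists>c. b = c *\<^sub>R a"
    proof
      assume "a $ 1 \<noteq> 0"
      then have "b = (b $ 1 / a $ 1) *\<^sub>R a" using d0 by (auto simp: vec_eq_iff forall_2 field_simps)
      then show ?thesis by blast
    next
      assume "a $ 2 \<noteq> 0"
      then have "b = (b $ 2 / a $ 2) *\<^sub>R a" using d0 by (auto simp: vec_eq_iff forall_2 field_simps)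
      then show ?thesis by blast
    qed
    then show False using assms(1) by blast
  qed
  define H :: "real^2 \<Rightarrow> real \<times> real" where
    "H z = ((a $ 1 * z $ 2 - a $ 2 * z $ 1) / d, (z $ 1 * b $ 2 - z $ 2 * b $ 1) / d)" for z
  show thesis
  proof (rule that)
    show "linear H" by (rule linearI) (simp_all add: H_def add_divide_distrib diff_divide_distrib algebra_simps)
    show H1: "H (x *\<^sub>R b + y *\<^sub>R a) = (x, y)" for x y
    proof -
      have "a $ 1 * (x * b $ 2 + y * a $ 2) - a $ 2 * (x * b $ 1 + y * a $ 1) = x * d"
        "(x * b $ 1 + y * a $ 1) * b $ 2 - (x * b $ 2 + y * a $ 2) * b $ 1 = y * d"
        by (simp_all add: d_def algebra_simps)
      then show ?thesis using d by (simp add: H_def)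
    qed
    show "fst (H z) *\<^sub>R b + snd (H z) *\<^sub>R a = z" for z
    proof -
      have "(a $ 1 * z $ 2 - a $ 2 * z $ 1) * b $ i + (z $ 1 * b $ 2 - z $ 2 * b $ 1) * a $ i = d * z $ i" for i :: 2
        using exhaust_2[of i] by (auto simp: d_def algebra_simps)
      then have "((a $ 1 * z $ 2 - a $ 2 * z $ 1) * b $ i + (z $ 1 * b $ 2 - z $ 2 * b $ 1) * a $ i) / d = z $ i" for i
        using d by simp
      then show ?thesis by (simp add: H_def vec_eq_iff add_divide_distrib)
    qed
  qed
qed

text \<open>Eigenvectors for different eigenvalues are independent, so translating \<open>q\<close>
  to the origin and passing to the eigenbasis makes the derivative of the time-one map diagonal,
  with the expanding direction first.\<close>

lemma C1_saddle_planar: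
  assumes "C1_saddle \<psi> q"
  obtains G :: "real \<times> real \<Rightarrow> real^2" and H D l m where
    "bounded_linear G" "bounded_linear H" "\<And>z. H (G z) = z" "\<And>z. G (H z) = z"
    "planar_saddle (\<lambda>t z. H (\<psi> t (q + G z) - q)) D l m"
proof -
  from assms obtain L l m a b D0 where
    act: "continuous_action UNIV \<psi>" and q: "q \<in> Sing UNIV \<psi>"
    and D0: "\<And>p. ((\<lambda>(t, z). \<psi> t z) has_derivative blinfun_apply (D0 p)) (at p)" "continuous_on UNIV D0"
    and L: "(\<psi> 1 has_derivative L) (at q)" and ab: "a \<noteq> 0" "b \<noteq> 0" "L a = l *\<^sub>R a" "L b = m *\<^sub>R b"
    and lm: "0 < l" "l < 1" "1 < m"
    unfolding C1_saddle_def C1_map_def by blast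
  have linL: "linear L" using L has_derivative_linear by blast
  have "b \<noteq> c *\<^sub>R a" for c
  proof
    assume c: "b = c *\<^sub>R a"
    then have "m *\<^sub>R b = l *\<^sub>R b" using ab linL by (simp add: linear_scale scaleR_left_commute)
    then show False using ab lm by auto
  qed
  then obtain H :: "real^2 \<Rightarrow> real \<times> real" where H: "linear H" "\<And>x y. H (x *\<^sub>R b + y *\<^sub>R a) = (x, y)"
    "\<And>z. fst (H z) *\<^sub>R b + snd (H z) *\<^sub>R a = z" using two_dim_coords ab(1) by metis
  define G where "G z = fst z *\<^sub>R b + snd z *\<^sub>R a" for z :: "real \<times> real"
  have G: "linear G" by (rule linearI) (simp_all add: G_def algebra_simps)
  have HG: "H (G z) = z" "G (H w) = w" for z w using H by (simp_all add: G_def)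
  have bl: "bounded_linear G" "bounded_linear H" using G H(1) linear_conv_bounded_linear by blast+
  let ?\<phi> = "\<lambda>t z. H (\<psi> t (q + G z) - q)"
  let ?K = "\<lambda>p :: real \<times> real \<times> real. (fst p, G (snd p))"
  have K: "bounded_linear ?K"
    by (intro bounded_linear_Pair bounded_linear_fst bounded_linear_compose[OF bl(1)] bounded_linear_snd)
  define D where "D p = Blinfun H o\<^sub>L (D0 (fst p, q + G (snd p)) o\<^sub>L Blinfun ?K)" for p
  have Dapp: "blinfun_apply (D p) w = H (blinfun_apply (D0 (fst p, q + G (snd p))) (fst w, G (snd w)))" for p w
    using bl K by (simp add: D_def bounded_linear_Blinfun_apply)
  have psi: "\<psi> 0 w = w" "\<psi> (s + t) w = \<psi> s (\<psi> t w)" "\<psi> t q = q" for s t w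
    using act q unfolding continuous_action_def Sing_def by blast+
  have cpsi: "continuous_on UNIV (\<lambda>(t, z). \<psi> t z)" using act unfolding continuous_action_def by simp
  have "planar_saddle ?\<phi> D l m"
  proof
    show "continuous_action UNIV ?\<phi>" unfolding continuous_action_def
    proof (intro conjI allI ballI)
      show "continuous_on (UNIV \<times> UNIV) (\<lambda>(t, x). H (\<psi> t (q + G x) - q))"
        unfolding case_prod_beta
        by (intro bounded_linear.continuous_on[OF bl(2)] continuous_intros
          continuous_on_compose2[OF cpsi[unfolded case_prod_beta], of _ "\<lambda>p. (fst p, q + G (snd p))", simplified]
          bounded_linear.continuous_on[OF bl(1)])
    qed (simp_all add: psi HG)
    show "((\<lambda>(t, z). ?\<phi> t z) has_derivative blinfun_apply (D (t, z))) (at (t, z))" for t z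
    proof -
      have "((\<lambda>p. (fst p, q + G (snd p))) has_derivative ?K) (at (t, z))"
        using has_derivative_add[OF has_derivative_const[of "(0, q)"] bounded_linear_imp_has_derivative[OF K]]
        by simp
      from has_derivative_compose[OF this D0(1)]
      have "((\<lambda>p. \<psi> (fst p) (q + G (snd p))) has_derivative (\<lambda>w. blinfun_apply (D0 (t, q + G z)) (?K w))) (at (t, z))"
        by simp
      then have "((\<lambda>p. \<psi> (fst p) (q + G (snd p)) - q) has_derivative (\<lambda>w. blinfun_apply (D0 (t, q + G z)) (?K w) - 0)) (at (t, z))"
        by (intro has_derivative_diff has_derivative_const)
      from bounded_linear.has_derivative[OF bl(2) this]
      have "((\<lambda>p. H (\<psi> (fst p) (q + G (snd p)) - q)) has_derivative (\<lambda>w. H (blinfun_apply (D0 (t, q + G z)) (?K w)))) (at (t, z))"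
        by simp
      moreover have "blinfun_apply (D (t, z)) = (\<lambda>w. H (blinfun_apply (D0 (t, q + G z)) (?K w)))"
        by (rule ext) (simp add: Dapp)
      ultimately show ?thesis by (simp add: case_prod_unfold)
    qed
    have "continuous_on UNIV (\<lambda>p :: real \<times> real \<times> real. D0 (fst p, q + G (snd p)))"
      by (rule continuous_on_compose2[OF D0(2)])
         (auto intro!: continuous_intros bounded_linear.continuous_on[OF bl(1)])
    then show "continuous_on UNIV D" unfolding D_def
      by (intro continuous_intros bounded_bilinear.continuous_on[OF bounded_bilinear_blinfun_compose])
    show "?\<phi> t 0 = 0" for t using psi bl by (simp add: bounded_linear.linear linear_0)
    have D1: "blinfun_apply (D0 (1, q)) (0, w) = L w" for w
    proof -
      have "((\<lambda>z. (1::real, z)) has_derivative (\<lambda>w. (0, w))) (at q)"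
        by (intro derivative_eq_intros) auto
      from has_derivative_compose[OF this D0(1)]
      have "(\<psi> 1 has_derivative (\<lambda>w. blinfun_apply (D0 (1, q)) (0, w))) (at q)" by simp
      then show ?thesis using L has_derivative_unique by metis
    qed
    show "blinfun_apply (D (1, 0)) (0, x, y) = (m * x, l * y)" for x y
    proof -
      have "L (G (x, y)) = G (m * x, l * y)"
        using linL ab by (simp add: G_def linear_add linear_scale mult.commute)
      then show ?thesis using D1 G HG by (simp add: Dapp linear_0)
    qed
  qed (use lm in auto)
  then show thesis using that bl HG by blast
qed


definition sq :: "real \<Rightarrow> (real \<times> real) set" where "sq r = {-r<..<r} \<times> {-r<..<r}"

definition csq :: "(real \<times> real) set" where "csq = {-1..1} \<times> {-1..1}"

text \<open>
  The first coordinate is the expanding one. The last two clauses replace the local invariant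
  manifolds: on each horizontal line at most one point stays in the unit square for all positive
  times, and on each vertical line at most one for all negative times.
\<close>

definition saddle_chart ::
  "'a::topological_space set \<Rightarrow> (real \<Rightarrow> 'a \<Rightarrow> 'a) \<Rightarrow> 'a \<Rightarrow> ('a \<Rightarrow> real \<times> real) \<Rightarrow> (real \<times> real \<Rightarrow> 'a) \<Rightarrow> bool" where
  "saddle_chart S v p h k \<longleftrightarrow>
     p \<in> Sing S v \<and> k (0, 0) = p \<and>
     openin (top_of_set S) (k ` sq 2) \<and> homeomorphism (k ` sq 2) (sq 2) h k \<and>
     (\<forall>y\<in>S. \<forall>T>0. (\<forall>s\<in>{0..T}. v s y \<in> k ` sq 2 \<and> \<bar>fst (h (v s y))\<bar> < 2 * \<bar>snd (h (v s y))\<bar>) \<longrightarrow>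
        \<bar>snd (h (v T y))\<bar> < \<bar>snd (h y)\<bar>) \<and>
     (\<forall>y\<in>S. \<forall>T>0. (\<forall>s\<in>{0..T}. v s y \<in> k ` sq 2 \<and> \<bar>snd (h (v s y))\<bar> < 2 * \<bar>fst (h (v s y))\<bar>) \<longrightarrow>
        \<bar>fst (h y)\<bar> < \<bar>fst (h (v T y))\<bar>) \<and>
     (\<forall>y\<in>S. \<forall>y'\<in>S. (\<forall>t\<ge>0. v t y \<in> k ` csq \<and> v t y' \<in> k ` csq) \<longrightarrow>
        \<bar>fst (h y) - fst (h y')\<bar> \<le> \<bar>snd (h y) - snd (h y')\<bar>) \<and>
     (\<forall>y\<in>S. \<forall>y'\<in>S. (\<forall>t\<le>0. v t y \<in> k ` csq \<and> v t y' \<in> k ` csq) \<longrightarrow>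
        \<bar>snd (h y) - snd (h y')\<bar> \<le> \<bar>fst (h y) - fst (h y')\<bar>)"

lemma first_hit:
  fixes m :: "real \<Rightarrow> real"
  assumes "continuous_on {0..b} m" "m 0 < c" "c \<le> m b" "0 \<le> b"
  shows "\<exists>t. 0 \<le> t \<and> t \<le> b \<and> m t = c \<and> (\<forall>s. 0 \<le> s \<longrightarrow> s < t \<longrightarrow> m s < c)"
proof -
  let ?A = "{0..b} \<inter> m -` {c}"
  have "closed ?A" using assms(1) by (intro continuous_closed_preimage) auto
  then have "compact ?A" by (simp add: compact_eq_bounded_closed bounded_Int)
  moreover have "?A \<noteq> {}" using IVT'[of m 0 c b] assms by auto
  ultimately obtain t where "t \<in> ?A" "\<forall>s\<in>?A. t \<le> s" using compact_attains_inf[of ?A] by metis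
  then have t: "t \<in> ?A" "\<And>s. s \<in> ?A \<Longrightarrow> t \<le> s" by blast+
  show ?thesis
  proof (intro exI[of _ t] conjI allI impI)
    fix s assume s: "0 \<le> s" "s < t"
    show "m s < c"
    proof (rule ccontr)
      assume "\<not> m s < c"
      then obtain u where "0 \<le> u" "u \<le> s" "m u = c"
        using IVT'[of m 0 c s] assms(2) s(1) continuous_on_subset[OF assms(1), of "{0..s}"] s(2) t(1) by force
      then show False using t(2)[of u] s t(1) by auto
    qed
  qed (use t in auto)
qed

lemma carries_orbitsD:
  assumes "carries_orbits \<phi> U \<psi> h" "y \<in> U" "0 \<le> T" "\<forall>s\<in>{0..T}. \<phi> s y \<in> U"
  shows "\<exists>\<tau>. \<tau> 0 = 0 \<and> continuous_on {0..T} \<tau> \<and> strict_mono_on {0..T} \<tau> \<and>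
             (\<forall>s\<in>{0..T}. h (\<phi> s y) = \<psi> (\<tau> s) (h y))"
  using assms(1)[unfolded carries_orbits_def, rule_format, OF assms(2,3)] assms(4) by blast

text \<open>The chart is the orbit equivalence of the saddle followed by eigenbasis coordinates and
  a rescaling. The monotonicity clauses concern finite arcs and transfer directly. The clauses on
  staying forever are delicate: the time change could map an infinite orbit of \<open>v\<close> to a
  finite stretch of the model orbit, so they are obtained from the inverse correspondence.\<close>

lemma saddle_chart_exists:
  fixes S :: "'a::t2_space set"
  assumes act: "continuous_action S v" and sad: "saddle S v p"
    and W: "openin (top_of_set S) W" "p \<in> W"
  obtains h k where "saddle_chart S v p h k" "k ` sq 2 \<subseteq> W"
proof -
  from sad obtain \<psi> q U V h0 k0 where p: "p \<in> Sing S v" and C1: "C1_saddle \<psi> q"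
    and U: "openin (top_of_set S) U" "p \<in> U" and V: "open V" "q \<in> V"
    and hom: "homeomorphism U V h0 k0" "h0 p = q"
    and car: "carries_orbits v U \<psi> h0" "carries_orbits \<psi> V v k0"
    unfolding saddle_def by blast
  obtain G H D l m where bl: "bounded_linear G" "bounded_linear H" and HG: "\<And>z. H (G z) = z" "\<And>z. G (H z) = z"
    and pl: "planar_saddle (\<lambda>t z. H (\<psi> t (q + G z) - q)) D l m"
    by (rule C1_saddle_planar[OF C1], rule that)
  define \<phi> where "\<phi> t z = H (\<psi> t (q + G z) - q)" for t z
  have "planar_saddle \<phi> D l m" using pl by (simp add: \<phi>_def[abs_def])
  then interpret planar_saddle \<phi> D l m .
  define g where "g w = q + G w" for w
  define gi where "gi z = H (z - q)" for z
  have g: "gi (g w) = w" "g (gi z) = z" for w z using HG by (simp_all add: g_def gi_def)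
  have \<psi>g: "\<psi> t (g w) = g (\<phi> t w)" for t w using HG by (simp add: \<phi>_def g_def)
  have cg: "continuous_on A g" and cgi: "continuous_on B gi" for A B
    unfolding g_def gi_def by (auto intro!: continuous_intros bounded_linear.continuous_on[OF bl(1)] bounded_linear.continuous_on[OF bl(2)])
  have g0: "g 0 = q" using bl(1) by (simp add: g_def bounded_linear.linear linear_0)
  obtain \<rho>1 where r1: "0 < \<rho>1"
    "\<forall>z T. 0 < T \<longrightarrow> (\<forall>s\<in>{0..T}. norm (\<phi> s z) < \<rho>1 \<and> \<bar>fst (\<phi> s z)\<bar> < 2 * \<bar>snd (\<phi> s z)\<bar>) \<longrightarrow>
       \<bar>snd (\<phi> T z)\<bar> < \<bar>snd z\<bar>"
    "\<forall>z T. 0 < T \<longrightarrow> (\<forall>s\<in>{0..T}. norm (\<phi> s z) < \<rho>1 \<and> \<bar>snd (\<phi> s z)\<bar> < 2 * \<bar>fst (\<phi> s z)\<bar>) \<longrightarrow>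
       \<bar>fst z\<bar> < \<bar>fst (\<phi> T z)\<bar>" using flow_monotone by (elim exE conjE)
  obtain \<rho>2 where r2: "0 < \<rho>2"
    "\<forall>z z'. (\<forall>t\<ge>0. norm (\<phi> t z) < \<rho>2 \<and> norm (\<phi> t z') < \<rho>2) \<longrightarrow> \<bar>fst z - fst z'\<bar> \<le> \<bar>snd z - snd z'\<bar>"
    "\<forall>z z'. (\<forall>t\<le>0. norm (\<phi> t z) < \<rho>2 \<and> norm (\<phi> t z') < \<rho>2) \<longrightarrow> \<bar>snd z - snd z'\<bar> \<le> \<bar>fst z - fst z'\<bar>"
    using flow_separation by (elim exE conjE)
  have US: "U \<subseteq> S" using U(1) openin_imp_subset by blast
  define W' where "W' = h0 ` (W \<inter> U)"
  have "openin (top_of_set U) (W \<inter> U)"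
    using openin_subset_trans[of S "W \<inter> U" U] W(1) U(1) US by (auto intro: openin_Int)
  then have "openin (top_of_set V) W'"
    unfolding W'_def using homeomorphism_imp_open_map[OF hom(1)] by blast
  then have W'o: "open W'" using V(1) openin_open_trans by blast
  have W'V: "W' \<subseteq> V" using hom(1) by (auto simp: W'_def homeomorphism_def)
  have qW': "q \<in> W'" unfolding W'_def using hom(2) U(2) W(2) by blast
  have k0W: "k0 z \<in> W" "k0 z \<in> U" if "z \<in> W'" for z
    using that hom(1) by (auto simp: W'_def homeomorphism_def)
  have "open (g -` W')" using cg[of UNIV] W'o by (simp add: open_vimage)
  moreover have "0 \<in> g -` W'" using g0 qW' by simp
  ultimately obtain d where d0: "0 < d" "ball 0 d \<subseteq> g -` W'" by (meson open_contains_ball)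
  have d: "0 < d" "\<And>w. norm w < d \<Longrightarrow> g w \<in> W'" using d0 by (auto simp: subset_iff)
  \<comment> \<open>A point of \<open>sq 2\<close> scaled by \<open>r\<close> has norm below
    \<open>4 * r\<close>, so it lies in the range of both local estimates and of the neighbourhood
    \<open>W'\<close>.\<close>
  define r where "r = min d (min \<rho>1 \<rho>2) / 4"
  have r: "0 < r" using d r1(1) r2(1) by (simp add: r_def)
  have nr: "norm w < min d (min \<rho>1 \<rho>2)" if "(1/r) *\<^sub>R w \<in> sq 2" for w
  proof -
    have "\<bar>fst w / r\<bar> < 2" "\<bar>snd w / r\<bar> < 2" using that by (cases w, auto simp: sq_def)+
    then have "\<bar>fst w\<bar> < 2 * r" "\<bar>snd w\<bar> < 2 * r" using r by (simp_all add: pos_divide_less_eq abs_divide)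
    then have "norm w < 4 * r" using norm_le_coords[of w] by linarith
    then show ?thesis by (simp add: r_def)
  qed

  \<comment> \<open>The rescaled chart and its inverse\<close>
  define k where "k w = k0 (g (r *\<^sub>R w))" for w
  define h where "h z = (1/r) *\<^sub>R gi (h0 z)" for z
  have gW: "g (r *\<^sub>R w) \<in> W'" if "w \<in> sq 2" for w using d(2)[of "r *\<^sub>R w"] nr[of "r *\<^sub>R w"] that r by simp
  have hk: "h (k w) = w" if "w \<in> sq 2" for w
  proof -
    have "h0 (k0 (g (r *\<^sub>R w))) = g (r *\<^sub>R w)" using hom(1) gW[OF that] W'V by (auto simp: homeomorphism_def)
    then show ?thesis using r by (simp add: h_def k_def g)
  qed
  have kh: "k (h z) = z" if "z \<in> U" for z
    using hom(1) that r by (simp add: h_def k_def g homeomorphism_def)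
  have kW: "k ` sq 2 \<subseteq> W" "k ` sq 2 \<subseteq> U" using gW k0W by (auto simp: k_def)
  have csq2: "csq \<subseteq> sq 2" by (auto simp: csq_def sq_def)
  have hin: "h z \<in> sq 2" if "z \<in> k ` sq 2" for z using that hk by auto
  have inj: "h z \<in> A" if "z \<in> k ` A" "A \<subseteq> sq 2" for z A using that hk by auto
  have homk: "homeomorphism (k ` sq 2) (sq 2) h k"
    unfolding homeomorphism_def
  proof (intro conjI ballI)
    show "continuous_on (k ` sq 2) h" unfolding h_def
      by (intro continuous_intros continuous_on_compose2[OF cgi] continuous_on_subset[OF homeomorphism_cont1[OF hom(1)] kW(2)]) auto
    show "continuous_on (sq 2) k" unfolding k_def
      by (rule continuous_on_compose2[OF homeomorphism_cont2[OF hom(1)]])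
        (use gW W'V in \<open>auto intro!: continuous_on_compose2[OF cg] continuous_intros\<close>)
    show "h ` k ` sq 2 = sq 2" using hk by force
  qed (use hk in auto)
  have open_k: "openin (top_of_set S) (k ` sq 2)"
  proof -
    let ?A = "(\<lambda>w. g (r *\<^sub>R w)) ` sq 2"
    have "?A = (\<lambda>z. (1/r) *\<^sub>R gi z) -` sq 2"
    proof (intro equalityI subsetI)
      fix z assume "z \<in> (\<lambda>z. (1/r) *\<^sub>R gi z) -` sq 2"
      then show "z \<in> ?A" using r by (intro image_eqI[of _ _ "(1/r) *\<^sub>R gi z"]) (auto simp: g)
    qed (use r in \<open>auto simp: g\<close>)
    moreover have "open (sq 2)" by (simp add: sq_def open_Times)
    ultimately have "open ?A"
      using open_vimage[of "sq 2" "\<lambda>z. (1/r) *\<^sub>R gi z", OF _ continuous_on_scaleR[OF continuous_on_const cgi]] by simp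
    then have "openin (top_of_set V) ?A" by (intro open_subset) (use gW W'V in blast)
    moreover have "homeomorphism V U k0 h0" using hom(1) by (simp add: homeomorphism_symD)
    ultimately have "openin (top_of_set U) (k0 ` ?A)" using homeomorphism_imp_open_map by blast
    moreover have "k0 ` ?A = k ` sq 2" by (simp add: k_def image_image)
    ultimately show ?thesis using U(1) openin_trans by metis
  qed

  \<comment> \<open>Transfer of orbit arcs between the flow and the model\<close>
  have v0: "v 0 y = y" and vS: "v t y \<in> S" and vadd: "v (s + t) y = v s (v t y)" if "y \<in> S" for s t y
    using assms(1) that unfolding continuous_action_def by blast+
  \<comment> \<open>The time change is onto \<open>{0..\<tau> T}\<close> by the intermediate value
    theorem, so every intermediate point of the model arc comes from the given arc and satisfies its
    cone condition.\<close>
  have arc: "\<exists>T'>0. gi (h0 (v T y)) = \<phi> T' (gi (h0 y)) \<and>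
      (\<forall>t\<in>{0..T'}. \<exists>s\<in>{0..T}. \<phi> t (gi (h0 y)) = gi (h0 (v s y)))"
    if T: "0 < T" "y \<in> S" "\<And>s. s \<in> {0..T} \<Longrightarrow> v s y \<in> k ` sq 2" for y T
  proof -
    have "y \<in> U" using T(3)[of 0] T(1,2) kW v0 by auto
    moreover have "\<forall>s\<in>{0..T}. v s y \<in> U" using T(3) kW(2) by blast
    ultimately obtain \<tau> where \<tau>: "\<tau> 0 = 0" "continuous_on {0..T} \<tau>" "strict_mono_on {0..T} \<tau>"
        "\<forall>s\<in>{0..T}. h0 (v s y) = \<psi> (\<tau> s) (h0 y)"
      using carries_orbitsD[OF car(1), of y T] T(1) by auto
    have e: "gi (h0 (v s y)) = \<phi> (\<tau> s) (gi (h0 y))" if "s \<in> {0..T}" for s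
    proof -
      show ?thesis using \<psi>g[of "\<tau> s" "gi (h0 y)"] bspec[OF \<tau>(4) that] g by metis
    qed
    have "0 < \<tau> T" using \<tau>(1) T(1) strict_mono_onD[OF \<tau>(3), of 0 T] by simp
    moreover have "\<exists>s\<in>{0..T}. \<phi> t (gi (h0 y)) = gi (h0 (v s y))" if t: "t \<in> {0..\<tau> T}" for t
    proof -
      obtain s where "0 \<le> s" "s \<le> T" "\<tau> s = t" using IVT'[of \<tau> 0 t T] \<tau>(1,2) T(1) t by auto
      then show ?thesis using e[of s] by (intro bexI[of _ s]) auto
    qed
    ultimately show ?thesis using e[of T] T(1) by auto
  qed
  have hr: "gi (h0 z) = r *\<^sub>R h z" for z using r by (simp add: h_def)
  have cphi: "continuous_on A (\<lambda>t. \<phi> t w)" for A w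
  proof -
    have "continuous_on UNIV (\<lambda>(t, x). \<phi> t x)" using act by (simp add: continuous_action_def)
    moreover have "continuous_on A (\<lambda>t. (t, w))" by (intro continuous_intros)
    ultimately show ?thesis using continuous_on_compose2[of UNIV "\<lambda>(t, x). \<phi> t x" A "\<lambda>t. (t, w)"] by simp
  qed
  define M where "M w t = max \<bar>fst (\<phi> t w) / r\<bar> \<bar>snd (\<phi> t w) / r\<bar>" for w t
  have cM: "continuous_on A (M w)" for A w unfolding M_def using r
    by (intro continuous_intros cphi) auto
  have Mcsq: "(1/r) *\<^sub>R \<phi> t w \<in> csq \<longleftrightarrow> M w t \<le> 1" for w t
    by (cases "\<phi> t w") (simp add: csq_def M_def abs_le_iff del: abs_divide, linarith)
  have Msq: "(1/r) *\<^sub>R \<phi> t w \<in> sq 2 \<longleftrightarrow> M w t < 2" for w t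
    by (cases "\<phi> t w") (simp add: sq_def M_def abs_less_iff del: abs_divide, linarith)
  have gV: "g (\<phi> t w) \<in> V" "k0 (g (\<phi> t w)) = k ((1/r) *\<^sub>R \<phi> t w)" if "M w t < 2" for w t
    using gW[of "(1/r) *\<^sub>R \<phi> t w"] that W'V r by (auto simp: Msq k_def)
  \<comment> \<open>A model orbit that leaves the unit square first reaches some level
    \<open>c\<close> strictly between 1 and 2, where it is still inside the chart. The arc up to
    that moment is carried to a forward arc of \<open>v\<close> that ends outside the closed unit
    block.\<close>
  have stay_s: "M (gi (h0 y)) t \<le> 1" if y: "y \<in> S" "\<And>t. 0 \<le> t \<Longrightarrow> v t y \<in> k ` csq" "0 \<le> t" for y t
  proof (rule ccontr)
    let ?w = "gi (h0 y)"
    assume "\<not> M ?w t \<le> 1"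
    define c where "c = min (M ?w t) (3/2)"
    have c: "1 < c" "c < 2" "c \<le> M ?w t" using \<open>\<not> M ?w t \<le> 1\<close> by (auto simp: c_def)
    have y0: "y \<in> k ` csq" using y(2)[of 0] v0 y(1) by simp
    then have "h y \<in> csq" using inj csq2 by blast
    then have "M ?w 0 \<le> 1" using Mcsq[of 0 ?w] hr r by simp
    then obtain t2 where t2: "0 \<le> t2" "M ?w t2 = c" "\<forall>s. 0 \<le> s \<longrightarrow> s < t2 \<longrightarrow> M ?w s < c"
      using first_hit[OF cM[of "{0..t}" ?w], of c] c y(3) by auto
    have m2: "M ?w s < 2" if "s \<in> {0..t2}" for s using t2(2) t2(3)[rule_format, of s] c that by (cases "s = t2") auto
    have yU: "y \<in> U" using y0 csq2 kW by blast
    then have hV: "h0 y \<in> V" "k0 (h0 y) = y" using hom(1) by (auto simp: homeomorphism_def)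
    have "\<psi> s (h0 y) = g (\<phi> s ?w)" for s using \<psi>g[of s ?w] g(2) by metis
    then have "\<forall>s\<in>{0..t2}. \<psi> s (h0 y) \<in> V" using gV(1) m2 by simp
    then obtain \<tau> where \<tau>: "\<tau> 0 = 0" "strict_mono_on {0..t2} \<tau>"
        "\<forall>s\<in>{0..t2}. k0 (\<psi> s (h0 y)) = v (\<tau> s) (k0 (h0 y))"
      using carries_orbitsD[OF car(2) hV(1) t2(1)] by auto
    have "0 \<le> \<tau> t2" using \<tau>(1,2) t2(1) strict_mono_onD[OF \<tau>(2), of 0 t2] by (cases "t2 = 0") auto
    then have "v (\<tau> t2) y \<in> k ` csq" using y(2) by blast
    moreover have "v (\<tau> t2) y = k ((1/r) *\<^sub>R \<phi> t2 ?w)"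
      using \<tau>(3) t2(1) hV(2) gV(2)[OF m2[of t2]] \<open>\<And>s. \<psi> s (h0 y) = g (\<phi> s ?w)\<close> by auto
    ultimately have "h (k ((1/r) *\<^sub>R \<phi> t2 ?w)) \<in> csq" using inj[of _ csq] csq2 by simp
    then have "(1/r) *\<^sub>R \<phi> t2 ?w \<in> csq" using hk[of "(1/r) *\<^sub>R \<phi> t2 ?w"] Msq[of t2 ?w] m2[of t2] t2(1) by auto
    then show False using Mcsq t2(2) c(1) by auto
  qed
  have stay_u: "M (gi (h0 y)) t \<le> 1" if y: "y \<in> S" "\<And>t. t \<le> 0 \<Longrightarrow> v t y \<in> k ` csq" "t \<le> 0" for y t
  proof (rule ccontr)
    let ?w = "gi (h0 y)"
    assume "\<not> M ?w t \<le> 1"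
    define c where "c = min (M ?w t) (3/2)"
    have c: "1 < c" "c < 2" "c \<le> M ?w t" using \<open>\<not> M ?w t \<le> 1\<close> by (auto simp: c_def)
    have y0: "y \<in> k ` csq" using y(2)[of 0] v0 y(1) by simp
    then have "h y \<in> csq" using inj csq2 by blast
    then have M0: "M ?w 0 \<le> 1" using Mcsq[of 0 ?w] hr r by simp
    have "continuous_on {0..- t} (\<lambda>s. M ?w (- s))"
      by (rule continuous_on_compose2[OF cM[of UNIV]]) (auto intro: continuous_intros)
    then obtain t2 where t2: "0 \<le> t2" "M ?w (- t2) = c" "\<forall>s. 0 \<le> s \<longrightarrow> s < t2 \<longrightarrow> M ?w (- s) < c"
      using first_hit[of "- t" "\<lambda>s. M ?w (- s)" c] c y(3) M0 by auto
    have m2: "M ?w (s - t2) < 2" if "s \<in> {0..t2}" for s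
      using t2(2) t2(3)[rule_format, of "t2 - s"] c that by (cases "s = 0") auto
    have yU: "y \<in> U" using y0 csq2 kW by blast
    then have hV: "h0 y \<in> V" "k0 (h0 y) = y" using hom(1) by (auto simp: homeomorphism_def)
    \<comment> \<open>Arcs are carried in the forward direction only, so the backward arc is started
      at its earlier end.\<close>
    define y' where "y' = g (\<phi> (- t2) ?w)"
    have y': "\<psi> s y' = g (\<phi> (s - t2) ?w)" for s by (simp add: y'_def \<psi>g flip: flow_add)
    have y'V: "y' \<in> V" using gV(1) m2[of 0] t2(1) by (simp add: y'_def)
    have "\<forall>s\<in>{0..t2}. \<psi> s y' \<in> V" using gV(1) m2 y' by simp
    then obtain \<tau> where \<tau>: "\<tau> 0 = 0" "strict_mono_on {0..t2} \<tau>"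
        "\<forall>s\<in>{0..t2}. k0 (\<psi> s y') = v (\<tau> s) (k0 y')"
      using carries_orbitsD[OF car(2) y'V t2(1)] by auto
    have "0 \<le> \<tau> t2" using \<tau>(1,2) t2(1) strict_mono_onD[OF \<tau>(2), of 0 t2] by (cases "t2 = 0") auto
    then have "v (- \<tau> t2) y \<in> k ` csq" using y(2) by simp
    moreover have "k0 (\<psi> t2 y') = y" using y'[of t2] hV(2) by (simp add: g)
    then have "y = v (\<tau> t2) (k0 y')" using \<tau>(3) t2(1) by auto
    moreover have "k0 y' \<in> S" using y'V hom(1) US by (auto simp: homeomorphism_def)
    ultimately have "k0 y' \<in> k ` csq" using vadd[of "k0 y'" "- \<tau> t2" "\<tau> t2"] v0 by simp
    moreover have "k0 y' = k ((1/r) *\<^sub>R \<phi> (- t2) ?w)"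
      using gV(2)[OF m2[of 0]] t2(1) by (simp add: y'_def)
    ultimately have "h (k ((1/r) *\<^sub>R \<phi> (- t2) ?w)) \<in> csq" using inj[of _ csq] csq2 by simp
    then have "(1/r) *\<^sub>R \<phi> (- t2) ?w \<in> csq"
      using hk[of "(1/r) *\<^sub>R \<phi> (- t2) ?w"] Msq[of "- t2" ?w] m2[of 0] t2(1) by auto
    then show False using Mcsq t2(2) c(1) by auto
  qed
  have nM: "norm (\<phi> t w) < \<rho>2" if "M w t \<le> 1" for t w
    using nr[of "\<phi> t w"] that Msq[of t w] by auto
  have "saddle_chart S v p h k" unfolding saddle_chart_def
  proof (intro conjI ballI allI impI)
    show "k (0, 0) = p"
      using hom U(2) g0 by (auto simp: k_def homeomorphism_def zero_prod_def[symmetric])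
  next
    fix y T assume T: "y \<in> S" "(0::real) < T"
      "\<forall>s\<in>{0..T}. v s y \<in> k ` sq 2 \<and> \<bar>fst (h (v s y))\<bar> < 2 * \<bar>snd (h (v s y))\<bar>"
    obtain T' where T': "0 < T'" "gi (h0 (v T y)) = \<phi> T' (gi (h0 y))"
      "\<forall>t\<in>{0..T'}. \<exists>s\<in>{0..T}. \<phi> t (gi (h0 y)) = gi (h0 (v s y))" using arc[of T y] T by auto
    have "\<bar>snd (\<phi> T' (gi (h0 y)))\<bar> < \<bar>snd (gi (h0 y))\<bar>"
    proof (rule r1(2)[rule_format, OF T'(1)])
      fix t assume "t \<in> {0..T'}"
      then obtain s where s: "s \<in> {0..T}" "\<phi> t (gi (h0 y)) = gi (h0 (v s y))" using T'(3) by blast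
      have "(1/r) *\<^sub>R gi (h0 (v s y)) \<in> sq 2" using hin T(3) s(1) by (auto simp: h_def)
      then have "norm (gi (h0 (v s y))) < \<rho>1" using nr by auto
      moreover have "\<bar>fst (gi (h0 (v s y)))\<bar> < 2 * \<bar>snd (gi (h0 (v s y)))\<bar>"
        using T(3) s(1) r by (auto simp: hr abs_mult)
      ultimately show "norm (\<phi> t (gi (h0 y))) < \<rho>1 \<and> \<bar>fst (\<phi> t (gi (h0 y)))\<bar> < 2 * \<bar>snd (\<phi> t (gi (h0 y)))\<bar>"
        using s by simp
    qed
    then show "\<bar>snd (h (v T y))\<bar> < \<bar>snd (h y)\<bar>" using r T'(2)[symmetric] by (simp add: hr abs_mult)
  next
    fix y T assume T: "y \<in> S" "(0::real) < T"
      "\<forall>s\<in>{0..T}. v s y \<in> k ` sq 2 \<and> \<bar>snd (h (v s y))\<bar> < 2 * \<bar>fst (h (v s y))\<bar>"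
    obtain T' where T': "0 < T'" "gi (h0 (v T y)) = \<phi> T' (gi (h0 y))"
      "\<forall>t\<in>{0..T'}. \<exists>s\<in>{0..T}. \<phi> t (gi (h0 y)) = gi (h0 (v s y))" using arc[of T y] T by auto
    have "\<bar>fst (gi (h0 y))\<bar> < \<bar>fst (\<phi> T' (gi (h0 y)))\<bar>"
    proof (rule r1(3)[rule_format, OF T'(1)])
      fix t assume "t \<in> {0..T'}"
      then obtain s where s: "s \<in> {0..T}" "\<phi> t (gi (h0 y)) = gi (h0 (v s y))" using T'(3) by blast
      have "(1/r) *\<^sub>R gi (h0 (v s y)) \<in> sq 2" using hin T(3) s(1) by (auto simp: h_def)
      then have "norm (gi (h0 (v s y))) < \<rho>1" using nr by auto
      moreover have "\<bar>snd (gi (h0 (v s y)))\<bar> < 2 * \<bar>fst (gi (h0 (v s y)))\<bar>"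
        using T(3) s(1) r by (auto simp: hr abs_mult)
      ultimately show "norm (\<phi> t (gi (h0 y))) < \<rho>1 \<and> \<bar>snd (\<phi> t (gi (h0 y)))\<bar> < 2 * \<bar>fst (\<phi> t (gi (h0 y)))\<bar>"
        using s by simp
    qed
    then show "\<bar>fst (h y)\<bar> < \<bar>fst (h (v T y))\<bar>" using r T'(2)[symmetric] by (simp add: hr abs_mult)
  next
    fix y y' assume y: "y \<in> S" "y' \<in> S" "\<forall>t\<ge>0. v t y \<in> k ` csq \<and> v t y' \<in> k ` csq"
    have "\<bar>fst (gi (h0 y)) - fst (gi (h0 y'))\<bar> \<le> \<bar>snd (gi (h0 y)) - snd (gi (h0 y'))\<bar>"
      by (rule r2(2)[rule_format]) (use y stay_s nM in blast)
    then show "\<bar>fst (h y) - fst (h y')\<bar> \<le> \<bar>snd (h y) - snd (h y')\<bar>"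
      using r by (simp add: hr abs_mult flip: right_diff_distrib)
  next
    fix y y' assume y: "y \<in> S" "y' \<in> S" "\<forall>t\<le>0. v t y \<in> k ` csq \<and> v t y' \<in> k ` csq"
    have "\<bar>snd (gi (h0 y)) - snd (gi (h0 y'))\<bar> \<le> \<bar>fst (gi (h0 y)) - fst (gi (h0 y'))\<bar>"
      by (rule r2(3)[rule_format]) (use y stay_u nM in blast)
    then show "\<bar>snd (h y) - snd (h y')\<bar> \<le> \<bar>fst (h y) - fst (h y')\<bar>"
      using r by (simp add: hr abs_mult flip: right_diff_distrib)
  qed (use p homk open_k in auto)
  then show thesis using that kW by blast
qed

section \<open>Wandering gaps on the line\<close>

text \<open>One-sided germs of the line are represented by the filters \<^const>\<open>at_left\<close> and \<^const>\<open>at_right\<close>.\<close>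

definition one_sided :: "real filter \<Rightarrow> real \<Rightarrow> bool" where
  "one_sided F c \<longleftrightarrow> F = at_right c \<or> F = at_left c"

text \<open>A bounded increasing map has a limit from the right at \<open>c\<close> and, by
  continuity, takes every value just above that limit. Nothing is assumed at \<open>c\<close>
  itself, where the return map may be undefined.\<close>

lemma filtermap_strict_mono_at_right:
  fixes f :: "real \<Rightarrow> real"
  assumes "c < d" and cont: "continuous_on {c<..<d} f" and mono: "strict_mono_on {c<..<d} f"
    and bdd: "bounded (f ` {c<..<d})"
  shows "filtermap f (at_right c) = at_right (Inf (f ` {c<..<d}))"
proof -
  let ?J = "{c<..<d}" and ?l = "Inf (f ` {c<..<d})"
  have below: "bdd_below (f ` ?J)" using bdd by (rule bounded_imp_bdd_below)
  have ne: "?J \<noteq> {}" using \<open>c < d\<close> by simp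
  have gt: "?l < f w" if "w \<in> ?J" for w
  proof -
    have "c < w" using that by simp
    then obtain w' where "c < w'" "w' < w" by (meson dense)
    then have w': "w' \<in> ?J" "w' < w" using that by auto
    have "?l \<le> f w'" using below w' by (intro cInf_lower) auto
    also have "f w' < f w" using mono w' that by (auto simp: strict_mono_on_def)
    finally show ?thesis .
  qed
  have ex: "\<exists>w\<in>?J. w < b \<and> f w < y" if "?l < y" "c < b" for y b
  proof -
    obtain w0 where w0: "w0 \<in> ?J" "f w0 < y"
      using cInf_less_iff[of "f ` ?J" y] below ne \<open>?l < y\<close> by auto
    obtain w where w: "c < w" "w < min w0 b" using w0 \<open>c < b\<close> by (metis dense greaterThanLessThan_iff min_less_iff_conj)
    then have "w \<in> ?J" using w0 by auto
    then have "f w < f w0" using mono w w0 by (auto simp: strict_mono_on_def)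
    then show ?thesis using w w0 \<open>w \<in> ?J\<close> by force
  qed
  show ?thesis
  proof (rule antisym)
    show "filtermap f (at_right c) \<le> at_right ?l"
    proof (rule filter_leI)
      fix P assume "eventually P (at_right ?l)"
      then obtain b where b: "?l < b" "\<And>y. ?l < y \<Longrightarrow> y < b \<Longrightarrow> P y"
        by (auto simp: eventually_at_right_field)
      obtain w0 where w0: "w0 \<in> ?J" "f w0 < b" using ex[OF b(1) \<open>c < d\<close>] by auto
      have "P (f w)" if "c < w" "w < w0" for w
      proof -
        have w: "w \<in> ?J" using that w0 by auto
        then have "f w < f w0" using mono w0 that by (auto simp: strict_mono_on_def)
        then show ?thesis using b(2)[of "f w"] gt[OF w] w0 by auto
      qed
      then show "eventually P (filtermap f (at_right c))"
        using w0 by (auto simp: eventually_filtermap eventually_at_right_field intro!: exI[of _ w0])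
    qed
    show "at_right ?l \<le> filtermap f (at_right c)"
    proof (rule filter_leI)
      fix P assume "eventually P (filtermap f (at_right c))"
      then obtain b where b: "c < b" "\<And>w. c < w \<Longrightarrow> w < b \<Longrightarrow> P (f w)"
        by (auto simp: eventually_filtermap eventually_at_right_field)
      obtain w0 where w0: "c < w0" "w0 < min b d" using b \<open>c < d\<close> by (metis dense min_less_iff_conj)
      have w0J: "w0 \<in> ?J" using w0 by auto
      have "P y" if y: "?l < y" "y < f w0" for y
      proof -
        obtain w1 where w1: "w1 \<in> ?J" "w1 < w0" "f w1 < y" using ex[OF y(1) w0(1)] by auto
        have "continuous_on {w1..w0} f"
          by (rule continuous_on_subset[OF cont]) (use w1 w0J in auto)
        then obtain w where w: "w1 \<le> w" "w \<le> w0" "f w = y"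
          using IVT'[of f w1 y w0] w1 y by auto
        then show ?thesis using b(2)[of w] w1 w0 by auto
      qed
      then show "eventually P (at_right ?l)"
        using gt[OF w0J] by (auto simp: eventually_at_right_field)
    qed
  qed
qed

text \<open>A continuous injection of an interval is monotone. The decreasing case and the case of
  left germs are reflections of the increasing case at a right germ.\<close>

lemma one_sided_filtermap:
  fixes f :: "real \<Rightarrow> real"
  assumes F: "one_sided F c" and ev: "eventually (\<lambda>w. isCont f w \<and> w \<in> D \<and> f w \<in> Z) F"
    and inj: "inj_on f D" and Z: "bounded Z"
  shows "\<exists>c'. one_sided (filtermap f F) c'"
proof -
  have right: "\<exists>c'. one_sided (filtermap f (at_right c)) c'"
    if ev: "eventually (\<lambda>w. isCont f w \<and> w \<in> D \<and> f w \<in> Z) (at_right c)" and inj: "inj_on f D"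
    for f :: "real \<Rightarrow> real" and c D
  proof -
    obtain d where d: "c < d" "\<And>w. c < w \<Longrightarrow> w < d \<Longrightarrow> isCont f w \<and> w \<in> D \<and> f w \<in> Z"
      using ev by (auto simp: eventually_at_right_field)
    let ?J = "{c<..<d}"
    have cont: "continuous_on ?J f" using d by (auto intro!: continuous_at_imp_continuous_on)
    have "inj_on f ?J" using d by (auto intro: inj_on_subset[OF inj])
    then have sm: "strict_mono_on ?J f \<or> strict_antimono_on ?J f"
      using injective_eq_monotone_map[of ?J f] cont by (simp add: is_interval_oo)
    have bd: "bounded (f ` ?J)" by (rule bounded_subset[OF Z]) (use d in auto)
    show ?thesis
    proof (cases "strict_mono_on ?J f")
      case True
      then show ?thesis using filtermap_strict_mono_at_right[OF d(1) cont True bd]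
        by (auto simp: one_sided_def)
    next
      case False
      let ?g = "\<lambda>w. - f w"
      have "strict_mono_on ?J ?g" using sm False by (auto simp: monotone_on_def)
      moreover have "continuous_on ?J ?g" using cont by (intro continuous_intros)
      moreover have "bounded (?g ` ?J)" using bd by (auto simp: bounded_iff)
      ultimately have "filtermap ?g (at_right c) = at_right (Inf (?g ` ?J))"
        using filtermap_strict_mono_at_right[OF d(1)] by blast
      then have "filtermap uminus (filtermap ?g (at_right c)) = at_left (- Inf (?g ` ?J))"
        by (simp add: at_left_minus)
      then show ?thesis by (auto simp: filtermap_filtermap one_sided_def)
    qed
  qed
  show ?thesis
  proof (cases "F = at_right c")
    case True
    then show ?thesis using right[of f D c] ev inj by simp
  next
    case False
    then have Fl: "F = filtermap uminus (at_right (- c))" using F at_left_minus by (simp add: one_sided_def)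
    have cu: "isCont (\<lambda>x. f (- x)) w" if "isCont f (- w)" for w
      using isCont_o2[of w uminus f] that by auto
    have "\<exists>c'. one_sided (filtermap (\<lambda>w. f (- w)) (at_right (- c))) c'"
    proof (rule right[where D = "uminus ` D"])
      show "inj_on (\<lambda>w. f (- w)) (uminus ` D)" using inj by (auto simp: inj_on_def)
      show "\<forall>\<^sub>F w in at_right (- c). isCont (\<lambda>w. f (- w)) w \<and> w \<in> uminus ` D \<and> f (- w) \<in> Z"
        using ev unfolding Fl eventually_filtermap
        by (rule eventually_mono) (auto intro!: cu image_eqI[where x = "- _"])
    qed
    then show ?thesis by (simp add: Fl filtermap_filtermap)
  qed
qed

lemma one_sided_tendsto: "one_sided F c \<Longrightarrow> ((\<lambda>w. w) \<longlongrightarrow> c) F"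
  by (auto simp: one_sided_def intro: tendsto_ident_at)

lemma one_sided_neq: "one_sided F c \<Longrightarrow> eventually (\<lambda>w. w \<noteq> c) F"
  by (auto simp: one_sided_def eventually_at_filter)

lemma one_sided_neq_bot: "one_sided F c \<Longrightarrow> F \<noteq> bot"
  by (metis one_sided_def trivial_limit_at_left_real trivial_limit_at_right_real)

lemma one_sided_unique: "one_sided F c \<Longrightarrow> one_sided F c' \<Longrightarrow> c = c'"
  using tendsto_unique one_sided_tendsto one_sided_neq_bot by blast

lemma one_sided_sequence:
  assumes "one_sided F c" obtains w :: "nat \<Rightarrow> real" where "filterlim w F sequentially"
proof (cases "F = at_right c")
  case True
  have "(\<lambda>n. c + inverse (real (Suc n))) \<longlonglongrightarrow> c + 0"
    by (intro tendsto_intros LIMSEQ_inverse_real_of_nat)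
  then have "filterlim (\<lambda>n. c + inverse (real (Suc n))) (at_right c) sequentially"
    unfolding filterlim_at by (auto simp del: of_nat_Suc)
  then show ?thesis using True that by blast
next
  case False
  have "(\<lambda>n. c - inverse (real (Suc n))) \<longlonglongrightarrow> c - 0"
    by (intro tendsto_intros LIMSEQ_inverse_real_of_nat)
  then have "filterlim (\<lambda>n. c - inverse (real (Suc n))) (at_left c) sequentially"
    unfolding filterlim_at by (auto simp del: of_nat_Suc)
  then show ?thesis using False assms that by (auto simp: one_sided_def)
qed

text \<open>A left inverse of \<open>f\<close> on \<open>D\<close> recovers a germ contained in
  \<open>D\<close> from its image, so injectivity passes from points to germs.\<close>

lemma filtermap_inj_on_eq:
  assumes "filtermap f A = filtermap f B" "inj_on f D"
    "eventually (\<lambda>x. x \<in> D) A" "eventually (\<lambda>x. x \<in> D) B"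
  shows "A = B"
proof -
  have *: "filtermap (the_inv_into D f) (filtermap f F) = F" if "eventually (\<lambda>x. x \<in> D) F" for F
    unfolding filtermap_filtermap filter_eq_iff eventually_filtermap
  proof (intro allI)
    fix P
    have "eventually (\<lambda>x. the_inv_into D f (f x) = x) F"
      using that by eventually_elim (simp add: the_inv_into_f_f assms(2))
    then show "eventually (\<lambda>x. P (the_inv_into D f (f x))) F = eventually P F"
      using eventually_cong[of "\<lambda>x. the_inv_into D f (f x) = x" F "\<lambda>x. P (the_inv_into D f (f x))" P] by simp
  qed
  show ?thesis using assms * by metis
qed

text \<open>The germ sits at an end of its component, so a component determines at most two such
  germs. The last clause extracts from a gap that reaches far from \<open>c\<close> an interval of
  length \<open>d\<close> close to \<open>c\<close>; this also copes with unbounded components and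
  is the form in which long gaps are counted.\<close>

lemma one_sided_component:
  fixes \<Omega> :: "real set"
  assumes F: "one_sided F c" "eventually (\<lambda>w. w \<in> \<Omega>) F" and c: "c \<notin> \<Omega>"
  obtains K where "K \<in> components \<Omega>" "eventually (\<lambda>w. w \<in> K) F"
    "F = at_right (Inf K) \<or> F = at_left (Sup K)"
    "\<And>w d. w \<in> K \<Longrightarrow> 0 < d \<Longrightarrow> d \<le> \<bar>w - c\<bar> \<Longrightarrow> \<exists>m. \<bar>m - c\<bar> < d \<and> {m - d/2<..<m + d/2} \<subseteq> K"
proof (cases "F = at_right c")
  case True
  then obtain d where d: "c < d" "{c<..<d} \<subseteq> \<Omega>"
    using F by (force simp: eventually_at_right_field)
  have ne: "(c + d)/2 \<in> {c<..<d}" using d by auto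
  define K where "K = connected_component_set \<Omega> ((c + d)/2)"
  have K: "K \<in> components \<Omega>" unfolding K_def by (rule componentsI) (use ne d in blast)
  have sub: "{c<..<d} \<subseteq> K" unfolding K_def
    by (rule connected_component_maximal) (use ne d in auto)
  have cK: "c \<notin> K" using c K in_components_subset by blast
  have conn: "connected K" using K by (rule in_components_connected)
  have gt: "c < w" if "w \<in> K" for w
  proof (rule ccontr)
    assume "\<not> c < w"
    then have "w < c" using cK that by (cases "w = c") auto
    then have "c \<in> K" using connectedD_interval[OF conn that, of "(c+d)/2" c] ne sub by (meson greaterThanLessThan_iff less_imp_le subsetD)
    then show False using cK by simp
  qed
  have "Inf K = c"
  proof (rule cInf_eq)
    show "c \<le> w" if "w \<in> K" for w using gt[OF that] by simp
    show "y \<le> c" if y: "\<And>w. w \<in> K \<Longrightarrow> y \<le> w" for y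
    proof (rule ccontr)
      assume "\<not> y \<le> c"
      then have "c < min y d" using d by simp
      then obtain w where "c < w" "w < min y d" using dense by blast
      then show False using y[of w] sub by auto
    qed
  qed
  moreover have "eventually (\<lambda>w. w \<in> K) F"
    unfolding True eventually_at_right_field using sub d by (intro exI[of _ d]) auto
  moreover have "\<exists>m. \<bar>m - c\<bar> < e \<and> {m - e/2<..<m + e/2} \<subseteq> K"
    if "w \<in> K" "0 < e" "e \<le> \<bar>w - c\<bar>" for w e
  proof (intro exI[of _ "c + e/2"] conjI subsetI)
    show "\<bar>c + e/2 - c\<bar> < e" using that by simp
    fix y assume y: "y \<in> {c + e/2 - e/2<..<c + e/2 + e/2}"
    then have "c < min y d" using d by simp
    then obtain z where z: "c < z" "z < min y d" using dense by blast
    have "y \<le> w" using y that gt[of w] by auto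
    then show "y \<in> K" using connectedD_interval[OF conn, of z w y] z sub that by auto
  qed
  ultimately show ?thesis using that[of K] K True by simp
next
  case False
  then have Fl: "F = at_left c" using F by (simp add: one_sided_def)
  then obtain d where d: "d < c" "{d<..<c} \<subseteq> \<Omega>"
    using F by (force simp: eventually_at_left_field)
  have ne: "(c + d)/2 \<in> {d<..<c}" using d by auto
  define K where "K = connected_component_set \<Omega> ((c + d)/2)"
  have K: "K \<in> components \<Omega>" unfolding K_def by (rule componentsI) (use ne d in blast)
  have sub: "{d<..<c} \<subseteq> K" unfolding K_def
    by (rule connected_component_maximal) (use ne d in auto)
  have cK: "c \<notin> K" using c K in_components_subset by blast
  have conn: "connected K" using K by (rule in_components_connected)
  have gt: "w < c" if "w \<in> K" for w
  proof (rule ccontr)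
    assume "\<not> w < c"
    then have "c < w" using cK that by (cases "w = c") auto
    then have "c \<in> K" using connectedD_interval[OF conn _ that, of "(c+d)/2" c] ne sub by (meson greaterThanLessThan_iff less_imp_le subsetD)
    then show False using cK by simp
  qed
  have "Sup K = c"
  proof (rule cSup_eq)
    show "w \<le> c" if "w \<in> K" for w using gt[OF that] by simp
    show "c \<le> y" if y: "\<And>w. w \<in> K \<Longrightarrow> w \<le> y" for y
    proof (rule ccontr)
      assume "\<not> c \<le> y"
      then have "max y d < c" using d by simp
      then obtain w where "max y d < w" "w < c" using dense by blast
      then show False using y[of w] sub by auto
    qed
  qed
  moreover have "eventually (\<lambda>w. w \<in> K) F"
    unfolding Fl eventually_at_left_field using sub d by (intro exI[of _ d]) auto
  moreover have "\<exists>m. \<bar>m - c\<bar> < e \<and> {m - e/2<..<m + e/2} \<subseteq> K"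
    if "w \<in> K" "0 < e" "e \<le> \<bar>w - c\<bar>" for w e
  proof (intro exI[of _ "c - e/2"] conjI subsetI)
    show "\<bar>c - e/2 - c\<bar> < e" using that by simp
    fix y assume y: "y \<in> {c - e/2 - e/2<..<c - e/2 + e/2}"
    then have "max y d < c" using d by simp
    then obtain z where z: "max y d < z" "z < c" using dense by blast
    have "w \<le> y" using y that gt[of w] by auto
    then show "y \<in> K" using connectedD_interval[OF conn, of w z y] z sub that by auto
  qed
  ultimately show ?thesis using that[of K] K Fl by simp
qed

text \<open>
  \<open>O'\<close> collects the base points of germs that \<open>f\<close> may produce. The last clause about \<open>x0\<close> keeps the
  initial germ out of the range of \<open>f\<close> on germs, so that all iterated germs are distinct. At
  the points of \<open>Bd\<close> the map may be discontinuous or undefined; each of them lies in at most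
  one gap, hence disturbs the germs only finitely often.
\<close>

lemma wandering_gap:
  fixes f :: "real \<Rightarrow> real" and \<Omega> Y O' Bd D Z :: "real set"
  assumes Z: "bounded Z" and \<Omega>: "\<Omega> \<subseteq> Z" "open \<Omega>" "\<Omega> \<inter> Y = {}"
    and O: "O' \<subseteq> Y" "Y \<subseteq> Z" and Bd: "finite Bd" and inj: "inj_on f D"
    and \<delta>: "0 < \<delta>"
    and dom: "\<And>w. w \<in> \<Omega> \<Longrightarrow> w \<notin> Bd \<Longrightarrow> infdist w Y < \<delta> \<Longrightarrow> w \<in> D \<and> isCont f w \<and> f w \<in> \<Omega>"
    and lim: "\<And>c c' w. c \<in> O' \<Longrightarrow> (\<forall>k. w k \<in> \<Omega> \<inter> D \<and> w k \<noteq> c) \<Longrightarrow> w \<longlonglongrightarrow> c \<Longrightarrow>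
                 (\<lambda>k. f (w k)) \<longlonglongrightarrow> c' \<Longrightarrow> c' \<in> O' \<and> c' \<noteq> x0"
    and F0: "one_sided F0 x0" "x0 \<in> O'" "eventually (\<lambda>w. w \<in> \<Omega>) F0"
  shows "\<exists>I. open I \<and> I \<noteq> {} \<and> I \<subseteq> \<Omega> \<and> (\<forall>w\<in>I. \<forall>n. (f ^^ n) w \<in> D \<inter> \<Omega>) \<and>
    (\<forall>w\<in>I. \<forall>n>0. (f ^^ n) w \<notin> I) \<and> (\<forall>w\<in>I. (\<lambda>n. infdist ((f ^^ n) w) Y) \<longlonglongrightarrow> 0)"
proof -
  define F where "F n = filtermap (f ^^ n) F0" for n
  have FS: "F (Suc n) = filtermap f (F n)" for n
    by (simp add: F_def filtermap_filtermap o_def)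
  have F_0: "F 0 = F0" by (simp add: F_def filtermap_ident)
  have infd: "infdist w Y \<le> \<bar>w - c\<bar>" if "c \<in> Y" for w c
    using infdist_le[OF that, of w] by (simp add: dist_real_def)
  have dom_ev: "eventually (\<lambda>w. w \<in> D \<and> isCont f w \<and> f w \<in> \<Omega>) A"
    if A: "one_sided A c" "c \<in> O'" "eventually (\<lambda>w. w \<in> \<Omega>) A" for A c
  proof -
    have "eventually (\<lambda>w. \<forall>b\<in>Bd. w \<noteq> b) A"
    proof (subst eventually_ball_finite_distrib[OF Bd], rule ballI)
      fix b assume "b \<in> Bd"
      show "eventually (\<lambda>w. w \<noteq> b) A"
      proof (cases "b = c")
        case True then show ?thesis using one_sided_neq[OF A(1)] by simp
      next
        case False
        then show ?thesis using tendsto_imp_eventually_ne[OF one_sided_tendsto[OF A(1)]] by metis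
      qed
    qed
    moreover have "eventually (\<lambda>w. infdist w Y < \<delta>) A"
    proof -
      have "eventually (\<lambda>w. dist w c < \<delta>) A"
        using tendstoD[OF one_sided_tendsto[OF A(1)] \<delta>] .
      then show ?thesis
        by (rule eventually_mono) (use infd[of c] A(2) O in \<open>auto simp: dist_real_def intro: le_less_trans\<close>)
    qed
    ultimately show ?thesis using A(3) by eventually_elim (use dom in blast)
  qed
  have step: "\<exists>c. one_sided (F n) c \<and> c \<in> O' \<and> (0 < n \<longrightarrow> c \<noteq> x0) \<and> eventually (\<lambda>w. w \<in> \<Omega>) (F n)" for n
  proof (induction n)
    case 0 then show ?case using F0 by (auto simp: F_0)
  next
    case (Suc n)
    then obtain c where c: "one_sided (F n) c" "c \<in> O'" "eventually (\<lambda>w. w \<in> \<Omega>) (F n)" by auto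
    have ev: "eventually (\<lambda>w. w \<in> D \<and> isCont f w \<and> f w \<in> \<Omega>) (F n)" using dom_ev[OF c] .
    have "eventually (\<lambda>w. isCont f w \<and> w \<in> D \<and> f w \<in> \<Omega>) (F n)" using ev by eventually_elim auto
    then obtain c' where c': "one_sided (F (Suc n)) c'"
      using one_sided_filtermap[OF c(1) _ inj bounded_subset[OF Z \<Omega>(1)]] FS by metis
    obtain w where w: "filterlim w (F n) sequentially" using one_sided_sequence[OF c(1)] .
    have "eventually (\<lambda>x. x \<in> \<Omega> \<and> x \<in> D \<and> x \<noteq> c) (F n)"
      using ev c(3) one_sided_neq[OF c(1)] by eventually_elim auto
    then have "eventually (\<lambda>k. w k \<in> \<Omega> \<and> w k \<in> D \<and> w k \<noteq> c) sequentially"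
      using w by (rule eventually_compose_filterlim)
    then obtain N where N: "\<And>k. k \<ge> N \<Longrightarrow> w k \<in> \<Omega> \<and> w k \<in> D \<and> w k \<noteq> c"
      by (auto simp: eventually_sequentially)
    define w' where "w' k = w (k + N)" for k
    have w': "filterlim w' (F n) sequentially" unfolding w'_def
      using filterlim_compose[OF w filterlim_add_const_nat_at_top[of N]] by simp
    have "filterlim (\<lambda>k. f (w' k)) (F (Suc n)) sequentially"
      unfolding FS using w' by (auto simp: filterlim_def filtermap_mono filtermap_filtermap[symmetric])
    then have l': "(\<lambda>k. f (w' k)) \<longlonglongrightarrow> c'"
      using filterlim_compose[OF one_sided_tendsto[OF c']] by blast
    have l: "w' \<longlonglongrightarrow> c" using filterlim_compose[OF one_sided_tendsto[OF c(1)] w'] .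
    have "c' \<in> O' \<and> c' \<noteq> x0" by (rule lim[OF c(2) _ l l']) (use N in \<open>auto simp: w'_def\<close>)
    moreover have "eventually (\<lambda>w. w \<in> \<Omega>) (F (Suc n))" unfolding FS eventually_filtermap
      using ev by eventually_elim auto
    ultimately show ?case using c' by blast
  qed
  then obtain c where c: "\<And>n. one_sided (F n) (c n)" "\<And>n. c n \<in> O'" "\<And>n. 0 < n \<Longrightarrow> c n \<noteq> x0"
    "\<And>n. eventually (\<lambda>w. w \<in> \<Omega>) (F n)" by metis
  have evD: "eventually (\<lambda>w. w \<in> D) (F n)" for n
    using dom_ev[OF c(1,2,4)] by eventually_elim auto
  \<comment> \<open>Injectivity cancels common iterations, so any repetition among the germs would
    already be a return to the initial one, which \<open>c m \<noteq> x0\<close> excludes.\<close>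
  have shift: "F n = F (n + m) \<Longrightarrow> F 0 = F m" for n m
  proof (induction n)
    case (Suc n)
    then show ?case using filtermap_inj_on_eq[OF _ inj evD evD, of n "n + m"] by (simp add: FS)
  qed simp
  have inj_F: "n = m" if "F n = F m" "n \<le> m" for n m
  proof (rule ccontr)
    assume "n \<noteq> m"
    then have "F 0 = F (m - n)" "0 < m - n" using shift[of n "m - n"] that by auto
    then show False using c(3)[of "m - n"] one_sided_unique[OF c(1)[of "m - n"], of x0] F0 F_0 by metis
  qed
  have cY: "c n \<notin> \<Omega>" "c n \<in> Y" for n using c(2)[of n] O \<Omega> by auto
  have "\<exists>K. K \<in> components \<Omega> \<and> eventually (\<lambda>w. w \<in> K) (F n) \<and>
      (F n = at_right (Inf K) \<or> F n = at_left (Sup K)) \<and>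
      (\<forall>w d. w \<in> K \<longrightarrow> 0 < d \<longrightarrow> d \<le> \<bar>w - c n\<bar> \<longrightarrow> (\<exists>m. \<bar>m - c n\<bar> < d \<and> {m - d/2<..<m + d/2} \<subseteq> K))" for n
    by (rule one_sided_component[OF c(1) c(4) cY(1)]) blast
  then obtain K where K: "\<And>n. K n \<in> components \<Omega>" "\<And>n. eventually (\<lambda>w. w \<in> K n) (F n)"
      "\<And>n. F n = at_right (Inf (K n)) \<or> F n = at_left (Sup (K n))"
      "\<And>n w d. w \<in> K n \<Longrightarrow> 0 < d \<Longrightarrow> d \<le> \<bar>w - c n\<bar> \<Longrightarrow> \<exists>m. \<bar>m - c n\<bar> < d \<and> {m - d/2<..<m + d/2} \<subseteq> K n"
    by metis
  have Kne: "K n \<noteq> {}" for n using K(1) in_components_nonempty by blast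
  have same: "K n = K m" if "K n \<inter> K m \<noteq> {}" for n m
    using components_eq[OF K(1) K(1), of n m] that by blast
  \<comment> \<open>A gap has two ends, hence contains at most two of the distinct germs.\<close>
  have fin: "finite {n. K n = A}" for A
  proof (rule finite_imageD)
    show "finite (F ` {n. K n = A})"
      by (rule finite_subset[of _ "{at_right (Inf A), at_left (Sup A)}"]) (use K(3) in auto)
    show "inj_on F {n. K n = A}"
      by (rule inj_onI) (metis inj_F nat_le_linear)
  qed
  \<comment> \<open>Infinitely many long gaps would contain intervals of length \<open>d\<close>
    with centres in the bounded set \<open>Z\<close>. Two centres closer than \<open>d/2\<close>
    make the intervals overlap, hence the gaps coincide, and this would put infinitely many indices
    on one gap.\<close>
  have short: "eventually (\<lambda>n. \<forall>w\<in>K n. \<bar>w - c n\<bar> < d) sequentially" if d: "0 < d" for d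
  proof (rule ccontr)
    define N where "N = {n. \<exists>w\<in>K n. d \<le> \<bar>w - c n\<bar>}"
    assume "\<not> ?thesis"
    then have "infinite N" unfolding N_def
      by (auto simp: eventually_sequentially infinite_nat_iff_unbounded_le not_less)
    have "\<exists>m. \<bar>m - c n\<bar> < d \<and> {m - d/2<..<m + d/2} \<subseteq> K n" if "n \<in> N" for n
      using K(4) d that unfolding N_def by blast
    then obtain m where m: "\<And>n. n \<in> N \<Longrightarrow> {m n - d/2<..<m n + d/2} \<subseteq> K n" by metis
    let ?e = "enumerate N"
    have "?e i \<in> N" for i using \<open>infinite N\<close> by (rule enumerate_in_set)
    then have "m (?e i) \<in> Z" for i
    proof -
      have "m (?e i) \<in> K (?e i)" using m[OF \<open>?e i \<in> N\<close>] d by auto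
      then show ?thesis using K(1) in_components_subset \<Omega>(1) by blast
    qed
    then have "bounded (range (\<lambda>i. m (?e i)))" by (intro bounded_subset[OF Z]) auto
    then obtain l r where r: "strict_mono r" "((\<lambda>i. m (?e i)) \<circ> r) \<longlonglongrightarrow> l"
      using bounded_imp_convergent_subsequence by blast
    then have "Cauchy ((\<lambda>i. m (?e i)) \<circ> r)" using LIMSEQ_imp_Cauchy by blast
    then obtain M where M: "\<And>i j. i \<ge> M \<Longrightarrow> j \<ge> M \<Longrightarrow> dist (m (?e (r i))) (m (?e (r j))) < d/2"
      using d unfolding Cauchy_def o_def by (meson half_gt_zero)
    have "K (?e (r i)) = K (?e (r M))" if "i \<ge> M" for i
    proof (rule same)
      let ?B = "\<lambda>j. {m (?e (r j)) - d/2<..<m (?e (r j)) + d/2}"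
      have "m (?e (r i)) \<in> ?B i" "m (?e (r i)) \<in> ?B M"
        using M[OF that order_refl] d unfolding dist_real_def greaterThanLessThan_iff by linarith+
      then have "m (?e (r i)) \<in> K (?e (r i))" "m (?e (r i)) \<in> K (?e (r M))"
        using m[OF \<open>?e (r i) \<in> N\<close>] m[OF \<open>?e (r M) \<in> N\<close>] by blast+
      then show "K (?e (r i)) \<inter> K (?e (r M)) \<noteq> {}" by blast
    qed
    then have "(\<lambda>i. ?e (r i)) ` {M..} \<subseteq> {n. K n = K (?e (r M))}" by blast
    moreover have "inj_on (\<lambda>i. ?e (r i)) {M..}"
      using strict_mono_enumerate[OF \<open>infinite N\<close>] r(1)
      by (auto simp: inj_on_def strict_mono_eq)
    moreover have "infinite {M..}" by (rule infinite_Ici)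
    ultimately show False using fin finite_imageD finite_subset by metis
  qed
  have "eventually (\<lambda>n. K n \<inter> Bd = {}) sequentially"
  proof -
    have "eventually (\<lambda>n. b \<notin> K n) sequentially" for b
    proof (cases "\<exists>n. b \<in> K n")
      case True
      then obtain n0 where "b \<in> K n0" by blast
      then have "{n. b \<in> K n} \<subseteq> {n. K n = K n0}" using same by blast
      then have "finite {n. b \<in> K n}" using fin finite_subset by blast
      then show ?thesis by (simp add: eventually_cofinite cofinite_eq_sequentially[symmetric])
    qed simp
    then have "eventually (\<lambda>n. \<forall>b\<in>Bd. b \<notin> K n) sequentially"
      by (simp add: eventually_ball_finite_distrib[OF Bd])
    then show ?thesis by eventually_elim auto
  qed
  from eventually_conj[OF this short[OF \<delta>]]
  obtain n0 where n0: "\<And>n. n \<ge> n0 \<Longrightarrow> K n \<inter> Bd = {} \<and> (\<forall>w\<in>K n. \<bar>w - c n\<bar> < \<delta>)"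
    unfolding eventually_sequentially by blast
  have Kdom: "w \<in> D \<and> isCont f w \<and> f w \<in> \<Omega>" if "n \<ge> n0" "w \<in> K n" for n w
  proof (rule dom)
    show "w \<in> \<Omega>" using that K(1) in_components_subset by blast
    show "w \<notin> Bd" using n0 that by blast
    show "infdist w Y < \<delta>" using infd[OF cY(2)[of n], of w] n0 that by fastforce
  qed
  \<comment> \<open>The image of the gap is connected, avoids the complement of
    \<open>\<Omega>\<close>, and meets the next gap along the germ \<open>F (Suc n)\<close>.\<close>
  have KS: "f ` K n \<subseteq> K (Suc n)" if n: "n \<ge> n0" for n
  proof (rule components_maximal[OF K(1)])
    show "connected (f ` K n)"
      by (intro connected_continuous_image in_components_connected[OF K(1)]
          continuous_at_imp_continuous_on) (use Kdom n in auto)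
    show "f ` K n \<subseteq> \<Omega>" using Kdom n by auto
    have "eventually (\<lambda>w. f w \<in> K (Suc n)) (F n)"
      using K(2)[of "Suc n"] by (simp add: FS eventually_filtermap)
    then have "eventually (\<lambda>w. w \<in> K n \<and> f w \<in> K (Suc n)) (F n)" using K(2)[of n] by eventually_elim auto
    then obtain w where "w \<in> K n" "f w \<in> K (Suc n)"
      using eventually_happens'[OF one_sided_neq_bot[OF c(1)]] by blast
    then show "K (Suc n) \<inter> f ` K n \<noteq> {}" by blast
  qed
  \<comment> \<open>The last index at which the gap \<open>K n0\<close> occurs. Later gaps differ
    from it and are therefore disjoint from it, which makes it wandering.\<close>
  define n1 where "n1 = Max {m. K m = K n0}"
  have n1: "n1 \<ge> n0" "K n1 = K n0" unfolding n1_def using fin[of "K n0"]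
    Max_in[of "{m. K m = K n0}"] by (auto intro!: Max_ge)
  have n1': "K m \<noteq> K n1" if "m > n1" for m
  proof
    assume "K m = K n1"
    then have "m \<le> n1" unfolding n1_def using n1(2) by (intro Max_ge[OF fin]) (simp add: n1_def)
    then show False using that by simp
  qed
  have iter: "(f ^^ n) w \<in> K (n1 + n)" if "w \<in> K n1" for w n
  proof (induction n)
    case (Suc n) then show ?case using KS[of "n1 + n"] n1 by auto
  qed (use that in simp)
  show ?thesis
  proof (intro exI[of _ "K n1"] conjI ballI allI impI)
    show "open (K n1)" using open_components[OF \<Omega>(2)] K(1) by blast
    show "K n1 \<noteq> {}" by (rule Kne)
    show "K n1 \<subseteq> \<Omega>" using K(1) in_components_subset by blast
    show "(f ^^ n) w \<in> D \<inter> \<Omega>" if "w \<in> K n1" for w n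
      using Kdom[OF _ iter[OF that, of n]] n1 iter[OF that, of n] K(1)[of "n1 + n"]
        in_components_subset by fastforce
    show "(f ^^ n) w \<notin> K n1" if "w \<in> K n1" "0 < n" for w n
      using same[of "n1 + n" n1] n1'[of "n1 + n"] iter[OF that(1), of n] that(2) by auto
    show "(\<lambda>n. infdist ((f ^^ n) w) Y) \<longlonglongrightarrow> 0" if w: "w \<in> K n1" for w
    proof (rule LIMSEQ_I)
      fix e :: real assume "0 < e"
      then obtain M where M: "\<And>n. n \<ge> M \<Longrightarrow> \<forall>w\<in>K n. \<bar>w - c n\<bar> < e"
        using short by (auto simp: eventually_sequentially)
      have "infdist ((f ^^ n) w) Y < e" if "n \<ge> M" for n
        proof -
        have "\<bar>(f ^^ n) w - c (n1 + n)\<bar> < e" using M[of "n1 + n"] iter[OF w, of n] that by simp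
        then show ?thesis using infd[OF cY(2)[of "n1 + n"], of "(f ^^ n) w"] by simp
      qed
      then show "\<exists>M. \<forall>n\<ge>M. norm (infdist ((f ^^ n) w) Y - 0) < e"
        using infdist_nonneg[of _ Y] by (auto intro!: exI[of _ M])
    qed
  qed
qed

section \<open>Flows and their reversal\<close>

definition rev_action :: "(real \<Rightarrow> 'a \<Rightarrow> 'a) \<Rightarrow> real \<Rightarrow> 'a \<Rightarrow> 'a" where
  "rev_action v t = v (- t)"

lemma rev_rev [simp]: "rev_action (rev_action v) = v"
  by (simp add: rev_action_def fun_eq_iff)

locale flow =
  fixes S :: "'a::t2_space set" and v :: "real \<Rightarrow> 'a \<Rightarrow> 'a"
  assumes compact_S: "compact S" and action: "continuous_action S v"
begin

lemma v0 [simp]: "x \<in> S \<Longrightarrow> v 0 x = x"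
  and v_in [simp]: "x \<in> S \<Longrightarrow> v t x \<in> S"
  and v_add: "x \<in> S \<Longrightarrow> v (s + t) x = v s (v t x)"
  using action unfolding continuous_action_def by blast+

lemma v_inverse [simp]: "x \<in> S \<Longrightarrow> v t (v (- t) x) = x" "x \<in> S \<Longrightarrow> v (- t) (v t x) = x"
  by (simp_all flip: v_add)

lemma closed_S: "closed S" using compact_S by (rule compact_imp_closed)

lemma closure_sub: "A \<subseteq> S \<Longrightarrow> closure A \<subseteq> S"
  using closed_S by (simp add: closure_minimal)

lemma v_cont: "continuous_on (UNIV \<times> S) (\<lambda>(t, x). v t x)"
  using action by (simp add: continuous_action_def)

lemma v_cont_time: "x \<in> S \<Longrightarrow> continuous_on A (\<lambda>t. v t x)"
  using continuous_on_compose2[OF v_cont, of A "\<lambda>t. (t, x)"]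
  by (simp add: continuous_on_Pair image_subset_iff)

lemma v_cont_space: "continuous_on S (v t)"
  using continuous_on_compose2[OF v_cont, of S "\<lambda>x. (t, x)"]
  by (simp add: continuous_on_Pair image_subset_iff)

lemma v_tendsto_eventually:
  assumes "(t \<longlongrightarrow> t0) F" "(x \<longlongrightarrow> x0) F" "eventually (\<lambda>i. x i \<in> S) F" "x0 \<in> S"
  shows "((\<lambda>i. v (t i) (x i)) \<longlongrightarrow> v t0 x0) F"
proof -
  have "((\<lambda>i. (t i, x i)) \<longlongrightarrow> (t0, x0)) F" using assms by (intro tendsto_intros)
  from continuous_on_tendsto_compose[OF v_cont this] assms show ?thesis
    by (auto elim: eventually_mono)
qed

lemma v_tendsto:
  assumes "(t \<longlongrightarrow> t0) F" "(x \<longlongrightarrow> x0) F" "\<And>i. x i \<in> S" "x0 \<in> S"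
  shows "((\<lambda>i. v (t i) (x i)) \<longlongrightarrow> v t0 x0) F"
  using assms by (intro v_tendsto_eventually) simp_all

lemma v_nbhd:
  assumes "openin (top_of_set S) N" "x \<in> S" "v t x \<in> N"
  shows "\<exists>e>0. \<exists>M. openin (top_of_set S) M \<and> x \<in> M \<and> (\<forall>y\<in>M. \<forall>s. \<bar>s - t\<bar> < e \<longrightarrow> v s y \<in> N)"
proof -
  obtain T where T: "open T" "N = S \<inter> T" using assms(1) by (auto simp: openin_open)
  obtain A where A: "open A" "(\<lambda>(t, x). v t x) -` T \<inter> (UNIV \<times> S) = A \<inter> (UNIV \<times> S)"
    using continuous_on_open_invariant[of "UNIV \<times> S" "\<lambda>(t, x). v t x"] v_cont T(1) by metis
  have "(t, x) \<in> A" using A(2) assms T(2) by auto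
  then obtain B C where BC: "open B" "open C" "t \<in> B" "x \<in> C" "B \<times> C \<subseteq> A"
    using open_prod_elim[OF A(1)] by (metis mem_Sigma_iff)
  obtain e where e: "0 < e" "ball t e \<subseteq> B" using BC by (meson open_contains_ball)
  have "v s y \<in> N" if "y \<in> S \<inter> C" "\<bar>s - t\<bar> < e" for y s
  proof -
    have "s \<in> ball t e" using that by (simp add: dist_real_def abs_minus_commute)
    then have "(s, y) \<in> A" using that BC(5) e(2) by blast
    then have "(s, y) \<in> (\<lambda>(t, x). v t x) -` T" using A(2) that by auto
    then show ?thesis using T(2) that by auto
  qed
  then show ?thesis using e(1) BC assms(2)
    by (intro exI[of _ e] conjI exI[of _ "S \<inter> C"]) (auto simp: openin_open)
qed

lemma v_nbhd_time:
  assumes "openin (top_of_set S) N" "x \<in> S" "v t x \<in> N"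
  shows "\<exists>e>0. \<forall>s. \<bar>s - t\<bar> < e \<longrightarrow> v s x \<in> N"
  using v_nbhd[OF assms] by blast

lemma v_closure:
  assumes "y \<in> closure A" "A \<subseteq> S" "v t ` A \<subseteq> B"
  shows "v t y \<in> closure B"
proof -
  have "v t ` closure A \<subseteq> closure B"
  proof (rule image_closure_subset)
    show "continuous_on (closure A) (v t)"
      using closure_sub[OF assms(2)] continuous_on_subset[OF v_cont_space] by blast
    show "v t ` A \<subseteq> closure B" using assms(3) closure_subset by blast
  qed simp
  then show ?thesis using assms(1) by blast
qed

section \<open>Limit sets\<close>

lemma mem_omega_iff: "y \<in> omega_limit v x \<longleftrightarrow> (\<forall>N t. open N \<longrightarrow> y \<in> N \<longrightarrow> (\<exists>s\<ge>t. v s x \<in> N))"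
proof -
  have "y \<in> closure ((\<lambda>s. v s x) ` {t..}) \<longleftrightarrow> (\<forall>N. open N \<longrightarrow> y \<in> N \<longrightarrow> (\<exists>s\<ge>t. v s x \<in> N))" for t
  proof -
    let ?A = "(\<lambda>s. v s x) ` {t..}"
    have "y \<in> closure ?A \<longleftrightarrow> (\<forall>N. open N \<longrightarrow> y \<in> N \<longrightarrow> N \<inter> ?A \<noteq> {})"
    proof
      show "y \<in> closure ?A \<Longrightarrow> \<forall>N. open N \<longrightarrow> y \<in> N \<longrightarrow> N \<inter> ?A \<noteq> {}"
        using open_Int_closure_eq_empty[of _ ?A] by blast
      assume a: "\<forall>N. open N \<longrightarrow> y \<in> N \<longrightarrow> N \<inter> ?A \<noteq> {}"
      show "y \<in> closure ?A"
      proof (rule ccontr)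
        assume "y \<notin> closure ?A"
        then have "(- closure ?A) \<inter> ?A \<noteq> {}" using a[rule_format, of "- closure ?A"] by (simp add: open_Compl)
        then show False using closure_subset[of ?A] by blast
      qed
    qed
    then show ?thesis by auto
  qed
  then show ?thesis unfolding omega_limit_def by auto
qed

lemma omega_closed: "closed (omega_limit v x)"
  unfolding omega_limit_def by (intro closed_INT) auto

lemma omega_sub: "x \<in> S \<Longrightarrow> omega_limit v x \<subseteq> S"
proof -
  assume "x \<in> S"
  then have "closure ((\<lambda>s. v s x) ` {0..}) \<subseteq> S" by (intro closure_sub) auto
  then show ?thesis unfolding omega_limit_def by blast
qed

text \<open>Outside the neighbourhood \<open>S\<close> is compact and covered by the open
  complements of the closed tails of the orbit; a finite subcover gives the time.\<close>

lemma omega_attracts: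
  assumes x: "x \<in> S" and N: "openin (top_of_set S) N" "omega_limit v x \<subseteq> N"
  shows "\<exists>T. \<forall>t\<ge>T. v t x \<in> N"
proof -
  obtain T where T: "open T" "N = S \<inter> T" using N(1) by (auto simp: openin_open)
  have "compact (S - T)" using compact_S T(1) by (rule compact_diff)
  moreover have "S - T \<subseteq> (\<Union>n::nat. - closure ((\<lambda>s. v s x) ` {real n..}))"
  proof
    fix y assume y: "y \<in> S - T"
    then have "y \<notin> omega_limit v x" using N(2) T(2) by blast
    then obtain t where "y \<notin> closure ((\<lambda>s. v s x) ` {t..})" by (auto simp: omega_limit_def)
    moreover obtain n :: nat where "t \<le> n" using real_arch_simple by blast
    then have "closure ((\<lambda>s. v s x) ` {real n..}) \<subseteq> closure ((\<lambda>s. v s x) ` {t..})"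
      by (intro closure_mono image_mono) auto
    ultimately show "y \<in> (\<Union>n::nat. - closure ((\<lambda>s. v s x) ` {real n..}))" by blast
  qed
  ultimately obtain F where F: "finite F" "S - T \<subseteq> (\<Union>n\<in>F. - closure ((\<lambda>s. v s x) ` {real n..}))"
    using compactE_image[of "S - T" UNIV "\<lambda>n::nat. - closure ((\<lambda>s. v s x) ` {real n..})"] by (auto simp: open_Compl)
  have "v t x \<in> N" if "t \<ge> real (Max (insert 0 F))" for t
  proof (rule ccontr)
    assume "v t x \<notin> N"
    then have "v t x \<in> S - T" using T(2) x by auto
    then obtain n where n: "n \<in> F" "v t x \<notin> closure ((\<lambda>s. v s x) ` {real n..})" using F(2) by blast
    have "n \<le> Max (insert 0 F)" using n(1) F(1) by simp
    then have "real n \<le> t" using that by (meson of_nat_mono order_trans)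
    then have "v t x \<in> (\<lambda>s. v s x) ` {real n..}" by auto
    then show False using n(2) subsetD[OF closure_subset] by metis
  qed
  then show ?thesis by (intro exI allI impI)
qed

lemma omega_nonempty: "x \<in> S \<Longrightarrow> omega_limit v x \<noteq> {}"
  using omega_attracts[of x "{}"] by auto

lemma omega_shift: assumes "x \<in> S" shows "omega_limit v (v r x) = omega_limit v x"
proof -
  have "(\<exists>s\<ge>t. v s (v r x) \<in> N) \<longleftrightarrow> (\<exists>s\<ge>t + r. v s x \<in> N)" for N t
  proof safe
    fix s assume "t \<le> s" "v s (v r x) \<in> N"
    then show "\<exists>s\<ge>t + r. v s x \<in> N" using assms by (intro exI[of _ "s + r"]) (auto simp: v_add)
  next
    fix s assume "t + r \<le> s" "v s x \<in> N"
    then show "\<exists>s\<ge>t. v s (v r x) \<in> N" using assms by (intro exI[of _ "s - r"]) (auto simp flip: v_add)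
  qed
  then have "y \<in> omega_limit v (v r x) \<longleftrightarrow> y \<in> omega_limit v x" for y
    unfolding mem_omega_iff by (metis diff_add_cancel)
  then show ?thesis by blast
qed

lemma omega_invariant: assumes "x \<in> S" "y \<in> omega_limit v x" shows "v r y \<in> omega_limit v x"
  unfolding omega_limit_def
proof (rule INT_I)
  fix t
  have "v r y \<in> closure ((\<lambda>s. v s x) ` {t..})"
  proof (rule v_closure[where A = "(\<lambda>s. v s x) ` {t - r..}"])
    show "y \<in> closure ((\<lambda>s. v s x) ` {t - r..})" using assms(2) by (auto simp: omega_limit_def)
    show "v r ` (\<lambda>s. v s x) ` {t - r..} \<subseteq> (\<lambda>s. v s x) ` {t..}"
    proof safe
      fix s assume "t - r \<le> s"
      then show "v r (v s x) \<in> (\<lambda>s. v s x) ` {t..}"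
        using assms(1) by (intro image_eqI[of _ _ "r + s"]) (auto simp: v_add)
    qed
  qed (use assms in auto)
  then show "v r y \<in> closure ((\<lambda>s. v s x) ` {t..})" .
qed

lemma omega_sub_closed:
  assumes "closed A" "\<And>t. t \<ge> 0 \<Longrightarrow> v t y \<in> A" shows "omega_limit v y \<subseteq> A"
proof -
  have "closure ((\<lambda>s. v s y) ` {0..}) \<subseteq> A" using assms by (intro closure_minimal) auto
  then show ?thesis unfolding omega_limit_def by blast
qed

text \<open>Up to any time the orbit is a compact arc, so a point of the closure that is not on the
  orbit lies in the closure of every tail.\<close>

lemma closure_pos_orbit: assumes "x \<in> S" shows "closure (pos_orbit v x) = pos_orbit v x \<union> omega_limit v x"
proof
  show "pos_orbit v x \<union> omega_limit v x \<subseteq> closure (pos_orbit v x)"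
    using closure_subset[of "pos_orbit v x"] unfolding omega_limit_def pos_orbit_def by blast
  show "closure (pos_orbit v x) \<subseteq> pos_orbit v x \<union> omega_limit v x"
  proof
    fix y assume y: "y \<in> closure (pos_orbit v x)"
    show "y \<in> pos_orbit v x \<union> omega_limit v x"
    proof (rule ccontr)
      assume n: "y \<notin> pos_orbit v x \<union> omega_limit v x"
      then obtain t where t: "y \<notin> closure ((\<lambda>s. v s x) ` {t..})" by (auto simp: omega_limit_def)
      have "pos_orbit v x \<subseteq> (\<lambda>s. v s x) ` {0..max t 0} \<union> (\<lambda>s. v s x) ` {t..}"
      proof
        fix z assume "z \<in> pos_orbit v x"
        then obtain s where "0 \<le> s" "z = v s x" by (auto simp: pos_orbit_def)
        then show "z \<in> (\<lambda>s. v s x) ` {0..max t 0} \<union> (\<lambda>s. v s x) ` {t..}"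
          by (cases "s \<le> t") auto
      qed
      then have "closure (pos_orbit v x) \<subseteq> closure ((\<lambda>s. v s x) ` {0..max t 0}) \<union> closure ((\<lambda>s. v s x) ` {t..})"
        by (metis closure_Un closure_mono)
      moreover have "closed ((\<lambda>s. v s x) ` {0..max t 0})"
        by (intro compact_imp_closed compact_continuous_image v_cont_time assms) auto
      ultimately have "y \<in> (\<lambda>s. v s x) ` {0..max t 0}" using y t by (auto simp: closure_closed)
      then show False using n by (auto simp: pos_orbit_def)
    qed
  qed
qed

lemma periodic_omega: assumes "x \<in> S" "0 < t" "v t x = x" shows "x \<in> omega_limit v x"
  unfolding mem_omega_iff
proof (intro allI impI)
  fix N u assume N: "open N" "x \<in> N"
  have "v (real n * t) x = x" for n
    by (induction n) (use assms in \<open>auto simp: distrib_right v_add\<close>)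
  moreover obtain n where "u < real n * t" using reals_Archimedean3[OF assms(2)] by blast
  ultimately show "\<exists>s\<ge>u. v s x \<in> N" using N by (metis less_imp_le)
qed

lemma SingD: "p \<in> Sing S v \<Longrightarrow> p \<in> S" "p \<in> Sing S v \<Longrightarrow> v t p = p"
  by (auto simp: Sing_def)

lemma omega_Sing: assumes "p \<in> Sing S v" shows "omega_limit v p = {p}"
  unfolding omega_limit_def SingD(2)[OF assms] by (auto simp: image_constant_conv)

lemma pos_orbit_sub: "x \<in> S \<Longrightarrow> pos_orbit v x \<subseteq> S"
  by (auto simp: pos_orbit_def)

lemma Wu_sub: "Wu S v p \<subseteq> S" by (auto simp: Wu_def)

lemma ext_pos_base: "pos_orbit v x \<subseteq> ext_pos_orbit S v x"
  unfolding ext_pos_orbit_def using stages.base by fast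

lemma ext_pos_step:
  assumes "x' \<in> ext_pos_orbit S v x" "omega_limit v x' = {p}" "saddle S v p"
  shows "Wu S v p \<subseteq> ext_pos_orbit S v x"
proof -
  obtain B where B: "B \<in> stages (pos_step S v) (pos_orbit v x)" "x' \<in> B"
    using assms(1) by (auto simp: ext_pos_orbit_def)
  have "Wu S v p \<subseteq> pos_step S v B" using B(2) assms(2,3) by (auto simp: pos_step_def)
  then show ?thesis using stages.succ[OF B(1)] by (auto simp: ext_pos_orbit_def)
qed

text \<open>Together with \<open>ext_pos_base\<close> and \<open>ext_pos_step\<close> this presents
  the extended positive orbit as the least set that contains the positive orbit and is closed under
  passing through saddles. Apart from time reversal, later arguments use this description instead of
  the transfinite stages.\<close>

lemma ext_pos_least:
  assumes "pos_orbit v x \<subseteq> A"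
    "\<And>x' p. x' \<in> A \<Longrightarrow> omega_limit v x' = {p} \<Longrightarrow> saddle S v p \<Longrightarrow> Wu S v p \<subseteq> A"
  shows "ext_pos_orbit S v x \<subseteq> A"
proof -
  have "B \<subseteq> A" if "B \<in> stages (pos_step S v) (pos_orbit v x)" for B
    using that
  proof induction
    case (succ B)
    then show ?case unfolding pos_step_def using assms(2) by blast
  qed (use assms(1) in blast)+
  then show ?thesis by (auto simp: ext_pos_orbit_def)
qed

lemma ext_pos_sub: "x \<in> S \<Longrightarrow> ext_pos_orbit S v x \<subseteq> S"
  by (rule ext_pos_least) (use pos_orbit_sub Wu_sub in auto)

end

section \<open>Time reversal of all notions\<close>

lemma alpha_rev: "alpha_limit v x = omega_limit (rev_action v) x"
proof -
  have "(\<lambda>s. v s x) ` {..t} = (\<lambda>s. rev_action v s x) ` {- t..}" for t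
  proof -
    have "{..t} = uminus ` {- t..}" by simp
    then show ?thesis by (simp only: image_image rev_action_def)
  qed
  then have "alpha_limit v x = (\<Inter>t. closure ((\<lambda>s. rev_action v s x) ` {- t..}))"
    by (simp add: alpha_limit_def)
  moreover have "(\<Inter>t::real. A (- t)) = (\<Inter>t. A t)" for A :: "real \<Rightarrow> 'a set"
  proof -
    have "(\<Inter>t::real. A (- t)) = \<Inter> (A ` range uminus)" by (simp only: image_image)
    then show ?thesis by simp
  qed
  ultimately show ?thesis by (simp only: omega_limit_def)
qed

lemma omega_rev: "omega_limit v x = alpha_limit (rev_action v) x"
  by (simp add: alpha_rev)

lemma neg_orbit_rev: "neg_orbit v x = pos_orbit (rev_action v) x"
proof -
  have "{..0::real} = uminus ` {0..}" by simp
  then show ?thesis unfolding neg_orbit_def pos_orbit_def rev_action_def by (simp only: image_image)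
qed

lemma Sing_rev: "Sing S (rev_action v) = Sing S v"
proof -
  have "(\<forall>t. v (- t) x = x) \<longleftrightarrow> (\<forall>t. v t x = x)" for x by (metis add.inverse_inverse)
  then show ?thesis by (simp add: Sing_def rev_action_def)
qed

lemma Ws_rev: "Ws S v = Wu S (rev_action v)"
  by (rule ext) (simp add: Ws_def Wu_def omega_rev)

lemma continuous_action_rev:
  assumes "continuous_action S v" shows "continuous_action S (rev_action v)"
proof -
  have "continuous_on (UNIV \<times> S) (\<lambda>p. (- fst p :: real, snd p))"
    by (intro continuous_intros)
  moreover have "(\<lambda>p. (- fst p, snd p)) ` (UNIV \<times> S) \<subseteq> (UNIV::real set) \<times> S" by auto
  ultimately have "continuous_on (UNIV \<times> S) (\<lambda>(t, x). v (- t) x)"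
    using continuous_on_compose2[of "UNIV \<times> S" "\<lambda>(t, x). v t x" "UNIV \<times> S" "\<lambda>p. (- fst p, snd p)"] assms
    by (auto simp: continuous_action_def case_prod_unfold intro!: continuous_intros)
  then show ?thesis using assms unfolding continuous_action_def rev_action_def
    by (simp only: minus_add_distrib minus_zero) blast
qed

text \<open>A reversed arc from \<open>y\<close> is a forward arc from its other end
  \<open>y'\<close>, and reading the time change from that end gives
  \<open>\<tau> T - \<tau> (T - s)\<close>.\<close>

lemma carries_orbits_rev:
  assumes v: "continuous_action S v" and \<psi>: "continuous_action R \<psi>" and U: "U \<subseteq> S" "h ` U \<subseteq> R"
    and c: "carries_orbits v U \<psi> h"
  shows "carries_orbits (rev_action v) U (rev_action \<psi>) h"
  unfolding carries_orbits_def
proof (intro ballI allI impI)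
  fix y T assume y: "y \<in> U" "0 \<le> T" "\<forall>s\<in>{0..T}. rev_action v s y \<in> U"
  have v_add: "v (s + t) x = v s (v t x)" and v0: "v 0 x = x" if "x \<in> S" for s t x
    using v that unfolding continuous_action_def by blast+
  have p_add: "\<psi> (s + t) x = \<psi> s (\<psi> t x)" if "x \<in> R" for s t x
    using \<psi> that unfolding continuous_action_def by blast
  define y' where "y' = v (- T) y"
  have y': "y' \<in> U" using y(2,3) by (auto simp: y'_def rev_action_def)
  have yS: "y \<in> S" using y U by blast
  have vy': "v s y' = v (s - T) y" for s using v_add[OF yS, of s "- T"] by (simp add: y'_def)
  have "v s y' \<in> U" if "s \<in> {0..T}" for s using y(3)[rule_format, of "T - s"] that by (simp add: vy' rev_action_def)
  then obtain \<tau> where \<tau>: "\<tau> 0 = 0" "continuous_on {0..T} \<tau>" "strict_mono_on {0..T} \<tau>"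
      "\<forall>s\<in>{0..T}. h (v s y') = \<psi> (\<tau> s) (h y')" using carries_orbitsD[OF c y' y(2)] by blast
  have hy: "h y = \<psi> (\<tau> T) (h y')" using \<tau>(4) y(2) vy'[of T] v0[OF yS] by force
  have hy': "h y' \<in> R" using y' U by blast
  show "\<exists>\<tau>. \<tau> 0 = 0 \<and> continuous_on {0..T} \<tau> \<and> strict_mono_on {0..T} \<tau> \<and>
      (\<forall>s\<in>{0..T}. h (rev_action v s y) = rev_action \<psi> (\<tau> s) (h y))"
  proof (intro exI[of _ "\<lambda>s. \<tau> T - \<tau> (T - s)"] conjI ballI)
    show "continuous_on {0..T} (\<lambda>s. \<tau> T - \<tau> (T - s))"
      by (intro continuous_intros continuous_on_compose2[OF \<tau>(2)]) auto
    show "strict_mono_on {0..T} (\<lambda>s. \<tau> T - \<tau> (T - s))"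
      by (rule strict_mono_onI) (use strict_mono_onD[OF \<tau>(3)] in auto)
    fix s assume s: "s \<in> {0..T}"
    then have "h (v (T - s) y') = \<psi> (\<tau> (T - s)) (h y')" using \<tau>(4) by auto
    also have "\<dots> = \<psi> (\<tau> (T - s) - \<tau> T) (h y)"
      using p_add[OF hy', of "\<tau> (T - s) - \<tau> T" "\<tau> T"] by (simp add: hy)
    finally show "h (rev_action v s y) = rev_action \<psi> (\<tau> T - \<tau> (T - s)) (h y)"
      by (simp add: rev_action_def vy')
  qed simp
qed

text \<open>The derivative of the time \<open>-1\<close> map inverts \<open>L\<close>, so the
  eigenvectors exchange roles, with eigenvalues \<open>1/m\<close> and \<open>1/l\<close>.\<close>

lemma C1_saddle_rev: assumes "C1_saddle \<psi> q" shows "C1_saddle (rev_action \<psi>) q"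
proof -
  from assms obtain L l m a b D where
    act: "continuous_action UNIV \<psi>" and q: "q \<in> Sing UNIV \<psi>"
    and D: "\<And>p. ((\<lambda>(t, z). \<psi> t z) has_derivative blinfun_apply (D p)) (at p)" "continuous_on UNIV D"
    and L: "(\<psi> 1 has_derivative L) (at q)" and ab: "a \<noteq> 0" "b \<noteq> 0" "L a = l *\<^sub>R a" "L b = m *\<^sub>R b"
    and lm: "0 < l" "l < 1" "1 < m"
    unfolding C1_saddle_def C1_map_def by blast
  let ?K = "\<lambda>p :: real \<times> (real^2). (- fst p, snd p)"
  have K: "bounded_linear ?K"
    by (intro bounded_linear_Pair bounded_linear_minus bounded_linear_fst bounded_linear_snd)
  define D' where "D' p = D (?K p) o\<^sub>L Blinfun ?K" for p
  have "((\<lambda>(t, z). rev_action \<psi> t z) has_derivative blinfun_apply (D' p)) (at p)" for p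
  proof -
    have "(?K has_derivative ?K) (at p)" by (rule bounded_linear_imp_has_derivative[OF K])
    from has_derivative_compose[OF this D(1)]
    have "((\<lambda>x. \<psi> (- fst x) (snd x)) has_derivative (\<lambda>x. blinfun_apply (D (?K p)) (?K x))) (at p)" by simp
    moreover have "blinfun_apply (D' p) = (\<lambda>x. blinfun_apply (D (?K p)) (?K x))"
      by (rule ext) (simp add: D'_def bounded_linear_Blinfun_apply[OF K])
    ultimately show ?thesis by (simp add: case_prod_unfold rev_action_def)
  qed
  moreover have "continuous_on UNIV D'"
  proof -
    have "continuous_on UNIV (\<lambda>p. D (?K p))"
      by (rule continuous_on_compose2[OF D(2)]) (auto intro!: continuous_intros)
    then show ?thesis unfolding D'_def
      by (intro continuous_intros bounded_bilinear.continuous_on[OF bounded_bilinear_blinfun_compose])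
  qed
  ultimately have C1: "C1_map (\<lambda>(t, z). rev_action \<psi> t z)" unfolding C1_map_def by blast
  have psi: "\<psi> 0 w = w" "\<psi> (s + t) w = \<psi> s (\<psi> t w)" "\<psi> t q = q" for s t w
    using act q unfolding continuous_action_def Sing_def by blast+
  define L' where "L' w = blinfun_apply (D (- 1, q)) (0, w)" for w
  have L': "(\<psi> (- 1) has_derivative L') (at q)"
  proof -
    have "((\<lambda>z. (- 1::real, z)) has_derivative (\<lambda>w. (0, w))) (at q)"
      by (intro derivative_eq_intros) auto
    from has_derivative_compose[OF this D(1)] show ?thesis by (simp add: L'_def[abs_def])
  qed
  have "((\<lambda>z. \<psi> (- 1) (\<psi> 1 z)) has_derivative (\<lambda>w. L' (L w))) (at q)"
    using has_derivative_compose[OF L, of "\<psi> (- 1)" L'] L' by (simp add: psi(3))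
  moreover have "(\<lambda>z. \<psi> (- 1) (\<psi> 1 z)) = (\<lambda>z. z)" using psi by (simp add: fun_eq_iff flip: psi(2))
  ultimately have "(\<lambda>w. L' (L w)) = (\<lambda>w. w)" using has_derivative_unique has_derivative_ident by metis
  then have inv: "L' (L w) = w" for w by meson
  have linL': "linear L'" using L' has_derivative_linear by blast
  have "L' a = (1/l) *\<^sub>R a" "L' b = (1/m) *\<^sub>R b"
    using inv[of a] inv[of b] ab lm linL' by (simp_all add: linear_scale) (metis less_irrefl less_trans scaleR_one scaleR_scaleR nonzero_divide_eq_eq zero_less_one inverse_eq_divide divide_self)+
  then have "(rev_action \<psi> 1 has_derivative L') (at q) \<and> b \<noteq> 0 \<and> a \<noteq> 0 \<and>
      L' b = (1/m) *\<^sub>R b \<and> L' a = (1/l) *\<^sub>R a \<and> 0 < 1/m \<and> 1/m < 1 \<and> 1 < 1/l"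
    using L' ab lm by (simp add: rev_action_def)
  then show ?thesis
    unfolding C1_saddle_def
    using C1 continuous_action_rev[OF act] q Sing_rev[of UNIV \<psi>] by metis
qed

lemma saddle_rev: assumes v: "continuous_action S v" and s: "saddle S v p" shows "saddle S (rev_action v) p"
proof -
  from s obtain \<psi> q U V h0 k0 where p: "p \<in> Sing S v" and C1: "C1_saddle \<psi> q"
    and U: "openin (top_of_set S) U" "p \<in> U" and V: "open V" "q \<in> V"
    and hom: "homeomorphism U V h0 k0" "h0 p = q"
    and car: "carries_orbits v U \<psi> h0" "carries_orbits \<psi> V v k0"
    unfolding saddle_def by blast
  have US: "U \<subseteq> S" using U(1) openin_imp_subset by blast
  have \<psi>: "continuous_action UNIV \<psi>" using C1 by (simp add: C1_saddle_def)
  have "carries_orbits (rev_action v) U (rev_action \<psi>) h0"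
    by (rule carries_orbits_rev[OF v \<psi> US _ car(1)]) simp
  moreover have "carries_orbits (rev_action \<psi>) V (rev_action v) k0"
    by (rule carries_orbits_rev[OF \<psi> v _ _ car(2)]) (use hom US in \<open>auto simp: homeomorphism_def\<close>)
  ultimately show ?thesis unfolding saddle_def
    using p C1_saddle_rev[OF C1] U V hom by (metis Sing_rev)
qed

lemma saddle_rev_iff: "continuous_action S v \<Longrightarrow> saddle S (rev_action v) p \<longleftrightarrow> saddle S v p"
  using saddle_rev[of S v p] saddle_rev[of S "rev_action v" p] continuous_action_rev[of S v] by auto

lemma neg_step_rev: "continuous_action S v \<Longrightarrow> neg_step S v = pos_step S (rev_action v)"
  by (rule ext) (simp add: neg_step_def pos_step_def Ws_rev alpha_rev saddle_rev_iff)

lemma ext_neg_rev: "continuous_action S v \<Longrightarrow> ext_neg_orbit S v x = ext_pos_orbit S (rev_action v) x"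
  by (simp add: ext_neg_orbit_def ext_pos_orbit_def neg_step_rev neg_orbit_rev)

lemma ext_pos_rev: "continuous_action S v \<Longrightarrow> ext_pos_orbit S v x = ext_neg_orbit S (rev_action v) x"
  by (simp add: ext_neg_rev continuous_action_rev)

lemma ext_orbit_rev: "continuous_action S v \<Longrightarrow> ext_orbit S (rev_action v) x = ext_orbit S v x"
  unfolding ext_orbit_def using ext_neg_rev[of S v x] ext_pos_rev[of S v x] by auto

lemma ext_neg_recurrent_rev:
  "continuous_action S v \<Longrightarrow> ext_neg_recurrent_pt S v x \<longleftrightarrow> ext_pos_recurrent_pt S (rev_action v) x"
  by (simp add: ext_neg_recurrent_pt_def ext_pos_recurrent_pt_def alpha_rev ext_neg_rev neg_orbit_rev)

lemma ext_pap_rev: "continuous_action S v \<Longrightarrow> ext_pap S (rev_action v) \<longleftrightarrow> ext_pap S v"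
  by (simp add: ext_pap_def ext_orbit_rev)

lemma (in flow) flow_rev: "flow S (rev_action v)"
  using compact_S continuous_action_rev[OF action] by unfold_locales

section \<open>Isolating blocks\<close>

text \<open>Joint continuity gives a neighbourhood of \<open>x\<close> for each time, and
  compactness of \<open>{a..b}\<close> a common one.\<close>

lemma (in flow) tube:
  assumes N: "openin (top_of_set S) N" and x: "x \<in> S" and arc: "\<forall>s\<in>{a..b}. v s x \<in> N"
  shows "\<exists>M. openin (top_of_set S) M \<and> x \<in> M \<and> (\<forall>y\<in>M. \<forall>s\<in>{a..b}. v s y \<in> N)"
proof -
  have "\<forall>s\<in>{a..b}. \<exists>e>0. \<exists>M. openin (top_of_set S) M \<and> x \<in> M \<and> (\<forall>y\<in>M. \<forall>u. \<bar>u - s\<bar> < e \<longrightarrow> v u y \<in> N)"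
    using v_nbhd[OF N x] arc by blast
  then obtain e M where eM: "\<forall>s\<in>{a..b}. 0 < e s \<and> openin (top_of_set S) (M s) \<and> x \<in> M s \<and>
      (\<forall>y\<in>M s. \<forall>u. \<bar>u - s\<bar> < e s \<longrightarrow> v u y \<in> N)" by metis
  have "{a..b} \<subseteq> (\<Union>s\<in>{a..b}. ball s (e s))" using eM by force
  then obtain F where F: "F \<subseteq> {a..b}" "finite F" "{a..b} \<subseteq> (\<Union>s\<in>F. ball s (e s))"
    using compactE_image[OF compact_Icc, of "{a..b}" "\<lambda>s. ball s (e s)" a b] by auto
  let ?M = "S \<inter> (\<Inter>s\<in>F. M s)"
  have "openin (top_of_set S) (\<Inter> (insert S (M ` F)))"
    using eM F by (intro openin_Inter) auto
  moreover have "v s y \<in> N" if y: "y \<in> ?M" and s: "s \<in> {a..b}" for y s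
  proof -
    obtain u where u: "u \<in> F" "s \<in> ball u (e u)" using F(3) s by blast
    then have "\<bar>s - u\<bar> < e u" by (simp add: dist_real_def abs_minus_commute)
    then show ?thesis using eM F(1) y u(1) by blast
  qed
  ultimately show ?thesis using x eM F(1) by (intro exI[of _ ?M]) auto
qed

locale chart = flow +
  fixes p h k
  assumes chart: "saddle_chart S v p h k"
begin

text \<open>Orbits enter the block \<open>B\<close> through \<open>E\<close> and leave it through \<open>X\<close>; the corners belong to both.\<close>

definition "U = k ` sq 2"
definition "B = k ` csq"
definition "Bo = k ` sq 1"
definition "E = k ` ({-1..1} \<times> {-1, 1})"
definition "Eo = k ` ({-1<..<1} \<times> {-1, 1})"
definition "X = k ` ({-1, 1} \<times> {-1..1})"
definition "Rs = {z \<in> U. \<bar>fst (h z)\<bar> < 2 * \<bar>snd (h z)\<bar>}"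
definition "Ru = {z \<in> U. \<bar>snd (h z)\<bar> < 2 * \<bar>fst (h z)\<bar>}"

lemma Sing_p: "p \<in> Sing S v" and k0: "k (0, 0) = p" and open_U: "openin (top_of_set S) U"
  and homeo: "homeomorphism U (sq 2) h k"
  using chart unfolding saddle_chart_def U_def by blast+

lemma mono_s: "y \<in> S \<Longrightarrow> 0 < T \<Longrightarrow> \<forall>s\<in>{0..T}. v s y \<in> Rs \<Longrightarrow> \<bar>snd (h (v T y))\<bar> < \<bar>snd (h y)\<bar>"
  using chart unfolding saddle_chart_def Rs_def U_def by blast

lemma mono_u: "y \<in> S \<Longrightarrow> 0 < T \<Longrightarrow> \<forall>s\<in>{0..T}. v s y \<in> Ru \<Longrightarrow> \<bar>fst (h y)\<bar> < \<bar>fst (h (v T y))\<bar>"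
  using chart unfolding saddle_chart_def Ru_def U_def by blast

lemma cone_s: "y \<in> S \<Longrightarrow> y' \<in> S \<Longrightarrow> \<forall>t\<ge>0. v t y \<in> B \<Longrightarrow> \<forall>t\<ge>0. v t y' \<in> B \<Longrightarrow>
    \<bar>fst (h y) - fst (h y')\<bar> \<le> \<bar>snd (h y) - snd (h y')\<bar>"
  using chart unfolding saddle_chart_def B_def by blast

lemma cone_u: "y \<in> S \<Longrightarrow> y' \<in> S \<Longrightarrow> \<forall>t\<le>0. v t y \<in> B \<Longrightarrow> \<forall>t\<le>0. v t y' \<in> B \<Longrightarrow>
    \<bar>snd (h y) - snd (h y')\<bar> \<le> \<bar>fst (h y) - fst (h y')\<bar>"
  using chart unfolding saddle_chart_def B_def by blast

lemma U_sub: "U \<subseteq> S" using open_U openin_imp_subset by blast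

lemma hk [simp]: "w \<in> sq 2 \<Longrightarrow> h (k w) = w" and kh [simp]: "z \<in> U \<Longrightarrow> k (h z) = z"
  using homeo by (auto simp: homeomorphism_def)

lemma h_cont: "continuous_on U h" and k_cont: "continuous_on (sq 2) k"
  using homeo by (auto simp: homeomorphism_def)

lemma image_k: "A \<subseteq> sq 2 \<Longrightarrow> k ` A = {z \<in> U. h z \<in> A}"
proof (intro equalityI subsetI)
  fix z assume A: "A \<subseteq> sq 2" and z: "z \<in> k ` A"
  then obtain w where "w \<in> A" "z = k w" by blast
  then show "z \<in> {z \<in> U. h z \<in> A}" using A hk[of w] by (auto simp: U_def)
next
  fix z assume "z \<in> {z \<in> U. h z \<in> A}"
  then show "z \<in> k ` A" by (intro image_eqI[of z k "h z"]) auto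
qed

lemma sq_subs: "csq \<subseteq> sq 2" "sq 1 \<subseteq> sq 2" "{-1..1} \<times> {-1, 1} \<subseteq> sq 2" "{-1, 1} \<times> {-1..1} \<subseteq> sq 2"
   "{-1<..<1} \<times> {-1, 1} \<subseteq> sq 2"
  by (auto simp: csq_def sq_def)

lemma mem_B: "z \<in> B \<longleftrightarrow> z \<in> U \<and> \<bar>fst (h z)\<bar> \<le> 1 \<and> \<bar>snd (h z)\<bar> \<le> 1"
  and mem_Bo: "z \<in> Bo \<longleftrightarrow> z \<in> U \<and> \<bar>fst (h z)\<bar> < 1 \<and> \<bar>snd (h z)\<bar> < 1"
  and mem_E: "z \<in> E \<longleftrightarrow> z \<in> U \<and> \<bar>fst (h z)\<bar> \<le> 1 \<and> \<bar>snd (h z)\<bar> = 1"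
  and mem_Eo: "z \<in> Eo \<longleftrightarrow> z \<in> U \<and> \<bar>fst (h z)\<bar> < 1 \<and> \<bar>snd (h z)\<bar> = 1"
  and mem_X: "z \<in> X \<longleftrightarrow> z \<in> U \<and> \<bar>fst (h z)\<bar> = 1 \<and> \<bar>snd (h z)\<bar> \<le> 1"
  unfolding B_def Bo_def E_def Eo_def X_def image_k[OF sq_subs(1)] image_k[OF sq_subs(2)] image_k[OF sq_subs(3)]
    image_k[OF sq_subs(4)] image_k[OF sq_subs(5)]
  by (auto simp: csq_def sq_def mem_Times_iff abs_le_iff abs_less_iff)

lemma compacts: "compact B" "compact E" "compact X"
  unfolding B_def E_def X_def
  by (intro compact_continuous_image continuous_on_subset[OF k_cont] sq_subs compact_Times; simp add: csq_def compact_Times)+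

lemma open_h: assumes "open A" shows "openin (top_of_set S) {z \<in> U. h z \<in> A}"
proof -
  have "openin (top_of_set U) (U \<inter> h -` A)" using h_cont assms by (rule continuous_openin_preimage_gen)
  moreover have "U \<inter> h -` A = {z \<in> U. h z \<in> A}" by auto
  ultimately show ?thesis using open_U openin_trans by metis
qed

lemma open_Bo: "openin (top_of_set S) Bo" and open_Rs: "openin (top_of_set S) Rs" and open_Ru: "openin (top_of_set S) Ru"
  and open_fst: "openin (top_of_set S) {z \<in> U. \<bar>fst (h z)\<bar> < 1}" and open_snd: "openin (top_of_set S) {z \<in> U. \<bar>snd (h z)\<bar> < 1}"
proof -
  have "open {w::real\<times>real. \<bar>fst w\<bar> < 2 * \<bar>snd w\<bar>}" "open {w::real\<times>real. \<bar>snd w\<bar> < 2 * \<bar>fst w\<bar>}"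
    "open {w::real\<times>real. \<bar>fst w\<bar> < 1}" "open {w::real\<times>real. \<bar>snd w\<bar> < 1}"
    by (intro open_Collect_less continuous_intros)+
  from open_h[OF this(1)] open_h[OF this(2)] open_h[OF this(3)] open_h[OF this(4)] open_h[OF open_Int[OF this(3,4)]]
  show "openin (top_of_set S) Rs" "openin (top_of_set S) Ru" "openin (top_of_set S) {z \<in> U. \<bar>fst (h z)\<bar> < 1}"
    "openin (top_of_set S) {z \<in> U. \<bar>snd (h z)\<bar> < 1}" "openin (top_of_set S) Bo"
    unfolding Rs_def Ru_def by (simp_all, smt (verit, best) Collect_cong mem_Bo Collect_mem_eq)
qed

lemma open_not: "closed A \<Longrightarrow> openin (top_of_set S) (S - A)"
  by (metis Diff_Compl Int_commute open_Compl openin_open Diff_eq)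

lemma B_sub: "B \<subseteq> U" "Bo \<subseteq> B" "E \<subseteq> B" "X \<subseteq> B" "Eo \<subseteq> E" "E \<subseteq> Rs" "X \<subseteq> Ru"
  by (auto simp: mem_B mem_Bo mem_E mem_X mem_Eo Rs_def Ru_def)

lemma p_B: "p \<in> Bo" "p \<in> S" "h p = (0, 0)"
proof -
  have 0: "(0, 0) \<in> sq 2" by (simp add: sq_def)
  then show "h p = (0, 0)" using hk[OF 0] k0 by simp
  then show "p \<in> Bo" using 0 k0 by (auto simp: mem_Bo U_def)
  then show "p \<in> S" using B_sub U_sub by blast
qed

lemma decrease:
  assumes "z \<in> Rs"
  shows "\<exists>e>0. \<forall>t. 0 < t \<longrightarrow> t < e \<longrightarrow> v t z \<in> Rs \<and> v (- t) z \<in> Rs \<and>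
     \<bar>snd (h (v t z))\<bar> < \<bar>snd (h z)\<bar> \<and> \<bar>snd (h z)\<bar> < \<bar>snd (h (v (- t) z))\<bar>"
proof -
  have z: "z \<in> S" using assms U_sub by (auto simp: Rs_def)
  obtain e where e: "0 < e" "\<forall>s. \<bar>s - 0\<bar> < e \<longrightarrow> v s z \<in> Rs"
    using v_nbhd_time[OF open_Rs z, of 0] assms z by auto
  have "\<bar>snd (h (v t z))\<bar> < \<bar>snd (h z)\<bar>" if "0 < t" "t < e" for t
    by (rule mono_s) (use e z that in auto)
  moreover have "\<bar>snd (h (v t (v (- t) z)))\<bar> < \<bar>snd (h (v (- t) z))\<bar>" if "0 < t" "t < e" for t
    by (rule mono_s) (use e z that in \<open>auto simp flip: v_add\<close>)
  ultimately show ?thesis using e z by (intro exI[of _ e]) auto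
qed

lemma increase:
  assumes "z \<in> Ru"
  shows "\<exists>e>0. \<forall>t. 0 < t \<longrightarrow> t < e \<longrightarrow> v t z \<in> Ru \<and> v (- t) z \<in> Ru \<and>
     \<bar>fst (h z)\<bar> < \<bar>fst (h (v t z))\<bar> \<and> \<bar>fst (h (v (- t) z))\<bar> < \<bar>fst (h z)\<bar>"
proof -
  have z: "z \<in> S" using assms U_sub by (auto simp: Ru_def)
  obtain e where e: "0 < e" "\<forall>s. \<bar>s - 0\<bar> < e \<longrightarrow> v s z \<in> Ru"
    using v_nbhd_time[OF open_Ru z, of 0] assms z by auto
  have "\<bar>fst (h z)\<bar> < \<bar>fst (h (v t z))\<bar>" if "0 < t" "t < e" for t
    by (rule mono_u) (use e z that in auto)
  moreover have "\<bar>fst (h (v (- t) z))\<bar> < \<bar>fst (h (v t (v (- t) z)))\<bar>" if "0 < t" "t < e" for t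
    by (rule mono_u) (use e z that in \<open>auto simp flip: v_add\<close>)
  ultimately show ?thesis using e z by (intro exI[of _ e]) auto
qed

text \<open>Reversing time exchanges the expanding and the contracting coordinate, and swapping
  coordinates restores the axioms of a chart. Facts about entering and stable separatrices thus
  yield facts about leaving and unstable separatrices.\<close>

lemma chart_rev: "chart S (rev_action v) p (prod.swap \<circ> h) (k \<circ> prod.swap)"
proof -
  interpret r: flow S "rev_action v" by (rule flow_rev)
  have sw: "prod.swap ` sq 2 = sq 2" "prod.swap ` csq = csq" by (auto simp: sq_def csq_def image_iff)
  have im: "(k \<circ> prod.swap) ` sq 2 = U" "(k \<circ> prod.swap) ` csq = B"
    unfolding image_comp[symmetric] sw U_def B_def by (rule refl)+
  have arc: "v s (v (- T) y) = v (s - T) y" if "y \<in> S" for s T y using v_add[OF that, of s "- T"] by simp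
  have "saddle_chart S (rev_action v) p (prod.swap \<circ> h) (k \<circ> prod.swap)"
    unfolding saddle_chart_def im
  proof (intro conjI ballI allI impI)
    show "p \<in> Sing S (rev_action v)" using Sing_p by (simp add: Sing_rev)
    show "(k \<circ> prod.swap) (0, 0) = p" using k0 by simp
    show "openin (top_of_set S) U" by (rule open_U)
    have "homeomorphism (sq 2) (sq 2) prod.swap prod.swap"
      by (auto simp: homeomorphism_def sw continuous_on_swap)
    from homeomorphism_compose[OF homeo this]
    show "homeomorphism U (sq 2) (prod.swap \<circ> h) (k \<circ> prod.swap)" .
  next
    fix y T assume y: "y \<in> S" "0 < (T::real)"
      "\<forall>s\<in>{0..T}. rev_action v s y \<in> U \<and> \<bar>fst ((prod.swap \<circ> h) (rev_action v s y))\<bar> < 2 * \<bar>snd ((prod.swap \<circ> h) (rev_action v s y))\<bar>"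
    have "v (s - T) y \<in> Ru" if "s \<in> {0..T}" for s
      using y(3)[rule_format, of "T - s"] that by (auto simp: Ru_def rev_action_def)
    then have "\<bar>fst (h (v (- T) y))\<bar> < \<bar>fst (h (v T (v (- T) y)))\<bar>"
      using y by (intro mono_u) (auto simp: arc)
    then show "\<bar>snd ((prod.swap \<circ> h) (rev_action v T y))\<bar> < \<bar>snd ((prod.swap \<circ> h) y)\<bar>"
      using y by (simp add: rev_action_def)
  next
    fix y T assume y: "y \<in> S" "0 < (T::real)"
      "\<forall>s\<in>{0..T}. rev_action v s y \<in> U \<and> \<bar>snd ((prod.swap \<circ> h) (rev_action v s y))\<bar> < 2 * \<bar>fst ((prod.swap \<circ> h) (rev_action v s y))\<bar>"
    have "v (s - T) y \<in> Rs" if "s \<in> {0..T}" for s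
      using y(3)[rule_format, of "T - s"] that by (auto simp: Rs_def rev_action_def)
    then have "\<bar>snd (h (v T (v (- T) y)))\<bar> < \<bar>snd (h (v (- T) y))\<bar>"
      using y by (intro mono_s) (auto simp: arc)
    then show "\<bar>fst ((prod.swap \<circ> h) y)\<bar> < \<bar>fst ((prod.swap \<circ> h) (rev_action v T y))\<bar>"
      using y by (simp add: rev_action_def)
  next
    fix y y' assume y: "y \<in> S" "y' \<in> S" "\<forall>t\<ge>0. rev_action v t y \<in> B \<and> rev_action v t y' \<in> B"
    have "v t y \<in> B \<and> v t y' \<in> B" if "t \<le> 0" for t using y(3)[rule_format, of "- t"] that by (simp add: rev_action_def)
    then show "\<bar>fst ((prod.swap \<circ> h) y) - fst ((prod.swap \<circ> h) y')\<bar> \<le> \<bar>snd ((prod.swap \<circ> h) y) - snd ((prod.swap \<circ> h) y')\<bar>"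
      using cone_u[OF y(1,2)] by simp
  next
    fix y y' assume y: "y \<in> S" "y' \<in> S" "\<forall>t\<le>0. rev_action v t y \<in> B \<and> rev_action v t y' \<in> B"
    have "v t y \<in> B \<and> v t y' \<in> B" if "0 \<le> t" for t using y(3)[rule_format, of "- t"] that by (simp add: rev_action_def)
    then show "\<bar>snd ((prod.swap \<circ> h) y) - snd ((prod.swap \<circ> h) y')\<bar> \<le> \<bar>fst ((prod.swap \<circ> h) y) - fst ((prod.swap \<circ> h) y')\<bar>"
      using cone_s[OF y(1,2)] by simp
  qed
  then show ?thesis by unfold_locales
qed

text \<open>Take the earliest time from which the orbit stays in \<open>B\<close> until
  \<open>t1\<close>. The point there is not interior. If it had \<open>\<bar>fst\<bar> = 1\<close>
  and \<open>\<bar>snd\<bar> < 1\<close>, then \<open>\<bar>fst\<bar>\<close> would decrease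
  backwards and the orbit would have been in \<open>B\<close> before.\<close>

lemma entry:
  assumes z: "z \<in> S" and t: "t0 < t1" "v t0 z \<notin> B" "v t1 z \<in> B"
  shows "\<exists>t. t0 < t \<and> t \<le> t1 \<and> v t z \<in> E \<and> (\<forall>s\<in>{t..t1}. v s z \<in> B)"
proof -
  define A where "A = {t. t0 \<le> t \<and> t \<le> t1 \<and> (\<forall>s\<in>{t..t1}. v s z \<in> B)}"
  define t where "t = Inf A"
  have A1: "t1 \<in> A" using t by (auto simp: A_def)
  have bdd: "bdd_below A" by (auto simp: A_def bdd_below_def)
  have t01: "t0 \<le> t" "t \<le> t1" unfolding t_def using A1 bdd by (auto intro!: cInf_greatest cInf_lower simp: A_def)
  have after: "v s z \<in> B" if s: "t < s" "s \<le> t1" for s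
  proof -
    obtain a where "a \<in> A" "a < s" using cInf_lessD[of A s] A1 s(1) unfolding t_def by blast
    then show ?thesis using s by (auto simp: A_def)
  qed
  have tB: "v t z \<in> B"
  proof (rule ccontr)
    assume "v t z \<notin> B"
    then have "v t z \<in> S - B" using z by simp
    then obtain e where e: "0 < e" "\<forall>s. \<bar>s - t\<bar> < e \<longrightarrow> v s z \<in> S - B"
      using v_nbhd_time[OF open_not z] compacts(1) compact_imp_closed by blast
    have "t < t1" using \<open>v t z \<notin> B\<close> t t01 by (cases "t = t1") auto
    then show False using after[of "min t1 (t + e/2)"] e by auto
  qed
  then have "t0 < t" using t01 t(2) by (cases "t = t0") auto
  have all: "\<forall>s\<in>{t..t1}. v s z \<in> B" using after tB by force
  have before: "\<exists>s. u < s \<and> s < t \<and> v s z \<notin> B" if "u < t" "t0 \<le> u" for u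
  proof (rule ccontr)
    assume n: "\<not> ?thesis"
    have "(u + t)/2 \<in> A" using n all that t01 by (force simp: A_def)
    then have "t \<le> (u + t)/2" unfolding t_def by (rule cInf_lower[OF _ bdd])
    then show False using that by simp
  qed
  have contra: False if e: "0 < e" "\<And>s. 0 < s \<Longrightarrow> s < e \<Longrightarrow> v (- s) (v t z) \<in> B" for e
  proof -
    have "\<exists>s. max t0 (t - e) < s \<and> s < t \<and> v s z \<notin> B" using before[of "max t0 (t - e)"] e(1) \<open>t0 < t\<close> by simp
    then obtain s where s: "max t0 (t - e) < s" "s < t" "v s z \<notin> B" by blast
    then show False using e(2)[of "t - s"] z by (simp flip: v_add)
  qed
  let ?w = "v t z"
  have wS: "?w \<in> S" and wU: "?w \<in> U" using z tB by (auto simp: mem_B)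
  have "?w \<in> E"
  proof (rule ccontr)
    assume nE: "?w \<notin> E"
    then have s1: "\<bar>snd (h ?w)\<bar> < 1" using tB by (auto simp: mem_B mem_E)
    show False
    proof (cases "\<bar>fst (h ?w)\<bar> < 1")
      case True
      then have "v 0 ?w \<in> Bo" using s1 wU wS by (simp add: mem_Bo)
      then obtain e where "0 < e" "\<forall>s. \<bar>s - 0\<bar> < e \<longrightarrow> v s ?w \<in> Bo"
        using v_nbhd_time[OF open_Bo wS] by blast
      then show False using contra[of e] B_sub(2) by (force simp: abs_if)
    next
      case False
      then have f1: "\<bar>fst (h ?w)\<bar> = 1" using tB by (auto simp: mem_B)
      then have "?w \<in> Ru" using s1 wU by (simp add: Ru_def)
      then obtain e where e: "0 < e" "\<forall>t. 0 < t \<longrightarrow> t < e \<longrightarrow> \<bar>fst (h (v (- t) ?w))\<bar> < \<bar>fst (h ?w)\<bar>"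
        using increase by blast
      have "v 0 ?w \<in> {z \<in> U. \<bar>snd (h z)\<bar> < 1}" using s1 wU wS by simp
      then obtain e' where e': "0 < e'" "\<forall>s. \<bar>s - 0\<bar> < e' \<longrightarrow> v s ?w \<in> {z \<in> U. \<bar>snd (h z)\<bar> < 1}"
        using v_nbhd_time[OF open_snd wS] by blast
      have "v (- s) ?w \<in> B" if "0 < s" "s < min e e'" for s
        using e(2)[rule_format, of s] e'(2)[rule_format, of "- s"] that f1 by (auto simp: mem_B)
      then show False using contra[of "min e e'"] e e' by auto
    qed
  qed
  then show ?thesis using \<open>t0 < t\<close> t01 all by blast
qed

text \<open>Just before reaching \<open>E\<close> the contracting coordinate exceeds 1.\<close>

lemma no_reentry:
  assumes z: "z \<in> S" and t: "0 < t" "\<And>s. 0 \<le> s \<Longrightarrow> s \<le> t \<Longrightarrow> v s z \<in> B"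
  shows "v t z \<notin> E"
proof
  assume E: "v t z \<in> E"
  then obtain e where e: "0 < e" "\<forall>s. 0 < s \<longrightarrow> s < e \<longrightarrow> \<bar>snd (h (v t z))\<bar> < \<bar>snd (h (v (- s) (v t z)))\<bar>"
    using decrease[of "v t z"] B_sub(6) by blast
  define s where "s = min t (e/2)"
  have s: "0 < s" "s < e" "s \<le> t" using e t by (auto simp: s_def)
  have "v (- s) (v t z) = v (t - s) z" using z by (simp flip: v_add)
  then have "\<bar>snd (h (v t z))\<bar> < 1" using e(2)[rule_format, OF s(1,2)] t(2)[of "t - s"] s by (simp add: mem_B)
  then show False using E by (simp add: mem_E)
qed

text \<open>Off the corners \<open>\<bar>fst\<bar> < 1\<close> persists for a short time, and the
  strict decrease of \<open>\<bar>snd\<bar>\<close> makes the passage a crossing. At a corner the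
  orbit only touches the block, which is why the return map may jump there.\<close>

lemma Eo_cross:
  assumes "z \<in> Eo"
  shows "\<exists>e>0. \<forall>t. 0 < t \<longrightarrow> t < e \<longrightarrow> v t z \<in> Bo \<and> v (- t) z \<notin> B"
proof -
  have z: "z \<in> S" "z \<in> U" "\<bar>fst (h z)\<bar> < 1" "\<bar>snd (h z)\<bar> = 1" "z \<in> Rs"
    using assms U_sub B_sub by (auto simp: mem_Eo Rs_def)
  obtain e where e: "0 < e" "\<forall>t. 0 < t \<longrightarrow> t < e \<longrightarrow>
     \<bar>snd (h (v t z))\<bar> < \<bar>snd (h z)\<bar> \<and> \<bar>snd (h z)\<bar> < \<bar>snd (h (v (- t) z))\<bar>"
    using decrease[OF z(5)] by blast
  have "v 0 z \<in> {z \<in> U. \<bar>fst (h z)\<bar> < 1}" using z by simp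
  then obtain e' where e': "0 < e'" "\<forall>s. \<bar>s - 0\<bar> < e' \<longrightarrow> v s z \<in> {z \<in> U. \<bar>fst (h z)\<bar> < 1}"
    using v_nbhd_time[OF open_fst z(1)] by blast
  have "v t z \<in> Bo \<and> v (- t) z \<notin> B" if "0 < t" "t < min e e'" for t
    using e(2)[rule_format, of t] e'(2)[rule_format, of t] that z(4) by (auto simp: mem_B mem_Bo)
  then show ?thesis using e e' by (intro exI[of _ "min e e'"]) auto
qed

lemma X_leaves:
  assumes "z \<in> X"
  shows "\<exists>e>0. \<forall>t. 0 < t \<longrightarrow> t < e \<longrightarrow> v t z \<notin> B"
proof -
  obtain e where e: "0 < e" "\<forall>t. 0 < t \<longrightarrow> t < e \<longrightarrow> \<bar>fst (h z)\<bar> < \<bar>fst (h (v t z))\<bar>"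
    using increase[of z] assms B_sub(7) by blast
  then show ?thesis using assms by (intro exI[of _ e]) (force simp: mem_X mem_B)
qed

text \<open>From \<open>E\<close> the coordinate \<open>\<bar>snd\<bar>\<close> falls below 1 as
  long as the orbit is in \<open>Rs\<close>, and compactness of \<open>E\<close> makes this time
  uniform. It leads to a positive lower bound for all return times.\<close>

lemma short_return: "\<exists>e>0. \<forall>z\<in>E. \<forall>t. 0 < t \<longrightarrow> t < e \<longrightarrow> v t z \<in> U \<and> v t z \<notin> E"
proof -
  have "\<forall>z\<in>E. \<exists>e>0. \<exists>M. openin (top_of_set S) M \<and> z \<in> M \<and> (\<forall>y\<in>M. \<forall>s. \<bar>s - 0\<bar> < e \<longrightarrow> v s y \<in> Rs)"
  proof
    fix z assume "z \<in> E"
    then have "z \<in> S" "z \<in> Rs" using B_sub(1,3,6) U_sub by blast+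
    then have "z \<in> S" "v 0 z \<in> Rs" by simp_all
    then show "\<exists>e>0. \<exists>M. openin (top_of_set S) M \<and> z \<in> M \<and> (\<forall>y\<in>M. \<forall>s. \<bar>s - 0\<bar> < e \<longrightarrow> v s y \<in> Rs)"
      using v_nbhd[OF open_Rs] by blast
  qed
  then obtain e M where eM: "\<forall>z\<in>E. 0 < e z \<and> openin (top_of_set S) (M z) \<and> z \<in> M z \<and>
      (\<forall>y\<in>M z. \<forall>s. \<bar>s - 0\<bar> < e z \<longrightarrow> v s y \<in> Rs)" by metis
  have "\<forall>z\<in>E. \<exists>T. open T \<and> M z = S \<inter> T" using eM by (auto simp: openin_open)
  then obtain T where T: "\<forall>z\<in>E. open (T z) \<and> M z = S \<inter> T z" by metis
  have ES: "E \<subseteq> S" using B_sub U_sub by blast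
  have "E \<subseteq> (\<Union>z\<in>E. T z)" using eM T by blast
  then obtain F where F: "F \<subseteq> E" "finite F" "E \<subseteq> (\<Union>z\<in>F. T z)"
    using compactE_image[OF compacts(2), of E T] T by auto
  define d where "d = Min (insert 1 (e ` F))"
  have d: "0 < d" "\<forall>z\<in>F. d \<le> e z" using F eM by (auto simp: d_def)
  have "v t z \<in> U \<and> v t z \<notin> E" if z: "z \<in> E" and t: "0 < t" "t < d" for z t
  proof -
    obtain y where y: "y \<in> F" "z \<in> T y" using F(3) z by blast
    then have y: "y \<in> F" "z \<in> M y" using T F(1) ES z by auto
    have Rs: "\<forall>s\<in>{0..t}. v s z \<in> Rs"
    proof
      fix s assume s: "s \<in> {0..t}"
      have "d \<le> e y" using d y by blast
      then have "\<bar>s - 0\<bar> < e y" using s t by auto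
      then show "v s z \<in> Rs" using eM y F(1) by blast
    qed
    have "\<bar>snd (h (v t z))\<bar> < \<bar>snd (h z)\<bar>" by (rule mono_s) (use Rs t z ES in auto)
    moreover have "v t z \<in> Rs" using Rs t by simp
    ultimately show ?thesis using z by (auto simp: mem_E Rs_def)
  qed
  then show ?thesis using d by blast
qed

text \<open>On \<open>E\<close> this singles out the points where stable separatrices enter the
  block, in view of \<open>stays_omega\<close> and \<open>stays_unique\<close>.\<close>

definition stays :: "'a \<Rightarrow> bool" where "stays z \<longleftrightarrow> (\<forall>t\<ge>0. v t z \<in> B)"

lemma stays_p: "stays p" using SingD(2)[OF Sing_p] p_B B_sub(2) by (auto simp: stays_def)

lemma stays_in: "z \<in> S \<Longrightarrow> stays z \<Longrightarrow> z \<in> B"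
  using v0 by (metis order_refl stays_def)

lemma stays_shift: "z \<in> S \<Longrightarrow> stays z \<Longrightarrow> 0 \<le> t \<Longrightarrow> stays (v t z)"
  by (simp add: stays_def flip: v_add)

text \<open>Comparison with \<open>p\<close>, which stays as well and has coordinates 0.\<close>

lemma stays_cone: "z \<in> S \<Longrightarrow> stays z \<Longrightarrow> \<bar>fst (h z)\<bar> \<le> \<bar>snd (h z)\<bar>"
  using cone_s[of z p] stays_p p_B by (simp add: stays_def)

lemma stays_decreasing:
  assumes z: "z \<in> S" "stays z" "z \<noteq> p" and t: "0 < t"
  shows "\<bar>snd (h (v t z))\<bar> < \<bar>snd (h z)\<bar>"
proof (rule mono_s[OF z(1) t], rule ballI)
  fix s assume s: "s \<in> {0..t}"
  have st: "stays (v s z)" using stays_shift z s by simp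
  then have B: "v s z \<in> B" using stays_in z by simp
  have c: "\<bar>fst (h (v s z))\<bar> \<le> \<bar>snd (h (v s z))\<bar>" using stays_cone st z by simp
  have "snd (h (v s z)) \<noteq> 0"
  proof
    assume "snd (h (v s z)) = 0"
    then have "h (v s z) = (0, 0)" using c by (simp add: prod_eq_iff)
    then have "v s z = p" using kh[of "v s z"] B k0 by (simp add: mem_B)
    then have "z = v (- s) p" using v_inverse(2)[OF z(1), of s] by simp
    then show False using z(3) SingD(2)[OF Sing_p] by simp
  qed
  then show "v s z \<in> Rs" using c B by (simp add: Rs_def mem_B)
qed

text \<open>LaSalle's principle with \<open>\<bar>snd\<bar>\<close> as Lyapunov function: being
  monotone along the orbit it is constant on the limit set, whose points stay in \<open>B\<close> as
  well, whereas it decreases strictly along every staying orbit other than \<open>p\<close>.\<close>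

lemma stays_omega:
  assumes z: "z \<in> S" "stays z" shows "omega_limit v z = {p}"
proof (cases "z = p")
  case True then show ?thesis using omega_Sing Sing_p by simp
next
  case False
  have oB: "omega_limit v z \<subseteq> B"
    using z by (intro omega_sub_closed compact_imp_closed compacts) (auto simp: stays_def)
  have N: "\<bar>snd (h (v t z))\<bar> \<le> \<bar>snd (h (v s z))\<bar>" if "0 \<le> s" "s \<le> t" for s t
  proof (cases "s = t")
    case False
    have "v s z \<noteq> p" using \<open>z \<noteq> p\<close> v_inverse(2)[OF z(1), of s] SingD(2)[OF Sing_p] by metis
    then show ?thesis using stays_decreasing[of "v s z" "t - s"] stays_shift[OF z that(1)] that False z
      by (simp flip: v_add)
  qed simp
  have const: "\<bar>snd (h y)\<bar> \<le> \<bar>snd (h y')\<bar>" if y: "y \<in> omega_limit v z" "y' \<in> omega_limit v z" for y y'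
  proof (rule ccontr)
    assume "\<not> ?thesis"
    then obtain m where m: "\<bar>snd (h y')\<bar> < m" "m < \<bar>snd (h y)\<bar>" using dense not_le by metis
    have o: "open {w::real\<times>real. \<bar>snd w\<bar> < m}" "open {w::real\<times>real. m < \<bar>snd w\<bar>}"
      by (intro open_Collect_less continuous_intros)+
    obtain T1 where T1: "open T1" "{z \<in> U. h z \<in> {w. \<bar>snd w\<bar> < m}} = S \<inter> T1"
      using open_h[OF o(1)] unfolding openin_open by blast
    obtain T2 where T2: "open T2" "{z \<in> U. h z \<in> {w. m < \<bar>snd w\<bar>}} = S \<inter> T2"
      using open_h[OF o(2)] unfolding openin_open by blast
    note T = T1 T2
    have yU: "y \<in> U" "y' \<in> U" "y \<in> S" "y' \<in> S" using y oB B_sub U_sub by auto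
    have "y' \<in> S \<inter> T1" using T(2) yU m by blast
    then obtain s where s: "0 \<le> s" "v s z \<in> T1" using y(2) T(1) unfolding mem_omega_iff by blast
    have "y \<in> S \<inter> T2" using T(4) yU m by blast
    then obtain t where t: "s \<le> t" "v t z \<in> T2" using y(1) T(3) unfolding mem_omega_iff by blast
    have "v s z \<in> S \<inter> T1" "v t z \<in> S \<inter> T2" using s t z by auto
    then have "\<bar>snd (h (v s z))\<bar> < m" "m < \<bar>snd (h (v t z))\<bar>" unfolding T(2,4)[symmetric] by auto
    then show False using N[OF s(1) t(1)] by simp
  qed
  have "y = p" if y: "y \<in> omega_limit v z" for y
  proof (rule ccontr)
    assume "y \<noteq> p"
    have yS: "y \<in> S" using y omega_sub z by blast
    have "stays y" using omega_invariant[OF z(1) y] oB by (auto simp: stays_def)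
    then have "\<bar>snd (h (v 1 y))\<bar> < \<bar>snd (h y)\<bar>" using stays_decreasing[OF yS _ \<open>y \<noteq> p\<close>] by simp
    moreover have "\<bar>snd (h y)\<bar> \<le> \<bar>snd (h (v 1 y))\<bar>" using const omega_invariant[OF z(1) y] y by simp
    ultimately show False by simp
  qed
  then show ?thesis using omega_nonempty[OF z(1)] by blast
qed

lemma stays_unique:
  assumes "z \<in> E" "z' \<in> E" "stays z" "stays z'" "snd (h z) = snd (h z')" shows "z = z'"
proof -
  have S: "z \<in> S" "z' \<in> S" "z \<in> U" "z' \<in> U" using assms B_sub U_sub by auto
  have "fst (h z) = fst (h z')" using cone_s[OF S(1,2)] assms by (simp add: stays_def)
  then have "h z = h z'" using assms(5) by (simp add: prod_eq_iff)
  then show ?thesis using kh S by metis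
qed

lemma finite_stays: "finite {z \<in> E. stays z}"
proof (rule finite_imageD)
  show "finite ((\<lambda>z. snd (h z)) ` {z \<in> E. stays z})"
    by (rule finite_subset[of _ "{-1, 1}"]) (auto simp: mem_E abs_if split: if_splits)
  show "inj_on (\<lambda>z. snd (h z)) {z \<in> E. stays z}" using stays_unique by (auto intro: inj_onI)
qed

lemma finite_corners: "finite (E - Eo)"
proof (rule finite_subset)
  show "E - Eo \<subseteq> k ` ({-1, 1} \<times> {-1, 1})"
  proof
    fix z assume z: "z \<in> E - Eo"
    then have "h z \<in> {-1, 1} \<times> {-1, 1}" by (cases "h z") (auto simp: mem_E mem_Eo abs_if split: if_splits)
    then show "z \<in> k ` ({-1, 1} \<times> {-1, 1})" using kh[of z] z by (metis DiffD1 image_eqI mem_E)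
  qed
qed simp

end

section \<open>The return map of the entrance sections\<close>

text \<open>\<open>S\<close> carries no metric, so subsequences are always extracted from times,
  chart coordinates or section parameters and then mapped to \<open>S\<close>.\<close>

lemma compact_subsequence:
  fixes f :: "nat \<Rightarrow> 'b::metric_space"
  assumes "compact K" "\<forall>n. f n \<in> K"
  shows "\<exists>l r. l \<in> K \<and> strict_mono (r :: nat \<Rightarrow> nat) \<and> (f \<circ> r) \<longlonglongrightarrow> l"
  using assms unfolding compact_eq_seq_compact_metric seq_compact_def by blast

context chart
begin

lemma rev_sets:
  "chart.B (k \<circ> prod.swap) = B" "chart.E (k \<circ> prod.swap) = X" "chart.X (k \<circ> prod.swap) = E"
proof -
  interpret r: chart S "rev_action v" p "prod.swap \<circ> h" "k \<circ> prod.swap" by (rule chart_rev)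
  have "prod.swap ` csq = csq" "prod.swap ` ({-1..1} \<times> {-1, 1}) = {-1, 1::real} \<times> {-1..1::real}"
    "prod.swap ` ({-1, 1} \<times> {-1..1}) = {-1..1::real} \<times> {-1, 1::real}"
    by (auto simp: csq_def image_iff)
  then show "r.B = B" "r.E = X" "r.X = E"
    unfolding r.B_def B_def r.E_def E_def r.X_def X_def image_comp[symmetric] by simp_all
qed

lemma exit:
  assumes z: "z \<in> S" and t: "t0 < t1" "v t0 z \<in> B" "v t1 z \<notin> B"
  shows "\<exists>t. t0 \<le> t \<and> t < t1 \<and> v t z \<in> X \<and> (\<forall>s\<in>{t0..t}. v s z \<in> B)"
proof -
  interpret r: chart S "rev_action v" p "prod.swap \<circ> h" "k \<circ> prod.swap" by (rule chart_rev)
  have "\<exists>t. - t1 < t \<and> t \<le> - t0 \<and> rev_action v t z \<in> X \<and> (\<forall>s\<in>{t..- t0}. rev_action v s z \<in> B)"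
    using r.entry[of z "- t1" "- t0"] z t unfolding rev_sets by (simp add: rev_action_def)
  then obtain t where t: "- t1 < t" "t \<le> - t0" "rev_action v t z \<in> X" "\<forall>s\<in>{t..- t0}. rev_action v s z \<in> B" by blast
  show ?thesis
  proof (intro exI[of _ "- t"] conjI ballI)
    fix s assume "s \<in> {t0..- t}"
    then show "v s z \<in> B" using t(4)[rule_format, of "- s"] by (simp add: rev_action_def)
  qed (use t in \<open>auto simp: rev_action_def\<close>)
qed

lemma unstable_alpha:
  assumes "z \<in> S" "\<forall>t\<le>0. v t z \<in> B" shows "alpha_limit v z = {p}"
proof -
  interpret r: chart S "rev_action v" p "prod.swap \<circ> h" "k \<circ> prod.swap" by (rule chart_rev)
  have "r.stays z" using assms(2) by (simp add: r.stays_def rev_sets rev_action_def)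
  then show ?thesis using r.stays_omega[OF assms(1)] by (simp add: alpha_rev)
qed

lemma finite_unstable: "finite {z \<in> X. \<forall>t\<le>0. v t z \<in> B}"
proof -
  interpret r: chart S "rev_action v" p "prod.swap \<circ> h" "k \<circ> prod.swap" by (rule chart_rev)
  have "(\<forall>t\<le>0. v t z \<in> B) \<longleftrightarrow> r.stays z" for z
    unfolding r.stays_def rev_sets rev_action_def by (metis add.inverse_inverse neg_0_le_iff_le)
  then show ?thesis using r.finite_stays by (simp add: rev_sets)
qed

text \<open>Points of \<open>E\<close> near \<open>c\<close> do not stay, since each side has only
  one staying point, and they need longer and longer to leave. A limit of their exit points
  therefore has its whole backward orbit in \<open>B\<close>, which puts it on an unstable
  separatrix.\<close>

lemma approach:
  assumes c: "c \<in> E" "stays c" and w: "\<forall>n::nat. w n \<in> E \<and> w n \<noteq> c" "w \<longlonglongrightarrow> c"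
  shows "\<exists>u s r. strict_mono r \<and> u \<in> X \<and> (\<forall>t\<le>0. v t u \<in> B) \<and>
     (\<forall>n::nat. 0 \<le> s n \<and> (\<forall>t\<in>{0..s n}. v t (w (r n)) \<in> B)) \<and> (\<lambda>n. v (s n) (w (r n))) \<longlonglongrightarrow> u"
proof -
  have ES: "z \<in> E \<Longrightarrow> z \<in> S \<and> z \<in> U" for z using B_sub U_sub by blast
  have "(\<lambda>n. h (w n)) \<longlonglongrightarrow> h c"
    by (rule continuous_on_tendsto_compose[OF h_cont w(2)]) (use c w ES in auto)
  then have "(\<lambda>n. snd (h (w n))) \<longlonglongrightarrow> snd (h c)" by (rule tendsto_snd)
  \<comment> \<open>On \<open>E\<close> the contracting coordinate is 1 or -1, so a difference below
    1 already means the same side as \<open>c\<close>.\<close>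
  then obtain N where N: "\<forall>n\<ge>N. dist (snd (h (w n))) (snd (h c)) < 1" by (metis LIMSEQ_iff_nz lim_sequentially zero_less_one)
  define w' where "w' n = w (n + N)" for n
  have w': "w' n \<in> E" "w' n \<noteq> c" "w' n \<in> S" for n using w ES by (auto simp: w'_def)
  have lw': "w' \<longlonglongrightarrow> c" unfolding w'_def using w(2) by (rule LIMSEQ_ignore_initial_segment)
  have "\<not> stays (w' n)" for n
  proof
    assume "stays (w' n)"
    moreover have "snd (h (w' n)) = snd (h c)"
    proof -
      have "\<bar>snd (h (w' n))\<bar> = 1" "\<bar>snd (h c)\<bar> = 1" using w' c by (auto simp: mem_E)
      moreover have "\<bar>snd (h (w' n)) - snd (h c)\<bar> < 1" using N by (simp add: w'_def dist_real_def)
      ultimately show ?thesis by linarith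
    qed
    ultimately show False using stays_unique[OF w'(1) c(1) _ c(2)] w'(2) by blast
  qed
  then have "\<exists>t\<ge>0. v t (w' n) \<notin> B" for n by (auto simp: stays_def)
  moreover have w'B: "v 0 (w' n) \<in> B" for n using w' B_sub by auto
  ultimately have "\<exists>t>0. v t (w' n) \<notin> B" for n by (metis order_le_less)
  then have "\<exists>s. 0 \<le> s \<and> v s (w' n) \<in> X \<and> (\<forall>t\<in>{0..s}. v t (w' n) \<in> B)" for n
    using exit[OF w'(3) _ w'B] by blast
  then obtain s where s: "\<And>n. 0 \<le> s n" "\<And>n. v (s n) (w' n) \<in> X" "\<And>n. \<forall>t\<in>{0..s n}. v t (w' n) \<in> B" by metis
  let ?x = "\<lambda>n. h (v (s n) (w' n))"
  let ?K = "{-1, 1::real} \<times> {-1..1::real}"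
  have xK: "?x n \<in> ?K" for n using s(2)[of n] by (cases "?x n") (auto simp: mem_X abs_if split: if_splits)
  have "compact ?K" by (intro compact_Times) auto
  then obtain \<zeta> r where r: "\<zeta> \<in> ?K" "strict_mono (r :: nat \<Rightarrow> nat)" "(?x \<circ> r) \<longlonglongrightarrow> \<zeta>"
    using compact_subsequence[of ?K ?x] xK by blast
  define u where "u = k \<zeta>"
  have u: "u \<in> X" using r(1) unfolding u_def X_def by blast
  have "(\<lambda>n. k (?x (r n))) \<longlonglongrightarrow> k \<zeta>"
  proof (rule continuous_on_tendsto_compose[OF k_cont])
    show "(\<lambda>n. ?x (r n)) \<longlonglongrightarrow> \<zeta>" using r(3) by (simp add: o_def)
    show "\<zeta> \<in> sq 2" using r(1) sq_subs(4) by blast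
    show "\<forall>\<^sub>F n in sequentially. ?x (r n) \<in> sq 2" using xK sq_subs(4) by (intro always_eventually) blast
  qed
  moreover have "k (?x n) = v (s n) (w' n)" for n using s(2)[of n] by (simp add: mem_X)
  ultimately have lim: "(\<lambda>n. v (s (r n)) (w' (r n))) \<longlonglongrightarrow> u" by (simp add: u_def)
  have cS: "c \<in> S" using c ES by blast
  \<comment> \<open>Up to a fixed time \<open>T\<close> the orbit of \<open>c\<close> avoids the
    exit set \<open>X\<close>, and by \<open>tube\<close> so do nearby orbits.\<close>
  have late: "eventually (\<lambda>n. T < s n) sequentially" for T
  proof -
    have "\<forall>t\<in>{0..T}. v t c \<in> S - X"
    proof
      fix t assume "t \<in> {0..T}"
      then have st: "stays (v t c)" using stays_shift[OF cS c(2)] by simp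
      have "v t c \<notin> X"
      proof
        assume "v t c \<in> X"
        then obtain e where "0 < e" "\<forall>s. 0 < s \<longrightarrow> s < e \<longrightarrow> v s (v t c) \<notin> B" using X_leaves by blast
        then show False using st unfolding stays_def by (metis dense less_imp_le)
      qed
      then show "v t c \<in> S - X" using cS by simp
    qed
    then obtain M where M: "openin (top_of_set S) M" "c \<in> M" "\<forall>y\<in>M. \<forall>t\<in>{0..T}. v t y \<in> S - X"
      using tube[OF open_not[OF compact_imp_closed[OF compacts(3)]] cS, of 0 T] by blast
    obtain M' where M': "open M'" "M = S \<inter> M'" using M(1) by (auto simp: openin_open)
    have "eventually (\<lambda>n. w' n \<in> M') sequentially" using topological_tendstoD[OF lw' M'(1)] M(2) M'(2) by blast
    then show ?thesis
    proof eventually_elim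
      case (elim n)
      then have "w' n \<in> M" using M'(2) w'(3) by blast
      then show ?case using M(3) s(1,2)[of n] by (metis DiffD2 atLeastAtMost_iff not_le)
    qed
  qed
  have bwd: "v t u \<in> B" if t: "t \<le> 0" for t
  proof (rule Lim_in_closed_set)
    show "closed B" using compacts(1) by (rule compact_imp_closed)
    have "u \<in> S" using u B_sub U_sub by blast
    have "(\<lambda>n. v t (v (s (r n)) (w' (r n)))) \<longlonglongrightarrow> v t u"
      by (rule v_tendsto[OF tendsto_const lim _ \<open>u \<in> S\<close>]) (use w' in simp)
    then show "(\<lambda>n. v t (v (s (r n)) (w' (r n)))) \<longlonglongrightarrow> v t u" .
    have "eventually (\<lambda>n. - t < s (r n)) sequentially"
      using late r(2) by (rule eventually_subseq[rotated])
    then show "eventually (\<lambda>n. v t (v (s (r n)) (w' (r n))) \<in> B) sequentially"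
    proof eventually_elim
      case (elim n)
      have "v t (v (s (r n)) (w' (r n))) = v (t + s (r n)) (w' (r n))" using w' by (simp add: v_add)
      then show ?case using s(3)[of "r n"] elim t by auto
    qed
  qed simp
  show ?thesis
  proof (intro exI conjI allI)
    show "strict_mono (\<lambda>n. r n + N)" using r(2) by (simp add: strict_mono_def)
    show "u \<in> X" by (rule u)
    show "(\<lambda>n. v (s (r n)) (w (r n + N))) \<longlonglongrightarrow> u" using lim by (simp add: w'_def)
  qed (use bwd s in \<open>auto simp: w'_def\<close>)
qed

end

locale saddle_boxes = flow +
  fixes P h k
  assumes finite_P: "finite P" and nonempty_P: "P \<noteq> {}"
    and charts: "\<And>p. p \<in> P \<Longrightarrow> chart S v p (h p) (k p)"
    and disjoint_U: "\<And>p q. p \<in> P \<Longrightarrow> q \<in> P \<Longrightarrow> p \<noteq> q \<Longrightarrow> chart.U (k p) \<inter> chart.U (k q) = {}"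
begin

abbreviation "bx p \<equiv> chart.B (k p)"
abbreviation "ibx p \<equiv> chart.Bo (k p)"
abbreviation "ent p \<equiv> chart.E (k p)"
abbreviation "ento p \<equiv> chart.Eo (k p)"

definition "Sec = (\<Union>p\<in>P. ent p)"
definition "Seco = (\<Union>p\<in>P. ento p)"
definition "visits z \<longleftrightarrow> (\<forall>T. \<exists>t\<ge>T. \<exists>p\<in>P. v t z \<in> ibx p)"
definition "returns w \<longleftrightarrow> (\<exists>t>0. v t w \<in> Sec)"
text \<open>The value is arbitrary if \<open>w\<close> never returns, so statements about it are
  guarded by \<open>returns\<close>.\<close>

definition "ret_time w = (SOME t. 0 < t \<and> v t w \<in> Sec \<and> (\<forall>s. 0 < s \<longrightarrow> s < t \<longrightarrow> v s w \<notin> Sec))"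
definition "ret w = v (ret_time w) w"

lemma box_disjoint: "p \<in> P \<Longrightarrow> q \<in> P \<Longrightarrow> z \<in> chart.U (k p) \<Longrightarrow> z \<in> bx q \<Longrightarrow> p = q"
  using disjoint_U[of p q] chart.B_sub(1)[OF charts, of q] by blast

lemma ent_sub: "p \<in> P \<Longrightarrow> ent p \<subseteq> bx p" "p \<in> P \<Longrightarrow> bx p \<subseteq> chart.U (k p)" "p \<in> P \<Longrightarrow> chart.U (k p) \<subseteq> S"
    "p \<in> P \<Longrightarrow> ibx p \<subseteq> bx p" "p \<in> P \<Longrightarrow> ento p \<subseteq> ent p"
  using chart.B_sub[OF charts, of p] chart.U_sub[OF charts, of p] by blast+

lemma compact_Sec: "compact Sec"
  unfolding Sec_def using finite_P chart.compacts(2)[OF charts] by (intro compact_UN) auto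

lemma Sec_sub: "Sec \<subseteq> S" unfolding Sec_def using ent_sub by blast

lemma closed_box: "p \<in> P \<Longrightarrow> closed (bx p)"
  using chart.compacts(1)[OF charts] by (rule compact_imp_closed)

text \<open>A short arc from a section remains in the chart of its own block, which is disjoint from
  the other blocks.\<close>

lemma short: "\<exists>e>0. \<forall>z\<in>Sec. \<forall>t. 0 < t \<longrightarrow> t < e \<longrightarrow> v t z \<notin> Sec"
proof -
  have "\<forall>p\<in>P. \<exists>e>0. \<forall>z\<in>ent p. \<forall>t. 0 < t \<longrightarrow> t < e \<longrightarrow> v t z \<in> chart.U (k p) \<and> v t z \<notin> ent p"
    using chart.short_return[OF charts] by blast
  then obtain e where e: "\<forall>p\<in>P. 0 < e p \<and> (\<forall>z\<in>ent p. \<forall>t. 0 < t \<longrightarrow> t < e p \<longrightarrow> v t z \<in> chart.U (k p) \<and> v t z \<notin> ent p)"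
    by metis
  let ?d = "Min (e ` P)"
  have d: "0 < ?d" "\<forall>p\<in>P. ?d \<le> e p" using finite_P nonempty_P e by auto
  have "v t z \<notin> Sec" if z: "z \<in> Sec" and t: "0 < t" "t < ?d" for z t
  proof
    assume "v t z \<in> Sec"
    then obtain q where q: "q \<in> P" "v t z \<in> ent q" by (auto simp: Sec_def)
    obtain p where p: "p \<in> P" "z \<in> ent p" using z by (auto simp: Sec_def)
    have "t < e p" using d(2) p(1) t(2) by force
    then have "v t z \<in> chart.U (k p)" "v t z \<notin> ent p" using e p t(1) by blast+
    moreover have "p = q" using box_disjoint[OF p(1) q(1)] calculation(1) q ent_sub(1) by blast
    ultimately show False using q by simp
  qed
  then show ?thesis using d(1) by blast
qed

definition "\<epsilon> = (SOME e. 0 < e \<and> (\<forall>z\<in>Sec. \<forall>t. 0 < t \<longrightarrow> t < e \<longrightarrow> v t z \<notin> Sec))"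

lemma \<epsilon>: "0 < \<epsilon>" "z \<in> Sec \<Longrightarrow> 0 < t \<Longrightarrow> t < \<epsilon> \<Longrightarrow> v t z \<notin> Sec"
  using someI_ex[OF short] unfolding \<epsilon>_def by blast+

lemma hit:
  assumes "p \<in> P" "z \<in> S" "t0 < t1" "v t0 z \<notin> bx p" "v t1 z \<in> bx p"
  shows "\<exists>t. t0 < t \<and> t \<le> t1 \<and> v t z \<in> Sec"
  using chart.entry[OF charts[OF assms(1)] assms(2-5)] assms(1) unfolding Sec_def by blast

text \<open>The return times up to \<open>t1\<close> form a compact set because none lies below
  \<open>\<epsilon>\<close>, so the smallest one is attained.\<close>

lemma first_return:
  assumes w: "w \<in> Sec" "returns w"
  shows "\<exists>t. 0 < t \<and> v t w \<in> Sec \<and> (\<forall>s. 0 < s \<longrightarrow> s < t \<longrightarrow> v s w \<notin> Sec)"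
proof -
  obtain t1 where t1: "0 < t1" "v t1 w \<in> Sec" using w(2) by (auto simp: returns_def)
  have wS: "w \<in> S" using w Sec_sub by blast
  let ?A = "{\<epsilon>..t1} \<inter> (\<lambda>t. v t w) -` Sec"
  have "closed ?A"
    by (intro continuous_closed_preimage v_cont_time wS compact_imp_closed compact_Sec) auto
  then have "compact ?A" by (simp add: compact_eq_bounded_closed bounded_Int)
  moreover have ge: "\<epsilon> \<le> t" if "0 < t" "v t w \<in> Sec" for t using \<epsilon>(2)[OF w(1), of t] that by force
  then have "t1 \<in> ?A" using t1 by auto
  ultimately obtain t where t: "t \<in> ?A" "\<forall>s\<in>?A. t \<le> s" using compact_attains_inf[of ?A] by blast
  have "v s w \<notin> Sec" if "0 < s" "s < t" for s
  proof
    assume "v s w \<in> Sec"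
    then have "s \<in> ?A" using ge that t(1) by auto
    then show False using t(2) that by force
  qed
  then show ?thesis using t(1) \<epsilon>(1) by (intro exI[of _ t]) auto
qed

lemma ret_time:
  assumes "w \<in> Sec" "returns w"
  shows "0 < ret_time w" "\<epsilon> \<le> ret_time w" "ret w \<in> Sec" "0 < s \<Longrightarrow> s < ret_time w \<Longrightarrow> v s w \<notin> Sec"
proof -
  have *: "0 < ret_time w \<and> v (ret_time w) w \<in> Sec \<and> (\<forall>s. 0 < s \<longrightarrow> s < ret_time w \<longrightarrow> v s w \<notin> Sec)"
    using someI_ex[OF first_return[OF assms]] unfolding ret_time_def .
  then show "0 < ret_time w" "ret w \<in> Sec" "0 < s \<Longrightarrow> s < ret_time w \<Longrightarrow> v s w \<notin> Sec" by (auto simp: ret_def)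
  show "\<epsilon> \<le> ret_time w" using * \<epsilon>(2)[OF assms(1), of "ret_time w"] by force
qed

lemma ret_time_le: "w \<in> Sec \<Longrightarrow> 0 < t \<Longrightarrow> v t w \<in> Sec \<Longrightarrow> ret_time w \<le> t"
  using ret_time(4)[of w t] unfolding returns_def by (metis not_le)

text \<open>If two points had the same return but different return times, the one with the longer
  time would meet the section earlier, namely at the other point.\<close>

lemma ret_inj: "inj_on ret {w \<in> Sec. returns w}"
proof (rule inj_onI; clarify)
  have *: "ret_time w' \<le> ret_time w" if w: "w \<in> Sec" "returns w" "w' \<in> Sec" "returns w'" "ret w = ret w'" for w w'
  proof (rule ccontr)
    assume n: "\<not> ret_time w' \<le> ret_time w"
    have S: "w \<in> S" "w' \<in> S" using w Sec_sub by blast+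
    have "w = v (- ret_time w) (ret w)" using S by (simp add: ret_def)
    then have "w = v (- ret_time w) (ret w')" by (simp only: w(5))
    then have "w = v (ret_time w' - ret_time w) w'" using S v_add[OF S(2), of "- ret_time w" "ret_time w'"] by (simp add: ret_def)
    then show False using ret_time(4)[OF w(3,4), of "ret_time w' - ret_time w"] n ret_time(1)[OF w(1,2)] w(1) by simp
  qed
  fix w w' assume w: "w \<in> Sec" "returns w" "w' \<in> Sec" "returns w'" "ret w = ret w'"
  have S: "w \<in> S" "w' \<in> S" using w Sec_sub by blast+
  have "ret_time w = ret_time w'" using *[OF w] *[OF w(3,4,1,2) w(5)[symmetric]] by simp
  then show "w = w'" using w(5) S unfolding ret_def by (metis v_inverse(2))
qed

text \<open>Being outside a box at one time and in its interior at a later one are open conditions,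
  and \<open>hit\<close> puts a crossing in between. Hence bounded crossing times persist nearby,
  even if the crossing of \<open>z\<close> itself is at a corner.\<close>

lemma hit_nbhd:
  assumes z: "z \<in> S" "visits z" and leaves: "\<forall>p\<in>P. \<exists>t\<ge>0. v t z \<notin> bx p"
  shows "\<exists>M T. openin (top_of_set S) M \<and> z \<in> M \<and> 0 < T \<and> (\<forall>y\<in>M. \<exists>t. 0 < t \<and> t \<le> T \<and> v t y \<in> Sec)"
proof -
  obtain a where a: "\<forall>p\<in>P. 0 \<le> a p \<and> v (a p) z \<notin> bx p" using leaves by metis
  \<comment> \<open>Which box will be visited is not known beforehand, so the visit is taken after
    the times \<open>a\<close> of all boxes.\<close>
  obtain t1 q where t1: "t1 \<ge> Max (a ` P) + 1" "q \<in> P" "v t1 z \<in> ibx q" using z(2) by (metis visits_def)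
  have "a q \<le> Max (a ` P)" using finite_P t1(2) by simp
  then have aq: "a q < t1" "0 \<le> a q" using t1(1,2) a by auto
  have "v (a q) z \<in> S - bx q" using a t1(2) z(1) by simp
  then obtain M1 where M1: "openin (top_of_set S) M1" "z \<in> M1" "\<forall>y\<in>M1. v (a q) y \<in> S - bx q"
    using v_nbhd[OF chart.open_not[OF charts[OF t1(2)] closed_box[OF t1(2)]] z(1)] by (metis abs_zero diff_self)
  obtain M2 where M2: "openin (top_of_set S) M2" "z \<in> M2" "\<forall>y\<in>M2. v t1 y \<in> ibx q"
    using v_nbhd[OF chart.open_Bo[OF charts[OF t1(2)]] z(1) t1(3)] by (metis abs_zero diff_self)
  have "\<exists>t. 0 < t \<and> t \<le> t1 \<and> v t y \<in> Sec" if y: "y \<in> M1 \<inter> M2" for y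
  proof -
    have "y \<in> S" using y M1(1) openin_imp_subset by blast
    moreover have "v (a q) y \<notin> bx q" "v t1 y \<in> bx q" using y M1(3) M2(3) ent_sub(4)[OF t1(2)] by blast+
    ultimately obtain t where "a q < t" "t \<le> t1" "v t y \<in> Sec" using hit[OF t1(2) _ aq(1)] by blast
    then show ?thesis using aq(2) by (intro exI[of _ t]) simp
  qed
  then have "\<forall>y\<in>M1 \<inter> M2. \<exists>t. 0 < t \<and> t \<le> t1 \<and> v t y \<in> Sec" by blast
  moreover have "openin (top_of_set S) (M1 \<inter> M2)" "z \<in> M1 \<inter> M2" using M1 M2 by (simp_all add: openin_Int)
  moreover have "0 < t1" using aq by simp
  ultimately show ?thesis by metis
qed

text \<open>Around its return time the orbit passes from outside a box into the interior, and nearby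
  orbits do the same; this bounds their return time from above. From below, \<open>tube\<close>
  keeps them off the section during \<open>{\<epsilon>..\<tau> - d}\<close>, and earlier returns are
  excluded by the choice of \<open>\<epsilon>\<close>.\<close>

lemma ret_cont:
  assumes w: "w \<in> Sec" "returns w" "ret w \<in> Seco" and e: "0 < e"
  shows "\<exists>M. openin (top_of_set S) M \<and> w \<in> M \<and> (\<forall>y\<in>M \<inter> Sec. returns y \<and> \<bar>ret_time y - ret_time w\<bar> < e)"
proof -
  have wS: "w \<in> S" using w Sec_sub by blast
  define \<tau> where "\<tau> = ret_time w"
  obtain q where q: "q \<in> P" "v \<tau> w \<in> ento q" using w(3) by (auto simp: Seco_def ret_def \<tau>_def)
  obtain e1 where e1: "0 < e1" "\<forall>t. 0 < t \<longrightarrow> t < e1 \<longrightarrow> v t (v \<tau> w) \<in> ibx q \<and> v (- t) (v \<tau> w) \<notin> bx q"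
    using chart.Eo_cross[OF charts[OF q(1)] q(2)] by blast
  define d where "d = min e (min e1 \<tau>) / 2"
  have \<tau>: "0 < \<tau>" using ret_time(1)[OF w(1,2)] by (simp add: \<tau>_def)
  have d: "0 < d" "d < e" "d < e1" "d < \<tau>" using e e1(1) \<tau> by (auto simp: d_def)
  have "v d (v \<tau> w) = v (\<tau> + d) w" "v (- d) (v \<tau> w) = v (\<tau> - d) w"
    using wS by (simp_all add: add.commute flip: v_add)
  then have in_out: "v (\<tau> + d) w \<in> ibx q" "v (\<tau> - d) w \<in> S - bx q" using e1(2) d wS by auto
  obtain M1 where M1: "openin (top_of_set S) M1" "w \<in> M1" "\<forall>y\<in>M1. v (\<tau> - d) y \<in> S - bx q"
    using v_nbhd[OF chart.open_not[OF charts[OF q(1)] closed_box[OF q(1)]] wS in_out(2)] by (metis abs_zero diff_self)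
  obtain M2 where M2: "openin (top_of_set S) M2" "w \<in> M2" "\<forall>y\<in>M2. v (\<tau> + d) y \<in> ibx q"
    using v_nbhd[OF chart.open_Bo[OF charts[OF q(1)]] wS in_out(1)] by (metis abs_zero diff_self)
  have "\<forall>s\<in>{\<epsilon>..\<tau> - d}. v s w \<in> S - Sec"
    using ret_time(4)[OF w(1,2)] \<epsilon>(1) d wS by (auto simp: \<tau>_def)
  then obtain M3 where M3: "openin (top_of_set S) M3" "w \<in> M3" "\<forall>y\<in>M3. \<forall>s\<in>{\<epsilon>..\<tau> - d}. v s y \<in> S - Sec"
    using tube[OF chart.open_not[OF charts[OF q(1)] compact_imp_closed[OF compact_Sec]] wS, of \<epsilon> "\<tau> - d"] by blast
  have "returns y \<and> \<bar>ret_time y - \<tau>\<bar> < e" if y: "y \<in> (M1 \<inter> (M2 \<inter> M3)) \<inter> Sec" for y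
  proof -
    have yS: "y \<in> S" using y Sec_sub by blast
    have "v (\<tau> - d) y \<notin> bx q" "v (\<tau> + d) y \<in> bx q" using y M1(3) M2(3) ent_sub(4)[OF q(1)] by blast+
    then obtain t where t: "\<tau> - d < t" "t \<le> \<tau> + d" "v t y \<in> Sec"
      using hit[OF q(1) yS, of "\<tau> - d" "\<tau> + d"] d by auto
    have r: "returns y" using t d by (auto simp: returns_def intro!: exI[of _ t])
    have "ret_time y \<le> \<tau> + d" using ret_time_le[of y t] y t d by auto
    moreover have "\<tau> - d < ret_time y"
    proof (rule ccontr)
      assume "\<not> ?thesis"
      then have "v (ret_time y) y \<in> S - Sec" using M3(3) y ret_time(2)[OF _ r] by auto
      then show False using ret_time(3)[OF _ r] y by (auto simp: ret_def)
    qed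
    ultimately show ?thesis using r d by auto
  qed
  then show ?thesis using M1 M2 M3 unfolding \<tau>_def
    by (intro exI[of _ "M1 \<inter> (M2 \<inter> M3)"] conjI openin_Int) auto
qed

text \<open>
  Points of the section close to \<open>c\<close> either follow the orbit of \<open>c\<close> up to a later crossing or,
  if \<open>c\<close> is on a stable separatrix, follow an unstable separatrix of the same saddle.
\<close>

lemma near_return:
  assumes c: "c \<in> Sec" "visits c" and w: "\<forall>n::nat. w n \<in> Sec \<and> w n \<noteq> c" "w \<longlonglongrightarrow> c"
    and vis: "\<And>p u. p \<in> P \<Longrightarrow> u \<in> S \<Longrightarrow> omega_limit v c = {p} \<Longrightarrow> alpha_limit v u = {p} \<Longrightarrow> visits u"
  shows "\<exists>r y t. strict_mono r \<and> (\<forall>n::nat. returns (w (r n))) \<and> (\<lambda>n. ret (w (r n))) \<longlonglongrightarrow> v t y \<and>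
    (y = c \<and> 0 < t \<or> (\<exists>p\<in>P. omega_limit v c = {p} \<and> y \<in> S \<and> alpha_limit v y = {p} \<and> 0 \<le> t))"
proof -
  have cS: "c \<in> S" and wS: "w n \<in> S" for n using c w Sec_sub by blast+
  obtain p where p: "p \<in> P" "c \<in> ent p" using c(1) by (auto simp: Sec_def)
  interpret chart S v p "h p" "k p" using charts[OF p(1)] .
  show ?thesis
  proof (cases "stays c")
    case False
    have "\<exists>t\<ge>0. v t c \<notin> bx q" if "q \<in> P" for q
    proof (cases "q = p")
      case True then show ?thesis using False by (auto simp: stays_def)
    next
      case False
      then have "v 0 c \<notin> bx q" using box_disjoint[OF p(1) that, of c] p ent_sub cS by auto
      then show ?thesis by blast
    qed
    \<comment> \<open>As \<open>c\<close> leaves every box, the return times of nearby points lie in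
      a compact interval and accumulate at a time at which the orbit of \<open>c\<close> reaches the
      limit.\<close>
    then obtain M T where M: "openin (top_of_set S) M" "c \<in> M" "0 < T" "\<forall>y\<in>M. \<exists>t. 0 < t \<and> t \<le> T \<and> v t y \<in> Sec"
      using hit_nbhd[OF cS c(2)] by blast
    obtain M' where M': "open M'" "M = S \<inter> M'" using M(1) by (auto simp: openin_open)
    obtain N where N: "\<forall>n\<ge>N. w n \<in> M'"
      using topological_tendstoD[OF w(2) M'(1)] M(2) M'(2) by (auto simp: eventually_sequentially)
    have wM: "w (n + N) \<in> M" for n using N M'(2) wS by simp
    have ret': "returns (w (n + N))" "ret_time (w (n + N)) \<in> {\<epsilon>..T}" for n
    proof -
      obtain t where t: "0 < t" "t \<le> T" "v t (w (n + N)) \<in> Sec" using M(4) wM by blast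
      then show r: "returns (w (n + N))" by (auto simp: returns_def)
      show "ret_time (w (n + N)) \<in> {\<epsilon>..T}" using ret_time(2)[OF _ r] ret_time_le[of "w (n + N)" t] w(1) t by auto
    qed
    obtain \<tau> r where r: "\<tau> \<in> {\<epsilon>..T}" "strict_mono (r :: nat \<Rightarrow> nat)" "((\<lambda>n. ret_time (w (n + N))) \<circ> r) \<longlonglongrightarrow> \<tau>"
      using compact_subsequence[OF compact_Icc[of \<epsilon> T], of "\<lambda>n. ret_time (w (n + N))"] ret'(2) by blast
    have sm: "strict_mono (\<lambda>n. r n + N)" using r(2) by (simp add: strict_mono_def)
    have "(\<lambda>n. w (r n + N)) \<longlonglongrightarrow> c" using LIMSEQ_subseq_LIMSEQ[OF w(2) sm] by (simp add: o_def)
    then have "(\<lambda>n. v (ret_time (w (r n + N))) (w (r n + N))) \<longlonglongrightarrow> v \<tau> c"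
      using r(3) by (intro v_tendsto wS cS) (simp_all add: o_def)
    then show ?thesis using sm ret'(1) r(1) \<epsilon>(1)
      by (intro exI[of _ "\<lambda>n. r n + N"] exI[of _ c] exI[of _ \<tau>]) (simp add: ret_def)
  next
    case True
    have om: "omega_limit v c = {p}" using stays_omega[OF cS True] .
    obtain T0 where T0: "open T0" "U = S \<inter> T0" using open_U by (auto simp: openin_open)
    have "c \<in> U" using p ent_sub by blast
    then obtain N where N: "\<forall>n\<ge>N. w n \<in> T0"
      using topological_tendstoD[OF w(2) T0(1)] T0(2) by (auto simp: eventually_sequentially)
    define w1 where "w1 n = w (n + N)" for n
    have w1: "w1 n \<in> E \<and> w1 n \<noteq> c" "w1 n \<in> S" for n
    proof -
      have "w1 n \<in> U" using N T0(2) wS by (simp add: w1_def)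
      moreover obtain q where q: "q \<in> P" "w1 n \<in> ent q" using w(1) by (auto simp: w1_def Sec_def)
      ultimately have "p = q" using box_disjoint[OF p(1) q(1)] ent_sub(1)[OF q(1)] by blast
      then show "w1 n \<in> E \<and> w1 n \<noteq> c" "w1 n \<in> S" using q w(1) wS by (auto simp: w1_def)
    qed
    have lw1: "w1 \<longlonglongrightarrow> c" unfolding w1_def using w(2) by (rule LIMSEQ_ignore_initial_segment)
    obtain u s r where u: "strict_mono (r :: nat \<Rightarrow> nat)" "u \<in> X" "\<forall>t\<le>0. v t u \<in> B"
      "\<forall>n. 0 \<le> s n \<and> (\<forall>t\<in>{0..s n}. v t (w1 (r n)) \<in> B)" "(\<lambda>n. v (s n) (w1 (r n))) \<longlonglongrightarrow> u"
      using approach[of c w1] p(2) True w1(1) lw1 by blast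
    have uS: "u \<in> S" using u(2) B_sub U_sub by blast
    have al: "alpha_limit v u = {p}" using unstable_alpha[OF uS u(3)] .
    have "\<exists>t\<ge>0. v t u \<notin> bx q" if q: "q \<in> P" for q
    proof (cases "q = p")
      case True
      obtain e where "0 < e" "\<forall>t. 0 < t \<longrightarrow> t < e \<longrightarrow> v t u \<notin> B" using X_leaves[OF u(2)] by blast
      then show ?thesis using True by (intro exI[of _ "e/2"]) auto
    next
      case False
      have "u \<in> U" using u(2) B_sub by blast
      then have "v 0 u \<notin> bx q" using box_disjoint[OF p(1) q, of u] False uS by auto
      then show ?thesis by blast
    qed
    then obtain M T where M: "openin (top_of_set S) M" "u \<in> M" "0 < T" "\<forall>y\<in>M. \<exists>t. 0 < t \<and> t \<le> T \<and> v t y \<in> Sec"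
      using hit_nbhd[OF uS vis[OF p(1) uS om al]] by blast
    obtain M' where M': "open M'" "M = S \<inter> M'" using M(1) by (auto simp: openin_open)
    obtain K where K: "\<forall>n\<ge>K. v (s n) (w1 (r n)) \<in> M'"
      using topological_tendstoD[OF u(5) M'(1)] M(2) M'(2) by (auto simp: eventually_sequentially)
    define r1 where "r1 n = r (n + K) + N" for n
    define s1 where "s1 n = s (n + K)" for n
    have wr1: "w (r1 n) = w1 (r (n + K))" for n by (simp add: r1_def w1_def)
    have wM: "v (s1 n) (w (r1 n)) \<in> M" for n using K M'(2) w1(2) by (simp add: s1_def wr1)
    have s1: "0 \<le> s1 n" "\<forall>t\<in>{0..s1 n}. v t (w (r1 n)) \<in> B" for n using u(4) by (simp_all add: s1_def wr1)
    have ret': "returns (w (r1 n))" "ret_time (w (r1 n)) - s1 n \<in> {0..T}" for n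
    proof -
      obtain t where t: "0 < t" "t \<le> T" "v t (v (s1 n) (w (r1 n))) \<in> Sec" using M(4) wM by blast
      then have t': "v (t + s1 n) (w (r1 n)) \<in> Sec" using wS by (simp add: v_add)
      have "0 < t + s1 n" using t(1) s1(1)[of n] by simp
      then show r: "returns (w (r1 n))" using t' unfolding returns_def by blast
      have "ret_time (w (r1 n)) \<le> t + s1 n" using ret_time_le[OF _ \<open>0 < t + s1 n\<close> t'] w(1) by blast
      \<comment> \<open>No return occurs before the exit near \<open>u\<close>: inside the block its
        own entrance is not met again, and the other blocks are disjoint from it. The remaining time
        is then bounded.\<close>
      moreover have "s1 n < ret_time (w (r1 n))"
      proof (rule ccontr)
        let ?t = "ret_time (w (r1 n))"
        assume "\<not> ?thesis"
        then have B: "\<forall>t\<in>{0..?t}. v t (w (r1 n)) \<in> B" using s1(2)[of n] by auto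
        have pos: "0 < ?t" using ret_time(1)[OF _ r] w(1) by blast
        have "v ?t (w (r1 n)) \<in> Sec" using ret_time(3)[OF _ r] w(1) by (simp add: ret_def)
        then obtain q where q: "q \<in> P" "v ?t (w (r1 n)) \<in> ent q" by (auto simp: Sec_def)
        have "v ?t (w (r1 n)) \<in> U" using B pos B_sub(1) by auto
        then have "p = q" using box_disjoint[OF p(1) q(1)] q ent_sub(1) by blast
        moreover have "v ?t (w (r1 n)) \<notin> E" by (rule no_reentry) (use wS pos B in auto)
        ultimately show False using q by simp
      qed
      ultimately show "ret_time (w (r1 n)) - s1 n \<in> {0..T}" using t by auto
    qed
    obtain \<tau> r2 where r2: "\<tau> \<in> {0..T}" "strict_mono (r2 :: nat \<Rightarrow> nat)" "((\<lambda>n. ret_time (w (r1 n)) - s1 n) \<circ> r2) \<longlonglongrightarrow> \<tau>"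
      using compact_subsequence[OF compact_Icc[of 0 T], of "\<lambda>n. ret_time (w (r1 n)) - s1 n"] ret'(2) by blast
    have "(\<lambda>n. v (s (r2 n + K)) (w1 (r (r2 n + K)))) \<longlonglongrightarrow> u"
      using LIMSEQ_subseq_LIMSEQ[OF u(5), of "\<lambda>n. r2 n + K"] r2(2) by (simp add: o_def strict_mono_def)
    then have "(\<lambda>n. v (s1 (r2 n)) (w (r1 (r2 n)))) \<longlonglongrightarrow> u" by (simp add: s1_def wr1)
    then have "(\<lambda>n. v (ret_time (w (r1 (r2 n))) - s1 (r2 n)) (v (s1 (r2 n)) (w (r1 (r2 n))))) \<longlonglongrightarrow> v \<tau> u"
      using r2(3) by (intro v_tendsto uS) (simp_all add: o_def wS)
    then have "(\<lambda>n. ret (w (r1 (r2 n)))) \<longlonglongrightarrow> v \<tau> u" using wS by (simp add: ret_def flip: v_add)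
    moreover have "strict_mono (\<lambda>n. r1 (r2 n))" using u(1) r2(2) by (simp add: r1_def strict_mono_def)
    ultimately show ?thesis using ret'(1) om uS al p(1) r2(1)
      by (intro exI[of _ "\<lambda>n. r1 (r2 n)"] exI[of _ u] exI[of _ \<tau>]) auto
  qed
qed

text \<open>In the distant past the orbit is in the block of \<open>p\<close>, but at
  \<open>w\<close> or just before it is outside. It exits in between, at an exit point whose whole
  past lies in the block, and \<open>finite_unstable\<close> leaves finitely many of these.\<close>

lemma unstable_orbit:
  assumes p: "p \<in> P" and w: "w \<in> Seco" "alpha_limit v w = {p}"
  shows "\<exists>u t. u \<in> {z \<in> chart.X (k p). \<forall>t\<le>0. v t z \<in> bx p} \<and> v t w = u"
proof -
  interpret chart S v p "h p" "k p" using charts[OF p] .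
  have wS: "w \<in> S" using w(1) ent_sub unfolding Seco_def by blast
  interpret r: flow S "rev_action v" by (rule flow_rev)
  have "omega_limit (rev_action v) w \<subseteq> Bo" using w(2) p_B by (simp add: alpha_rev)
  then obtain T where T: "\<forall>t\<ge>T. rev_action v t w \<in> Bo" using r.omega_attracts[OF wS open_Bo] by blast
  have bwd: "v t w \<in> B" if "t \<le> - T" for t
    using T[rule_format, of "- t"] that B_sub(2) by (auto simp: rev_action_def)
  have "\<exists>e>0. v (- e) w \<notin> B \<or> w \<notin> B"
  proof -
    obtain q where q: "q \<in> P" "w \<in> ento q" using w(1) by (auto simp: Seco_def)
    show ?thesis
    proof (cases "q = p")
      case True
      then obtain e where e: "0 < e" "\<forall>t. 0 < t \<longrightarrow> t < e \<longrightarrow> v (- t) w \<notin> B" using Eo_cross[of w] q by blast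
      then show ?thesis by (intro exI[of _ "e/2"]) auto
    next
      case False
      then have "w \<notin> B" using box_disjoint[OF q(1) p, of w] ent_sub q by blast
      then show ?thesis by (intro exI[of _ 1]) auto
    qed
  qed
  then obtain t1 where t1: "t1 \<le> 0" "v t1 w \<notin> B" using wS by (metis less_imp_le neg_le_0_iff_le order_refl v0)
  have "- T < t1" using bwd[of t1] t1(2) by force
  then obtain t where t: "- T \<le> t" "t < t1" "v t w \<in> X" "\<forall>s\<in>{- T..t}. v s w \<in> B"
    using exit[OF wS, of "- T" t1] bwd[of "- T"] t1(2) by blast
  have "v s (v t w) \<in> B" if "s \<le> 0" for s
  proof -
    have "v s (v t w) = v (s + t) w" using wS by (simp add: v_add)
    then show ?thesis using bwd[of "s + t"] t(4) that by (cases "s + t \<le> - T") auto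
  qed
  then show ?thesis using t(3) by blast
qed

end

section \<open>Parametrizing the sections by the line\<close>

lemma one_sided_in_Icc:
  assumes "a < b" "z \<in> {a..b::real}"
  shows "\<exists>F. one_sided F z \<and> eventually (\<lambda>w. w \<in> {a<..<b}) F"
proof (cases "z < b")
  case True
  then have "eventually (\<lambda>w. w \<in> {a<..<b}) (at_right z)"
    unfolding eventually_at_right_field using assms by (intro exI[of _ b]) auto
  then show ?thesis by (auto simp: one_sided_def)
next
  case False
  then have "eventually (\<lambda>w. w \<in> {a<..<b}) (at_left z)"
    unfolding eventually_at_left_field using assms by (intro exI[of _ a]) auto
  then show ?thesis by (auto simp: one_sided_def)
qed

text \<open>Each new arc is placed on \<open>{M+1..M+3}\<close>, to the right of everything before,
  so that a single real parameter serves all sections. The last clause provides a germ of interior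
  points at every parameter, also at the ends of the intervals.\<close>

lemma arcs_in_line:
  fixes g :: "'i \<Rightarrow> real \<Rightarrow> 'b::topological_space"
  assumes "finite I" "\<forall>i\<in>I. continuous_on {-1..1} (g i) \<and> inj_on (g i) {-1..1}"
    "\<forall>i\<in>I. \<forall>j\<in>I. i \<noteq> j \<longrightarrow> g i ` {-1..1} \<inter> g j ` {-1..1} = {}"
  shows "\<exists>Z Zo \<gamma>. compact Z \<and> open Zo \<and> Zo \<subseteq> Z \<and> continuous_on Z \<gamma> \<and> inj_on \<gamma> Z \<and>
     \<gamma> ` Z = (\<Union>i\<in>I. g i ` {-1..1}) \<and> \<gamma> ` Zo = (\<Union>i\<in>I. g i ` {-1<..<1}) \<and>
     (\<forall>z\<in>Z. \<exists>F. one_sided F z \<and> eventually (\<lambda>w. w \<in> Zo) F)"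
  using assms
proof (induction I rule: finite_induct)
  case empty
  show ?case by (intro exI[of _ "{}"]) auto
next
  case (insert i I)
  then obtain Z Zo \<gamma> where IH: "compact Z" "open Zo" "Zo \<subseteq> Z" "continuous_on Z \<gamma>" "inj_on \<gamma> Z"
     "\<gamma> ` Z = (\<Union>i\<in>I. g i ` {-1..1})" "\<gamma> ` Zo = (\<Union>i\<in>I. g i ` {-1<..<1})"
     "\<forall>z\<in>Z. \<exists>F. one_sided F z \<and> eventually (\<lambda>w. w \<in> Zo) F"
    by auto
  have gi: "continuous_on {-1..1} (g i)" "inj_on (g i) {-1..1}" using insert.prems by auto
  obtain M where M: "\<forall>z\<in>Z. z \<le> M" using compact_imp_bounded[OF IH(1)] bounded_imp_bdd_above unfolding bdd_above_def by blast
  define \<gamma>' where "\<gamma>' z = (if z \<le> M then \<gamma> z else g i (z - (M + 2)))" for z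
  let ?J = "{M+1..M+3}" and ?Jo = "{M+1<..<M+3}"
  have e1: "\<gamma>' z = \<gamma> z" if "z \<in> Z" for z using M that by (auto simp: \<gamma>'_def)
  have e2: "\<gamma>' z = g i (z - (M + 2))" if "z \<in> ?J" for z using that by (auto simp: \<gamma>'_def)
  have shift: "(\<lambda>z. z - (M + 2)) ` ?J = {-1..1}" "(\<lambda>z. z - (M + 2)) ` ?Jo = {-1<..<1}"
    by (auto intro!: image_eqI[where x = "_ + (M + 2)"])
  have imJ: "\<gamma>' ` ?J = g i ` {-1..1}" "\<gamma>' ` ?Jo = g i ` {-1<..<1}"
    unfolding shift[symmetric] image_image using e2 by (auto intro!: image_cong)
  have imZ: "\<gamma>' ` Z = \<gamma> ` Z" "\<gamma>' ` Zo = \<gamma> ` Zo" using e1 IH(3) by (auto intro!: image_cong)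
  have disj: "Z \<inter> ?J = {}" using M by force
  show ?case
  proof (rule exI[of _ "Z \<union> ?J"], rule exI[of _ "Zo \<union> ?Jo"], rule exI[of _ \<gamma>'], intro conjI ballI)
    show "compact (Z \<union> ?J)" using IH(1) by (intro compact_Un) auto
    show "open (Zo \<union> ?Jo)" using IH(2) by auto
    show "Zo \<union> ?Jo \<subseteq> Z \<union> ?J" using IH(3) by auto
    have "continuous_on Z \<gamma>'" using IH(4) e1 by (simp cong: continuous_on_cong)
    moreover have "continuous_on ?J \<gamma>'"
    proof -
      have "continuous_on ?J (\<lambda>z. g i (z - (M + 2)))"
        by (rule continuous_on_compose2[OF gi(1)]) (auto intro!: continuous_intros)
      then show ?thesis by (rule continuous_on_eq) (use e2 in metis)
    qed
    ultimately show "continuous_on (Z \<union> ?J) \<gamma>'"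
      using IH(1) by (intro continuous_on_closed_Un compact_imp_closed) auto
    show "inj_on \<gamma>' (Z \<union> ?J)"
      unfolding inj_on_Un
    proof (intro conjI)
      show "inj_on \<gamma>' Z" using IH(5) e1 by (auto simp: inj_on_def)
      show "inj_on \<gamma>' ?J"
      proof (rule inj_onI)
        fix x y assume xy: "x \<in> ?J" "y \<in> ?J" "\<gamma>' x = \<gamma>' y"
        then have "g i (x - (M + 2)) = g i (y - (M + 2))" using e2 by metis
        then show "x = y" using inj_onD[OF gi(2), of "x - (M+2)" "y - (M+2)"] xy by auto
      qed
      have "\<gamma>' ` Z \<inter> \<gamma>' ` ?J = {}"
      proof -
        have "g j ` {-1..1} \<inter> g i ` {-1..1} = {}" if "j \<in> I" for j
        proof -
          have "j \<noteq> i" using that insert.hyps(2) by metis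
          then show ?thesis using insert.prems(2) that by (metis insertCI)
        qed
        then have "(\<Union>j\<in>I. g j ` {-1..1}) \<inter> g i ` {-1..1} = {}" by (simp only: Int_UN_distrib2 Int_commute UN_extend_simps(1)) blast
        then show ?thesis unfolding imJ imZ IH(6) .
      qed
      then show "\<gamma>' ` (Z - ?J) \<inter> \<gamma>' ` (?J - Z) = {}" by blast
    qed
    show "\<gamma>' ` (Z \<union> ?J) = (\<Union>i\<in>insert i I. g i ` {-1..1})"
      unfolding image_Un imJ imZ IH(6) by blast
    show "\<gamma>' ` (Zo \<union> ?Jo) = (\<Union>i\<in>insert i I. g i ` {-1<..<1})"
      unfolding image_Un imJ imZ IH(7) by blast
    fix z assume "z \<in> Z \<union> ?J"
    then show "\<exists>F. one_sided F z \<and> eventually (\<lambda>w. w \<in> Zo \<union> ?Jo) F"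
    proof
      assume "z \<in> Z"
      then obtain F where "one_sided F z" "eventually (\<lambda>w. w \<in> Zo) F" using IH(8) by blast
      then show ?thesis by (auto elim: eventually_mono)
    next
      assume "z \<in> ?J"
      then obtain F where "one_sided F z" "eventually (\<lambda>w. w \<in> ?Jo) F"
        using one_sided_in_Icc[of "M + 1" "M + 3" z] by auto
      then show ?thesis by (auto elim: eventually_mono)
    qed
  qed
qed

context saddle_boxes
begin

lemma Sec_param:
  "\<exists>Z Zo \<gamma>. compact Z \<and> open Zo \<and> Zo \<subseteq> Z \<and> continuous_on Z \<gamma> \<and> inj_on \<gamma> Z \<and>
     \<gamma> ` Z = Sec \<and> \<gamma> ` Zo = Seco \<and> (\<forall>z\<in>Z. \<exists>F. one_sided F z \<and> eventually (\<lambda>w. w \<in> Zo) F)"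
proof -
  let ?I = "P \<times> {-1, 1::real}"
  let ?g = "\<lambda>(p, s) a. k p (a, s)"
  have sub: "(a, s) \<in> sq 2" if "a \<in> {-1..1}" "s \<in> {-1, 1::real}" for a s using that by (auto simp: sq_def)
  have inj: "k p (a, s) = k p (b, t) \<Longrightarrow> (a, s) = (b, t)" if "p \<in> P" "(a, s) \<in> sq 2" "(b, t) \<in> sq 2" for p a s b t
    using chart.hk[OF charts[OF that(1)]] that(2,3) by metis
  have "\<forall>i\<in>?I. continuous_on {-1..1} (?g i) \<and> inj_on (?g i) {-1..1}"
  proof
    fix i assume "i \<in> ?I"
    then obtain p s where i: "i = (p, s)" and p: "p \<in> P" and s: "s \<in> {-1, 1}" by blast
    have "continuous_on {-1..1} (\<lambda>a. k p (a, s))"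
      by (rule continuous_on_compose2[OF chart.k_cont[OF charts[OF p]]])
        (use sub s in \<open>auto intro!: continuous_intros\<close>)
    moreover have "inj_on (\<lambda>a. k p (a, s)) {-1..1}"
      using inj[OF p sub[OF _ s] sub[OF _ s]] by (auto intro!: inj_onI)
    ultimately show "continuous_on {-1..1} (?g i) \<and> inj_on (?g i) {-1..1}" by (simp add: i)
  qed
  moreover have "\<forall>i\<in>?I. \<forall>j\<in>?I. i \<noteq> j \<longrightarrow> ?g i ` {-1..1} \<inter> ?g j ` {-1..1} = {}"
  proof (intro ballI impI)
    fix i j assume ij: "i \<in> ?I" "j \<in> ?I" "i \<noteq> j"
    obtain p s where i: "i = (p, s)" by fastforce
    obtain q t where j: "j = (q, t)" by fastforce
    have p: "p \<in> P" "q \<in> P" and s: "s \<in> {-1, 1::real}" "t \<in> {-1, 1::real}" and ne: "(p, s) \<noteq> (q, t)"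
      using ij by (auto simp: i j)
    have "(\<lambda>a. k p (a, s)) ` {-1..1} \<inter> (\<lambda>a. k q (a, t)) ` {-1..1} = {}"
    proof (cases "p = q")
      case True
      have "k p (a, s) \<noteq> k q (b, t)" if "a \<in> {-1..1}" "b \<in> {-1..1}" for a b
        using inj[OF p(1) sub[OF that(1) s(1)] sub[OF that(2) s(2)]] ne True by auto
      then show ?thesis by blast
    next
      case False
      have "(\<lambda>a. k p (a, s)) ` {-1..1} \<subseteq> chart.U (k p)" "(\<lambda>a. k q (a, t)) ` {-1..1} \<subseteq> chart.U (k q)"
        using sub s unfolding chart.U_def[OF charts[OF p(1)]] chart.U_def[OF charts[OF p(2)]] by auto
      then show ?thesis using disjoint_U[OF p False] by blast
    qed
    then show "?g i ` {-1..1} \<inter> ?g j ` {-1..1} = {}" by (simp add: i j)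
  qed
  moreover have "finite ?I" using finite_P by simp
  ultimately have "\<exists>Z Zo \<gamma>. compact Z \<and> open Zo \<and> Zo \<subseteq> Z \<and> continuous_on Z \<gamma> \<and> inj_on \<gamma> Z \<and>
     \<gamma> ` Z = (\<Union>i\<in>?I. ?g i ` {-1..1}) \<and> \<gamma> ` Zo = (\<Union>i\<in>?I. ?g i ` {-1<..<1}) \<and>
     (\<forall>z\<in>Z. \<exists>F. one_sided F z \<and> eventually (\<lambda>w. w \<in> Zo) F)" by (intro arcs_in_line)
  moreover have "(\<Union>i\<in>?I. ?g i ` {-1..1}) = Sec"
  proof -
    have "(\<Union>i\<in>?I. ?g i ` {-1..1}) = (\<Union>p\<in>P. k p ` ({-1..1} \<times> {-1, 1}))" by force
    then show ?thesis unfolding Sec_def using chart.E_def[OF charts] by simp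
  qed
  moreover have "(\<Union>i\<in>?I. ?g i ` {-1<..<1}) = Seco"
  proof -
    have "(\<Union>i\<in>?I. ?g i ` {-1<..<1}) = (\<Union>p\<in>P. k p ` ({-1<..<1} \<times> {-1, 1}))" by force
    then show ?thesis unfolding Seco_def using chart.Eo_def[OF charts] by simp
  qed
  ultimately show ?thesis by simp
qed

lemma finite_corners: "finite (Sec - Seco)"
proof (rule finite_subset)
  show "Sec - Seco \<subseteq> (\<Union>p\<in>P. ent p - ento p)" by (auto simp: Sec_def Seco_def)
  show "finite (\<Union>p\<in>P. ent p - ento p)" using finite_P chart.finite_corners[OF charts] by auto
qed

lemma Seco_sub: "Seco \<subseteq> Sec"
  using ent_sub(5) by (auto simp: Sec_def Seco_def)

text \<open>Near a point that is not a corner all orbits pass from outside the box to its interior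
  within a short time, hence meet the section, and by continuity they do so inside
  \<open>J\<close>.\<close>

lemma flow_box:
  assumes z: "z \<in> Seco" and J: "open J" "z \<in> J"
  shows "\<exists>M. openin (top_of_set S) M \<and> z \<in> M \<and> (\<forall>y\<in>M. \<exists>t. v t y \<in> Sec \<inter> J)"
proof -
  obtain q where q: "q \<in> P" "z \<in> ento q" using z by (auto simp: Seco_def)
  have zS: "z \<in> S" using z Seco_sub Sec_sub by blast
  obtain e1 where e1: "0 < e1" "\<forall>t. 0 < t \<longrightarrow> t < e1 \<longrightarrow> v t z \<in> ibx q \<and> v (- t) z \<notin> bx q"
    using chart.Eo_cross[OF charts[OF q(1)] q(2)] by blast
  have "openin (top_of_set S) (S \<inter> J)" "v 0 z \<in> S \<inter> J" using J zS by (auto simp: openin_open)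
  then obtain e2 M0 where M0: "0 < e2" "openin (top_of_set S) M0" "z \<in> M0" "\<forall>y\<in>M0. \<forall>s. \<bar>s - 0\<bar> < e2 \<longrightarrow> v s y \<in> S \<inter> J"
    using v_nbhd zS by blast
  define d where "d = min e1 e2 / 2"
  have d: "0 < d" "d < e1" "d < e2" using e1(1) M0(1) by (auto simp: d_def)
  have in_out: "v d z \<in> ibx q" "v (- d) z \<in> S - bx q" using e1(2) d zS by auto
  obtain M1 where M1: "openin (top_of_set S) M1" "z \<in> M1" "\<forall>y\<in>M1. v (- d) y \<in> S - bx q"
    using v_nbhd[OF chart.open_not[OF charts[OF q(1)] closed_box[OF q(1)]] zS in_out(2)] by (metis abs_zero diff_self)
  obtain M2 where M2: "openin (top_of_set S) M2" "z \<in> M2" "\<forall>y\<in>M2. v d y \<in> ibx q"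
    using v_nbhd[OF chart.open_Bo[OF charts[OF q(1)]] zS in_out(1)] by (metis abs_zero diff_self)
  have "\<forall>y\<in>M0 \<inter> (M1 \<inter> M2). \<exists>t. v t y \<in> Sec \<inter> J"
  proof
    fix y assume y: "y \<in> M0 \<inter> (M1 \<inter> M2)"
    have yS: "y \<in> S" using y M0(2) openin_imp_subset by blast
    have "v (- d) y \<notin> bx q" "v d y \<in> bx q" using y M1(3) M2(3) ent_sub(4)[OF q(1)] by blast+
    then obtain t where t: "- d < t" "t \<le> d" "v t y \<in> Sec"
      using hit[OF q(1) yS, of "- d" d] d by auto
    have "\<bar>t - 0\<bar> < e2" using t d by auto
    then have "v t y \<in> S \<inter> J" using M0(4) y by blast
    then show "\<exists>t. v t y \<in> Sec \<inter> J" using t(3) by blast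
  qed
  moreover have "openin (top_of_set S) (M0 \<inter> (M1 \<inter> M2))" "z \<in> M0 \<inter> (M1 \<inter> M2)"
    using M0 M1 M2 by (simp_all add: openin_Int)
  ultimately show ?thesis by metis
qed

text \<open>The accumulated return times grow by at least \<open>\<epsilon>\<close> at each step, so
  they are unbounded and no later crossing is missed between them.\<close>

lemma iterated_returns:
  assumes w: "\<forall>n. x n \<in> Sec \<and> returns (x n) \<and> x (Suc n) = ret (x n)"
  shows "\<exists>\<tau>. \<tau> 0 = 0 \<and> (\<forall>n. x n = v (\<tau> n) (x 0) \<and> real n * \<epsilon> \<le> \<tau> n) \<and>
     (\<forall>t>0. v t (x 0) \<in> Sec \<longrightarrow> (\<exists>n>0. t = \<tau> n))"
proof -
  define \<tau> where "\<tau> n = (\<Sum>i<n. ret_time (x i))" for n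
  have x0: "x 0 \<in> S" using w Sec_sub by blast
  have \<tau>S: "\<tau> (Suc n) = ret_time (x n) + \<tau> n" for n by (simp add: \<tau>_def)
  have xn: "x n = v (\<tau> n) (x 0)" for n
  proof (induction n)
    case 0 then show ?case using x0 by (simp add: \<tau>_def)
  next
    case (Suc n)
    have "x (Suc n) = v (ret_time (x n)) (x n)" using w by (simp add: ret_def)
    then show ?case using Suc x0 by (simp add: \<tau>S v_add)
  qed
  have \<tau>n: "real n * \<epsilon> \<le> \<tau> n" for n
  proof (induction n)
    case 0 then show ?case by (simp add: \<tau>_def)
  next
    case (Suc n)
    have "\<epsilon> \<le> ret_time (x n)" using ret_time(2) w by blast
    then show ?case using Suc by (simp add: \<tau>S distrib_right)
  qed
  have "\<exists>n>0. t = \<tau> n" if t: "0 < t" "v t (x 0) \<in> Sec" for t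
  proof -
    obtain m where "t < real m * \<epsilon>" using reals_Archimedean3[OF \<epsilon>(1)] by blast
    then have "\<exists>m. t \<le> \<tau> m" using \<tau>n[of m] by (intro exI[of _ m]) linarith
    define m where "m = (LEAST m. t \<le> \<tau> m)"
    have m1: "t \<le> \<tau> m" unfolding m_def by (rule LeastI_ex) fact
    have m2: "\<tau> j < t" if "j < m" for j
      using not_less_Least[of j "\<lambda>m. t \<le> \<tau> m"] that unfolding m_def by linarith
    note m = m1 m2
    have "m \<noteq> 0"
    proof
      assume "m = 0"
      then show False using m(1) t(1) by (simp add: \<tau>_def)
    qed
    then obtain j where j: "m = Suc j" using not0_implies_Suc by blast
    have "\<tau> j < t" using m(2) j by simp
    moreover have "v (t - \<tau> j) (x j) = v t (x 0)" using xn[of j] x0 by (simp flip: v_add)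
    ultimately have "ret_time (x j) \<le> t - \<tau> j" using ret_time_le[of "x j" "t - \<tau> j"] w t(2) by simp
    then have "t = \<tau> m" using m(1) \<tau>S[of j] j by simp
    then show ?thesis using \<open>m \<noteq> 0\<close> by blast
  qed
  moreover have "\<tau> 0 = 0" by (simp add: \<tau>_def)
  ultimately show ?thesis using xn \<tau>n by blast
qed

lemma ret_tendsto:
  assumes w: "w \<in> Sec" "returns w" "ret w \<in> Seco"
    and x: "(x \<longlongrightarrow> w) F" "eventually (\<lambda>i. x i \<in> Sec) F"
  shows "eventually (\<lambda>i. returns (x i)) F" "((\<lambda>i. ret (x i)) \<longlongrightarrow> ret w) F"
proof -
  have ev: "eventually (\<lambda>i. returns (x i) \<and> \<bar>ret_time (x i) - ret_time w\<bar> < e) F" if e: "0 < e" for e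
  proof -
    obtain M where M: "openin (top_of_set S) M" "w \<in> M" "\<forall>y\<in>M \<inter> Sec. returns y \<and> \<bar>ret_time y - ret_time w\<bar> < e"
      using ret_cont[OF w e] by blast
    obtain M' where M': "open M'" "M = S \<inter> M'" using M(1) by (auto simp: openin_open)
    have "eventually (\<lambda>i. x i \<in> M') F" using topological_tendstoD[OF x(1) M'(1)] M(2) M'(2) by blast
    with x(2) show ?thesis
    proof eventually_elim
      case (elim i)
      then have "x i \<in> M \<inter> Sec" using M'(2) Sec_sub by blast
      then show ?case using M(3) by blast
    qed
  qed
  show "eventually (\<lambda>i. returns (x i)) F" using ev[OF zero_less_one] by eventually_elim simp
  have "((\<lambda>i. ret_time (x i)) \<longlongrightarrow> ret_time w) F"
  proof (rule tendstoI)
    fix e :: real assume "0 < e"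
    then show "eventually (\<lambda>i. dist (ret_time (x i)) (ret_time w) < e) F"
      using ev[of e] by (auto simp: dist_real_def elim: eventually_mono)
  qed
  moreover have "eventually (\<lambda>i. x i \<in> S) F" using x(2) by eventually_elim (use Sec_sub in blast)
  ultimately show "((\<lambda>i. ret (x i)) \<longlongrightarrow> ret w) F"
    unfolding ret_def using w(1) Sec_sub x(1) by (intro v_tendsto_eventually) auto
qed

end

section \<open>Wandering intervals of the return map\<close>

text \<open>
  Here \<open>C\<close> is the class of \<open>x0\<close>, \<open>A\<close> is the part of its extended positive orbit that consists of
  unstable separatrices, and \<open>T0\<close> is the union of the omega limit set of \<open>x0\<close> and the closure of \<open>A\<close>.
\<close>

lemma (in saddle_boxes) no_escape:
  assumes C: "C \<subseteq> S" "\<And>w y. w \<in> S \<Longrightarrow> y \<in> omega_limit v w \<Longrightarrow> y \<in> C \<Longrightarrow> w \<in> C"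
    and vis: "\<And>z. z \<in> C \<Longrightarrow> visits z"
    and WuC: "\<And>p u. p \<in> P \<Longrightarrow> u \<in> S \<Longrightarrow> alpha_limit v u = {p} \<Longrightarrow> u \<in> C"
    and dense: "\<And>w. w \<in> C \<Longrightarrow> \<forall>p\<in>P. omega_limit v w \<noteq> {p} \<Longrightarrow> \<forall>p\<in>P. alpha_limit v w \<noteq> {p} \<Longrightarrow>
        C \<subseteq> closure (range (\<lambda>t. v t w))"
    and x0: "x0 \<in> Sec" "x0 \<notin> T0" "\<And>t. 0 < t \<Longrightarrow> v t x0 \<noteq> x0" "pos_orbit v x0 \<subseteq> C"
    and T0: "closed T0" "T0 \<subseteq> C" "\<And>y t. y \<in> T0 \<Longrightarrow> v t y \<in> T0" "omega_limit v x0 \<subseteq> T0"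
    and A: "A \<subseteq> T0" "\<And>y t. y \<in> A \<Longrightarrow> v t y \<in> A"
      "\<And>c p u. c \<in> pos_orbit v x0 \<union> A \<Longrightarrow> omega_limit v c = {p} \<Longrightarrow> p \<in> P \<Longrightarrow> u \<in> S \<Longrightarrow>
         alpha_limit v u = {p} \<Longrightarrow> u \<in> A"
  shows False
proof -
  have x0S: "x0 \<in> S" using x0(1) Sec_sub by blast

  \<comment> \<open>The return map in the line parameter\<close>
  define Y where "Y = pos_orbit v x0 \<union> T0"
  \<comment> \<open>Gaps are taken in the complement of the closed set \<open>Y\<close>, but germs
    are based only at points of \<open>Or\<close>, whose future is explicit: along the orbit of
    \<open>x0\<close>, or along an unstable separatrix in \<open>A\<close>.\<close>
  define Or where "Or = pos_orbit v x0 \<union> A"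
  have YC: "Y \<subseteq> C" and OY: "Or \<subseteq> Y" using x0(4) T0(2) A(1) by (auto simp: Y_def Or_def)
  have clY: "closed Y"
  proof -
    have "Y = closure (pos_orbit v x0) \<union> T0" using closure_pos_orbit[OF x0S] T0(4) by (auto simp: Y_def)
    then show ?thesis using closed_Un[OF closed_closure T0(1)] by metis
  qed
  have T0_iff: "v t y \<in> T0 \<longleftrightarrow> y \<in> T0" if "y \<in> S" for t y
    using T0(3)[of y t] T0(3)[of "v t y" "- t"] that by auto
  obtain Z Zo \<gamma> where Z: "compact Z" and Zo: "open Zo" "Zo \<subseteq> Z" and \<gamma>: "continuous_on Z \<gamma>" "inj_on \<gamma> Z"
      "\<gamma> ` Z = Sec" "\<gamma> ` Zo = Seco" and side: "\<forall>z\<in>Z. \<exists>F. one_sided F z \<and> eventually (\<lambda>w. w \<in> Zo) F"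
    using Sec_param by (elim exE conjE)
  define \<theta> where "\<theta> = inv_into Z \<gamma>"
  have \<theta>\<gamma>: "\<theta> (\<gamma> z) = z" if "z \<in> Z" for z using \<gamma>(2) that by (simp add: \<theta>_def)
  have \<gamma>\<theta>: "\<gamma> (\<theta> s) = s" "\<theta> s \<in> Z" if "s \<in> Sec" for s
    using that \<gamma>(3) by (auto simp: \<theta>_def f_inv_into_f inv_into_into)
  have \<theta>_cont: "continuous_on Sec \<theta>"
    using continuous_on_inv[OF \<gamma>(1) Z, of \<theta>] \<theta>\<gamma> \<gamma>(3) by simp
  have \<gamma>Sec: "\<gamma> z \<in> Sec" "\<gamma> z \<in> S" if "z \<in> Z" for z using that \<gamma>(3) Sec_sub by blast+
  have \<theta>Zo: "\<theta> s \<in> Zo" if s: "s \<in> Seco" for s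
  proof -
    have "s \<in> \<gamma> ` Zo" using s \<gamma>(4) by simp
    then obtain z where "z \<in> Zo" "\<gamma> z = s" by (elim imageE) simp
    then show ?thesis using \<theta>\<gamma>[of z] Zo(2) by auto
  qed
  define f where "f z = \<theta> (ret (\<gamma> z))" for z
  define D where "D = {z \<in> Z. returns (\<gamma> z)}"
  define Yl where "Yl = {z \<in> Z. \<gamma> z \<in> Y}"
  define Ol where "Ol = {z \<in> Z. \<gamma> z \<in> Or}"
  define \<Omega> where "\<Omega> = Zo - Yl"
  define z0 where "z0 = \<theta> x0"
  have z0: "z0 \<in> Z" "\<gamma> z0 = x0" using \<gamma>\<theta>[OF x0(1)] by (auto simp: z0_def)
  have D_ret: "ret (\<gamma> z) \<in> Sec" if "z \<in> D" for z using that ret_time(3) \<gamma>Sec by (auto simp: D_def)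
  have fZ: "f z \<in> Z" "\<gamma> (f z) = ret (\<gamma> z)" if "z \<in> D" for z
    using \<gamma>\<theta>[OF D_ret[OF that]] by (auto simp: f_def)
  have inj_ret: "inj_on (\<lambda>z. ret (\<gamma> z)) D"
  proof (rule inj_onI)
    fix y z assume yz: "y \<in> D" "z \<in> D" "ret (\<gamma> y) = ret (\<gamma> z)"
    then have "\<gamma> y = \<gamma> z" using inj_onD[OF ret_inj, of "\<gamma> y" "\<gamma> z"] \<gamma>Sec by (auto simp: D_def)
    then show "y = z" using inj_onD[OF \<gamma>(2)] yz by (auto simp: D_def)
  qed
  have inj_f: "inj_on f D"
  proof (rule inj_onI)
    fix y z assume "y \<in> D" "z \<in> D" "f y = f z"
    then show "y = z" using inj_onD[OF inj_ret] fZ(2) by metis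
  qed
  \<comment> \<open>A return to a corner may break continuity, and a return to \<open>x0\<close> is
    the only way from outside \<open>Y\<close> into \<open>Y\<close>. Both kinds of targets are
    finite in number, and the return map is injective.\<close>
  define Bd where "Bd = {z \<in> D. ret (\<gamma> z) \<in> insert x0 (Sec - Seco)}"
  have finBd: "finite Bd"
  proof (rule finite_imageD)
    show "finite ((\<lambda>z. ret (\<gamma> z)) ` Bd)"
      by (rule finite_subset[of _ "insert x0 (Sec - Seco)"]) (use finite_corners in \<open>auto simp: Bd_def\<close>)
    show "inj_on (\<lambda>z. ret (\<gamma> z)) Bd" using inj_ret by (rule inj_on_subset) (auto simp: Bd_def)
  qed

  \<comment> \<open>Hypotheses of the gap lemma\<close>
  have clYl: "closed Yl"
  proof -
    have "Yl = Z \<inter> \<gamma> -` Y" by (auto simp: Yl_def)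
    then show ?thesis using continuous_closed_preimage[OF \<gamma>(1) compact_imp_closed[OF Z] clY] by simp
  qed
  have \<Omega>: "\<Omega> \<subseteq> Z" "open \<Omega>" "\<Omega> \<inter> Yl = {}" using Zo clYl by (auto simp: \<Omega>_def)
  have \<gamma>_lim: "(\<lambda>n. \<gamma> (z n)) \<longlonglongrightarrow> \<gamma> c" if "c \<in> Z" "\<forall>n::nat. z n \<in> Z" "z \<longlonglongrightarrow> c" for z c
    by (rule continuous_on_tendsto_compose[OF \<gamma>(1) that(3,1)]) (use that(2) in simp)
  have near: "\<exists>r y t. strict_mono r \<and> (\<forall>n::nat. returns (\<gamma> (z (r n)))) \<and> (\<lambda>n. ret (\<gamma> (z (r n)))) \<longlonglongrightarrow> v t y \<and>
      (y = \<gamma> c \<and> 0 < t \<or> (\<exists>p\<in>P. omega_limit v (\<gamma> c) = {p} \<and> y \<in> S \<and> alpha_limit v y = {p} \<and> 0 \<le> t))"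
    if c: "c \<in> Yl" and z: "\<forall>n. z n \<in> Z \<and> z n \<noteq> c" "z \<longlonglongrightarrow> c" for z c
  proof (rule near_return)
    have cZ: "c \<in> Z" "\<gamma> c \<in> C" using c YC by (auto simp: Yl_def)
    show "\<gamma> c \<in> Sec" using \<gamma>Sec cZ by blast
    show "visits (\<gamma> c)" using vis cZ by blast
    show "\<forall>n. \<gamma> (z n) \<in> Sec \<and> \<gamma> (z n) \<noteq> \<gamma> c" using z(1) cZ \<gamma>Sec inj_onD[OF \<gamma>(2)] by blast
    show "(\<lambda>n. \<gamma> (z n)) \<longlonglongrightarrow> \<gamma> c" using \<gamma>_lim[OF cZ(1)] z by blast
  qed (use WuC vis in blast)
  have z0Yl: "z0 \<in> Yl" using z0 x0S by (auto simp: Yl_def Y_def pos_orbit_def intro!: image_eqI[of _ _ 0])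
  \<comment> \<open>Otherwise gap points that do not return would accumulate at a point of
    \<open>Yl\<close>, where \<open>near\<close> yields a returning subsequence.\<close>
  have "\<exists>\<delta>>0. \<forall>z\<in>\<Omega>. infdist z Yl < \<delta> \<longrightarrow> z \<in> D"
  proof (rule ccontr)
    assume n: "\<not> ?thesis"
    have "\<exists>z. z \<in> \<Omega> \<and> infdist z Yl < inverse (real (Suc n)) \<and> z \<notin> D" for n
      using n by (metis inverse_positive_iff_positive of_nat_0_less_iff zero_less_Suc)
    then obtain z where z: "\<And>n. z n \<in> \<Omega>" "\<And>n. infdist (z n) Yl < inverse (real (Suc n))" "\<And>n. z n \<notin> D"
      by metis
    have zZ: "\<forall>n. z n \<in> Z" using z(1) \<Omega>(1) by blast
    obtain c r where r: "c \<in> Z" "strict_mono (r :: nat \<Rightarrow> nat)" "(z \<circ> r) \<longlonglongrightarrow> c"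
      using compact_subsequence[OF Z zZ] by blast
    have "(\<lambda>n. infdist (z n) Yl) \<longlonglongrightarrow> 0"
    proof (rule tendsto_sandwich[OF _ _ tendsto_const LIMSEQ_inverse_real_of_nat])
      show "eventually (\<lambda>n. 0 \<le> infdist (z n) Yl) sequentially"
        by (intro always_eventually allI infdist_nonneg)
      show "eventually (\<lambda>n. infdist (z n) Yl \<le> inverse (real (Suc n))) sequentially"
        by (intro always_eventually allI less_imp_le z(2))
    qed
    then have "(\<lambda>n. infdist ((z \<circ> r) n) Yl) \<longlonglongrightarrow> 0" using LIMSEQ_subseq_LIMSEQ[OF _ r(2)] by (simp add: o_def)
    moreover have "(\<lambda>n. infdist ((z \<circ> r) n) Yl) \<longlonglongrightarrow> infdist c Yl" using r(3) by (rule tendsto_infdist)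
    ultimately have "infdist c Yl = 0" using LIMSEQ_unique by blast
    then have c: "c \<in> Yl" using in_closed_iff_infdist_zero[OF clYl] z0Yl by blast
    have "\<forall>n. (z \<circ> r) n \<in> Z \<and> (z \<circ> r) n \<noteq> c" using zZ z(1) \<Omega>(3) c by auto
    from near[OF c this r(3)] obtain r' where "\<forall>n::nat. returns (\<gamma> ((z \<circ> r) (r' n)))" by blast
    then have "(z \<circ> r) (r' 0) \<in> D" using zZ by (auto simp: D_def)
    then show False using z(3) by simp
  qed
  then obtain \<delta> where \<delta>: "0 < \<delta>" "\<forall>z\<in>\<Omega>. infdist z Yl < \<delta> \<longrightarrow> z \<in> D" by blast
  \<comment> \<open>\<open>T0\<close> is invariant in both time directions, and the positive orbit
    of \<open>x0\<close> can be entered only through \<open>x0\<close>. A first return cannot pass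
    over \<open>x0\<close>, which lies on the section, so it lands on \<open>x0\<close> and
    \<open>z\<close> belongs to \<open>Bd\<close>.\<close>
  have retY: "ret (\<gamma> z) \<notin> Y" if z: "z \<in> \<Omega>" "z \<in> D" "z \<notin> Bd" for z
  proof
    let ?\<tau> = "ret_time (\<gamma> z)"
    assume Y: "ret (\<gamma> z) \<in> Y"
    have zZ: "z \<in> Z" and nY: "\<gamma> z \<notin> Y" using z(1) Zo(2) by (auto simp: \<Omega>_def Yl_def)
    have \<tau>: "0 < ?\<tau>" using ret_time(1) z(2) \<gamma>Sec by (auto simp: D_def)
    have "ret (\<gamma> z) \<notin> T0" using T0_iff[of "\<gamma> z" ?\<tau>] \<gamma>Sec[OF zZ] nY by (auto simp: ret_def Y_def)
    then obtain t where t: "0 \<le> t" "ret (\<gamma> z) = v t x0" using Y by (auto simp: Y_def pos_orbit_def)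
    have "t \<noteq> 0"
    proof
      assume "t = 0"
      then show False using t z(2,3) x0S by (auto simp: Bd_def)
    qed
    have "\<gamma> z = v (- ?\<tau>) (ret (\<gamma> z))" using \<gamma>Sec[OF zZ] by (simp add: ret_def)
    then have gz: "\<gamma> z = v (t - ?\<tau>) x0" using t(2) v_add[OF x0S, of "- ?\<tau>" t] by simp
    show False
    proof (cases "?\<tau> \<le> t")
      case True
      then have "\<gamma> z \<in> pos_orbit v x0" by (subst gz, unfold pos_orbit_def, intro imageI) simp
      then show False using nY by (simp add: Y_def)
    next
      case False
      have "v (?\<tau> - t) (v (t - ?\<tau>) x0) = x0" using v_inverse(1)[OF x0S, of "?\<tau> - t"] by simp
      then have "v (?\<tau> - t) (\<gamma> z) = x0" by (simp only: gz[symmetric])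
      then show False using ret_time(4)[of "\<gamma> z" "?\<tau> - t"] False \<open>t \<noteq> 0\<close> t(1) x0(1) \<gamma>Sec[OF zZ] z(2)
        by (simp add: D_def)
    qed
  qed
  have dom: "w \<in> D \<and> isCont f w \<and> f w \<in> \<Omega>" if w: "w \<in> \<Omega>" "w \<notin> Bd" "infdist w Yl < \<delta>" for w
  proof (intro conjI)
    show wD: "w \<in> D" using \<delta>(2) w by blast
    have wZ: "w \<in> Z" "w \<in> Zo" using w(1) Zo(2) by (auto simp: \<Omega>_def)
    have retS: "ret (\<gamma> w) \<in> Seco" using D_ret[OF wD] w(2) wD by (auto simp: Bd_def)
    show "f w \<in> \<Omega>" using \<theta>Zo[OF retS] retY[OF w(1) wD w(2)] fZ[OF wD] by (auto simp: \<Omega>_def Yl_def f_def)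
    have evZ: "eventually (\<lambda>z. z \<in> Z) (at w)"
      using eventually_at_topological Zo wZ(2) by (metis subsetD)
    have g: "(\<gamma> \<longlongrightarrow> \<gamma> w) (at w)"
    proof -
      have "continuous_on Zo \<gamma>" using \<gamma>(1) Zo(2) by (rule continuous_on_subset)
      then show ?thesis using continuous_on_eq_continuous_at[OF Zo(1), of \<gamma>] wZ(2) unfolding isCont_def by blast
    qed
    have evS: "eventually (\<lambda>z. \<gamma> z \<in> Sec) (at w)" using evZ by eventually_elim (rule \<gamma>Sec)
    have ret_w: "\<gamma> w \<in> Sec" "returns (\<gamma> w)" using wD \<gamma>Sec by (auto simp: D_def)
    note rt = ret_tendsto[OF ret_w retS g evS]
    have "eventually (\<lambda>z. ret (\<gamma> z) \<in> Sec) (at w)"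
      using rt(1) evS by eventually_elim (use ret_time(3) in blast)
    then have "((\<lambda>z. \<theta> (ret (\<gamma> z))) \<longlongrightarrow> \<theta> (ret (\<gamma> w))) (at w)"
      using continuous_on_tendsto_compose[OF \<theta>_cont rt(2) D_ret[OF wD]] by blast
    then show "isCont f w" by (simp add: isCont_def f_def[abs_def])
  qed
  have x0A: "x0 \<notin> A" using x0(2) A(1) by blast
  \<comment> \<open>By \<open>near\<close> the limit is a strictly later point on the orbit of
    \<open>c\<close>, or it lies on an unstable separatrix in \<open>A\<close>. The former is not
    \<open>x0\<close> by aperiodicity if \<open>c\<close> is on the positive orbit of
    \<open>x0\<close>; points of \<open>A\<close> are not \<open>x0\<close> because \<open>A\<close>
    is contained in \<open>T0\<close>.\<close>
  have lim: "c' \<in> Ol \<and> c' \<noteq> z0"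
    if c: "c \<in> Ol" and w: "\<forall>k. w k \<in> \<Omega> \<inter> D \<and> w k \<noteq> c" "w \<longlonglongrightarrow> c" "(\<lambda>k. f (w k)) \<longlonglongrightarrow> c'" for c c' w
  proof -
    have cZ: "c \<in> Z" "c \<in> Yl" "\<gamma> c \<in> Or" using c OY by (auto simp: Ol_def Yl_def)
    have wZ: "\<forall>k. w k \<in> Z \<and> w k \<noteq> c" using w(1) \<Omega>(1) by blast
    have fw: "\<forall>k. f (w k) \<in> Z" using fZ(1) w(1) by blast
    have c'Z: "c' \<in> Z" by (rule closed_sequentially[OF compact_imp_closed[OF Z] _ w(3)]) (use fw in simp)
    have l1: "(\<lambda>k. ret (\<gamma> (w k))) \<longlonglongrightarrow> \<gamma> c'"
      using \<gamma>_lim[OF c'Z fw w(3)] fZ(2) w(1) by simp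
    obtain r y t where r: "strict_mono (r :: nat \<Rightarrow> nat)" "(\<lambda>n. ret (\<gamma> (w (r n)))) \<longlonglongrightarrow> v t y"
      "y = \<gamma> c \<and> 0 < t \<or> (\<exists>p\<in>P. omega_limit v (\<gamma> c) = {p} \<and> y \<in> S \<and> alpha_limit v y = {p} \<and> 0 \<le> t)"
      using near[OF cZ(2) wZ w(2)] by blast
    have "(\<lambda>n. ret (\<gamma> (w (r n)))) \<longlonglongrightarrow> \<gamma> c'" using LIMSEQ_subseq_LIMSEQ[OF l1 r(1)] by (simp add: o_def)
    then have gc': "\<gamma> c' = v t y" using r(2) LIMSEQ_unique by blast
    have "v t y \<in> Or \<and> v t y \<noteq> x0"
    proof (cases "y = \<gamma> c \<and> 0 < t")
      case True
      show ?thesis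
      proof (cases "\<gamma> c \<in> A")
        case cA: True
        then have "v t y \<in> A" using A(2) True by blast
        then show ?thesis using x0A by (auto simp: Or_def)
      next
        case False
        then obtain s where s: "0 \<le> s" "\<gamma> c = v s x0" using cZ(3) by (auto simp: Or_def pos_orbit_def)
        then have "v t y = v (t + s) x0" using True x0S by (simp add: v_add)
        moreover have "0 < t + s" using s True by simp
        ultimately show ?thesis using x0(3)[of "t + s"] by (auto simp: Or_def pos_orbit_def)
      qed
    next
      case False
      then obtain p where "p \<in> P" "omega_limit v (\<gamma> c) = {p}" "y \<in> S" "alpha_limit v y = {p}" using r(3) by blast
      then have "y \<in> A" using A(3)[of "\<gamma> c" p y] cZ(3) by (simp add: Or_def)
      then have "v t y \<in> A" by (rule A(2))
      then show ?thesis using x0A by (auto simp: Or_def)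
    qed
    then show ?thesis using gc' c'Z z0(2) by (auto simp: Ol_def)
  qed
  obtain F0 where F0: "one_sided F0 z0" "eventually (\<lambda>w. w \<in> Zo) F0" using side z0(1) by blast
  have evF0: "eventually (\<lambda>w. w \<in> \<Omega>) F0"
  proof -
    \<comment> \<open>\<open>G\<close> omits from \<open>Y\<close> the arc of duration
      \<open>\<epsilon>\<close> that starts at \<open>x0\<close>, and this arc meets the section
      only at \<open>x0\<close>. Since \<open>x0\<close> is not in the closed set \<open>G\<close>,
      the points of the section near \<open>x0\<close> other than \<open>x0\<close> avoid
      \<open>Y\<close>.\<close>
    define G where "G = closure (pos_orbit v (v \<epsilon> x0)) \<union> T0"
    have "x0 \<notin> pos_orbit v (v \<epsilon> x0)"
    proof
      assume "x0 \<in> pos_orbit v (v \<epsilon> x0)"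
      then obtain t where "0 \<le> t" "x0 = v (t + \<epsilon>) x0" using x0S by (auto simp: pos_orbit_def v_add)
      then show False using x0(3)[of "t + \<epsilon>"] \<epsilon>(1) by simp
    qed
    then have "x0 \<notin> G" using closure_pos_orbit[of "v \<epsilon> x0"] omega_shift[OF x0S] x0S T0(4) x0(2) by (auto simp: G_def)
    moreover have "closed G" unfolding G_def by (rule closed_Un[OF closed_closure T0(1)])
    ultimately have G: "open (- G)" "\<gamma> z0 \<in> - G" using z0(2) by (simp_all add: open_Compl)
    have id: "((\<lambda>w. w) \<longlongrightarrow> z0) F0" using F0(1) by (rule one_sided_tendsto)
    have "eventually (\<lambda>w. w \<in> Z) F0" using F0(2) by eventually_elim (use Zo(2) in blast)
    then have "(\<gamma> \<longlongrightarrow> \<gamma> z0) F0" using continuous_on_tendsto_compose[OF \<gamma>(1) id z0(1)] by simp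
    then have "eventually (\<lambda>w. \<gamma> w \<in> - G) F0" using topological_tendstoD G by blast
    then show ?thesis using F0(2) one_sided_neq[OF F0(1)]
    proof eventually_elim
      case (elim w)
      have wZ: "w \<in> Z" using elim Zo(2) by blast
      have "\<gamma> w \<notin> Y"
      proof
        assume "\<gamma> w \<in> Y"
        then obtain t where t: "0 \<le> t" "\<gamma> w = v t x0" using elim(1) by (auto simp: Y_def G_def pos_orbit_def)
        consider "t = 0" | "0 < t" "t < \<epsilon>" | "\<epsilon> \<le> t" using t(1) by linarith
        then show False
        proof cases
          case 1
          then have "\<gamma> w = \<gamma> z0" using t x0S z0(2) by simp
          then show False using elim(3) inj_onD[OF \<gamma>(2)] wZ z0(1) by blast
        next
          case 2
          then show False using \<epsilon>(2)[OF x0(1), of t] t(2) \<gamma>Sec[OF wZ] by simp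
        next
          case 3
          then have "\<gamma> w = v (t - \<epsilon>) (v \<epsilon> x0)" using t(2) v_add[OF x0S, of "t - \<epsilon>" \<epsilon>] by simp
          then have "\<gamma> w \<in> pos_orbit v (v \<epsilon> x0)" using 3 by (auto simp: pos_orbit_def)
          then have "\<gamma> w \<in> G" unfolding G_def by (intro UnI1 subsetD[OF closure_subset])
          then show False using elim(1) by blast
        qed
      qed
      then show ?case using elim(2) by (auto simp: \<Omega>_def Yl_def)
    qed
  qed
  have z0Ol: "z0 \<in> Ol" using z0 x0S by (auto simp: Ol_def Or_def pos_orbit_def intro!: image_eqI[of _ _ 0])
  have OlYl: "Ol \<subseteq> Yl" "Yl \<subseteq> Z" using OY by (auto simp: Ol_def Yl_def)
  have bdZ: "bounded Z" using Z by (rule compact_imp_bounded)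
  have gap: "\<exists>I. open I \<and> I \<noteq> {} \<and> I \<subseteq> \<Omega> \<and> (\<forall>w\<in>I. \<forall>n. (f ^^ n) w \<in> D \<inter> \<Omega>) \<and>
    (\<forall>w\<in>I. \<forall>n>0. (f ^^ n) w \<notin> I) \<and> (\<forall>w\<in>I. (\<lambda>n. infdist ((f ^^ n) w) Yl) \<longlonglongrightarrow> 0)"
    by (rule wandering_gap[OF bdZ \<Omega> OlYl finBd inj_f \<delta>(1) _ _ F0(1) z0Ol evF0]; (rule dom | rule lim); assumption)
  obtain I where I: "open I" "I \<noteq> {}" "I \<subseteq> \<Omega>"
    and I1: "\<forall>w\<in>I. \<forall>n. (f ^^ n) w \<in> D \<inter> \<Omega>"
    and I2: "\<forall>w\<in>I. \<forall>n>0. (f ^^ n) w \<notin> I"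
    and I3: "\<forall>w\<in>I. (\<lambda>n. infdist ((f ^^ n) w) Yl) \<longlonglongrightarrow> 0"
    using gap by (elim exE conjE)

  \<comment> \<open>Orbits through the wandering interval\<close>
  have IZ: "w \<in> Z" if "w \<in> I" for w using that I(3) \<Omega>(1) by blast
  have times: "\<exists>\<tau>. (\<forall>n. \<gamma> ((f ^^ n) w) = v (\<tau> n) (\<gamma> w) \<and> real n * \<epsilon> \<le> \<tau> n) \<and>
     (\<forall>t>0. v t (\<gamma> w) \<in> Sec \<longrightarrow> (\<exists>n>0. t = \<tau> n))" if w: "w \<in> I" for w
  proof -
    have "\<forall>n. \<gamma> ((f ^^ n) w) \<in> Sec \<and> returns (\<gamma> ((f ^^ n) w)) \<and> \<gamma> ((f ^^ Suc n) w) = ret (\<gamma> ((f ^^ n) w))"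
    proof
      fix n
      have "(f ^^ n) w \<in> D" using I1 w by blast
      then show "\<gamma> ((f ^^ n) w) \<in> Sec \<and> returns (\<gamma> ((f ^^ n) w)) \<and> \<gamma> ((f ^^ Suc n) w) = ret (\<gamma> ((f ^^ n) w))"
        using fZ(2)[of "(f ^^ n) w"] \<gamma>Sec by (auto simp: D_def)
    qed
    from iterated_returns[of "\<lambda>n. \<gamma> ((f ^^ n) w)", OF this] show ?thesis by auto
  qed
  have never: "v t (\<gamma> w) \<notin> \<gamma> ` I" if w: "w \<in> I" and t: "0 < t" for w t
  proof
    assume vI: "v t (\<gamma> w) \<in> \<gamma> ` I"
    obtain \<tau> where \<tau>: "\<forall>n. \<gamma> ((f ^^ n) w) = v (\<tau> n) (\<gamma> w) \<and> real n * \<epsilon> \<le> \<tau> n"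
      "\<forall>t>0. v t (\<gamma> w) \<in> Sec \<longrightarrow> (\<exists>n>0. t = \<tau> n)" using times[OF w] by blast
    obtain w' where w': "w' \<in> I" "v t (\<gamma> w) = \<gamma> w'" using vI by blast
    then obtain n where n: "0 < n" "t = \<tau> n" using \<tau>(2) t \<gamma>Sec IZ by metis
    then have "\<gamma> ((f ^^ n) w) = \<gamma> w'" using \<tau>(1) w'(2) by simp
    moreover have "(f ^^ n) w \<in> Z" using I1 w by (auto simp: D_def)
    ultimately have "(f ^^ n) w = w'" using inj_onD[OF \<gamma>(2)] IZ[OF w'(1)] by blast
    then show False using I2 w n(1) w'(1) by blast
  qed
  have once: "t = 0" if w: "w \<in> I" "w' \<in> I" "v t (\<gamma> w) = \<gamma> w'" for w w' t
  proof (rule ccontr)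
    assume "t \<noteq> 0"
    then consider "0 < t" | "0 < - t" by linarith
    then show False
    proof cases
      case 1
      then show False using never[OF w(1), of t] w by blast
    next
      case 2
      have "v (- t) (\<gamma> w') = \<gamma> w" using v_inverse(2)[of "\<gamma> w" t] w \<gamma>Sec IZ by simp
      then show False using never[OF w(2) 2] w(1) by auto
    qed
  qed
  \<comment> \<open>The returns approach \<open>Yl\<close> in the parameter and occur at unbounded
    times, so an accumulation point is an omega limit point. It lies in \<open>C\<close>, which
    brings the whole orbit into \<open>C\<close>.\<close>
  have limit: "\<exists>y\<in>Y. y \<in> omega_limit v (\<gamma> w)" if w: "w \<in> I" for w
  proof -
    obtain \<tau> where \<tau>: "\<forall>n. \<gamma> ((f ^^ n) w) = v (\<tau> n) (\<gamma> w) \<and> real n * \<epsilon> \<le> \<tau> n"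
      using times[OF w] by blast
    have xZ: "\<forall>n. (f ^^ n) w \<in> Z" using I1 w by (auto simp: D_def)
    obtain c r where r: "c \<in> Z" "strict_mono (r :: nat \<Rightarrow> nat)" "((\<lambda>n. (f ^^ n) w) \<circ> r) \<longlonglongrightarrow> c"
      using compact_subsequence[OF Z xZ] by blast
    have "(\<lambda>n. infdist (((\<lambda>n. (f ^^ n) w) \<circ> r) n) Yl) \<longlonglongrightarrow> 0"
      using LIMSEQ_subseq_LIMSEQ[OF I3[rule_format, OF w] r(2)] by (simp add: o_def)
    moreover have "(\<lambda>n. infdist (((\<lambda>n. (f ^^ n) w) \<circ> r) n) Yl) \<longlonglongrightarrow> infdist c Yl" using r(3) by (rule tendsto_infdist)
    ultimately have "infdist c Yl = 0" using LIMSEQ_unique by blast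
    then have c: "c \<in> Yl" using in_closed_iff_infdist_zero[OF clYl] z0Yl by blast
    have l: "(\<lambda>n. \<gamma> ((f ^^ r n) w)) \<longlonglongrightarrow> \<gamma> c" using \<gamma>_lim[OF r(1) _ r(3)] xZ by simp
    have "\<gamma> c \<in> omega_limit v (\<gamma> w)" unfolding mem_omega_iff
    proof (intro allI impI)
      fix N T assume N: "open N" "\<gamma> c \<in> N"
      obtain K where K: "\<forall>n\<ge>K. \<gamma> ((f ^^ r n) w) \<in> N"
        using topological_tendstoD[OF l N] by (auto simp: eventually_sequentially)
      obtain m where m: "T < real m * \<epsilon>" using reals_Archimedean3[OF \<epsilon>(1)] by blast
      let ?n = "max K m"
      have "m \<le> r ?n" using seq_suble[OF r(2), of ?n] by simp
      then have "real m * \<epsilon> \<le> real (r ?n) * \<epsilon>" using \<epsilon>(1) by (intro mult_right_mono) auto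
      also have "\<dots> \<le> \<tau> (r ?n)" using \<tau> by blast
      finally have "T \<le> \<tau> (r ?n)" using m by linarith
      moreover have "v (\<tau> (r ?n)) (\<gamma> w) \<in> N" using K[rule_format, of ?n] \<tau> by simp
      ultimately show "\<exists>s\<ge>T. v s (\<gamma> w) \<in> N" by blast
    qed
    then show ?thesis using c by (auto simp: Yl_def)
  qed
  have IC: "\<gamma> w \<in> C" if w: "w \<in> I" for w
    using limit[OF w] C(2)[of "\<gamma> w"] YC \<gamma>Sec IZ[OF w] by blast
  \<comment> \<open>Crossings at arbitrarily late times exclude convergence to a saddle, because the
    interior of its block contains no point of a section.\<close>
  have I_omega: "omega_limit v (\<gamma> w) \<noteq> {p}" if w: "w \<in> I" and p: "p \<in> P" for w p
  proof
    assume om: "omega_limit v (\<gamma> w) = {p}"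
    have wS: "\<gamma> w \<in> S" using \<gamma>Sec IZ[OF w] by blast
    have "omega_limit v (\<gamma> w) \<subseteq> ibx p" using om chart.p_B(1)[OF charts[OF p]] by simp
    then obtain T where T: "\<forall>t\<ge>T. v t (\<gamma> w) \<in> ibx p"
      using omega_attracts[OF wS chart.open_Bo[OF charts[OF p]]] by blast
    obtain \<tau> where \<tau>: "\<forall>n. \<gamma> ((f ^^ n) w) = v (\<tau> n) (\<gamma> w) \<and> real n * \<epsilon> \<le> \<tau> n"
      using times[OF w] by blast
    obtain m where m: "T < real m * \<epsilon>" using reals_Archimedean3[OF \<epsilon>(1)] by blast
    then have "T \<le> \<tau> m" using \<tau> by (meson less_imp_le order_trans)
    then have b: "\<gamma> ((f ^^ m) w) \<in> ibx p" using T \<tau> by simp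
    have "\<gamma> ((f ^^ m) w) \<in> Sec" using I1 w \<gamma>Sec by (auto simp: D_def)
    then obtain q where q: "q \<in> P" "\<gamma> ((f ^^ m) w) \<in> ent q" by (auto simp: Sec_def)
    have "\<gamma> ((f ^^ m) w) \<in> chart.U (k p)" using b ent_sub(2,4)[OF p] by blast
    moreover have "\<gamma> ((f ^^ m) w) \<in> bx q" using q ent_sub(1)[OF q(1)] by blast
    ultimately have "p = q" using box_disjoint[OF p q(1)] by blast
    then show False using b q chart.mem_E[OF charts[OF p]] chart.mem_Bo[OF charts[OF p]] by auto
  qed
  \<comment> \<open>A dense orbit would come close to a second point \<open>w2\<close> of the
    interval, and \<open>flow_box\<close> would turn this into a crossing at a parameter in
    \<open>I\<close> other than \<open>w\<close>, against \<open>once\<close>.\<close>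
  have I_alpha: "\<exists>p\<in>P. alpha_limit v (\<gamma> w) = {p}" if w: "w \<in> I" for w
  proof (rule ccontr)
    assume "\<not> ?thesis"
    then have dn: "C \<subseteq> closure (range (\<lambda>t. v t (\<gamma> w)))" using dense[OF IC[OF w]] I_omega[OF w] by blast
    have "infinite I" using I(1,2) finite_imp_not_open by blast
    then obtain w2 where w2: "w2 \<in> I" "w2 \<noteq> w" by (metis ex_card finite.simps finite_insert finite_subset insert_iff subsetI)
    have "open (I - {w})" using I(1) by (simp add: open_delete)
    then have "openin (top_of_set Sec) (Sec \<inter> \<theta> -` (I - {w}))"
      using continuous_openin_preimage_gen[OF \<theta>_cont] by blast
    then obtain J where J: "open J" "Sec \<inter> \<theta> -` (I - {w}) = Sec \<inter> J" by (auto simp: openin_open)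
    have w2o: "\<gamma> w2 \<in> Seco" using w2(1) I(3) \<gamma>(4) by (auto simp: \<Omega>_def)
    have "\<gamma> w2 \<in> Sec \<inter> \<theta> -` (I - {w})" using w2 \<theta>\<gamma> \<gamma>Sec IZ by simp
    then have "\<gamma> w2 \<in> J" using J(2) by blast
    then obtain M where M: "openin (top_of_set S) M" "\<gamma> w2 \<in> M" "\<forall>y\<in>M. \<exists>t. v t y \<in> Sec \<inter> J"
      using flow_box[OF w2o J(1)] by blast
    obtain M' where M': "open M'" "M = S \<inter> M'" using M(1) by (auto simp: openin_open)
    have "\<gamma> w2 \<in> closure (range (\<lambda>t. v t (\<gamma> w)))" using dn IC[OF w2(1)] by blast
    then have "M' \<inter> range (\<lambda>t. v t (\<gamma> w)) \<noteq> {}"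
      using open_Int_closure_eq_empty[OF M'(1)] M(2) M'(2) by blast
    then obtain s where s: "v s (\<gamma> w) \<in> M'" by blast
    have wS: "\<gamma> w \<in> S" using \<gamma>Sec IZ[OF w] by blast
    then have "v s (\<gamma> w) \<in> M" using s M'(2) by simp
    then obtain t where t: "v t (v s (\<gamma> w)) \<in> Sec \<inter> \<theta> -` (I - {w})" using M(3) J(2) by blast
    define w3 where "w3 = \<theta> (v t (v s (\<gamma> w)))"
    have w3: "w3 \<in> I" "w3 \<noteq> w" "\<gamma> w3 = v (t + s) (\<gamma> w)" using t \<gamma>\<theta>(1) wS by (auto simp: w3_def v_add)
    then have "t + s = 0" using once[OF w w3(1)] by metis
    then have "\<gamma> w3 = \<gamma> w" using w3(3) wS by simp
    then show False using inj_onD[OF \<gamma>(2)] IZ w3(1,2) w by blast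
  qed
  \<comment> \<open>Each orbit through \<open>I\<close> passes one of these finitely many exit
    points, and by \<open>once\<close> different points of \<open>I\<close> lie on different
    orbits.\<close>
  define UF where "UF = (\<Union>p\<in>P. {z \<in> chart.X (k p). \<forall>t\<le>0. v t z \<in> bx p})"
  have finUF: "finite UF" unfolding UF_def using finite_P chart.finite_unstable[OF charts] by auto
  have "\<forall>w\<in>I. \<exists>u. u \<in> UF \<and> (\<exists>t. v t (\<gamma> w) = u)"
  proof
    fix w assume w: "w \<in> I"
    obtain p where p: "p \<in> P" "alpha_limit v (\<gamma> w) = {p}" using I_alpha[OF w] by blast
    have "\<gamma> w \<in> Seco" using w I(3) \<gamma>(4) by (auto simp: \<Omega>_def)
    then show "\<exists>u. u \<in> UF \<and> (\<exists>t. v t (\<gamma> w) = u)" using unstable_orbit[OF p(1) _ p(2)] p(1) unfolding UF_def by blast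
  qed
  then obtain u where u: "\<forall>w\<in>I. u w \<in> UF \<and> (\<exists>t. v t (\<gamma> w) = u w)" by metis
  have "inj_on u I"
  proof (rule inj_onI)
    fix w w' assume w: "w \<in> I" "w' \<in> I" "u w = u w'"
    obtain t where t: "v t (\<gamma> w) = u w" using u w by blast
    obtain t' where t': "v t' (\<gamma> w') = u w'" using u w by blast
    have S: "\<gamma> w \<in> S" "\<gamma> w' \<in> S" using \<gamma>Sec IZ w by blast+
    have "v (- t') (v t (\<gamma> w)) = \<gamma> w'" using t t' w(3) S v_inverse(2)[OF S(2), of t'] by simp
    then have e: "v (- t' + t) (\<gamma> w) = \<gamma> w'" using S by (simp only: v_add)
    then have "- t' + t = 0" by (rule once[OF w(1,2)])
    then have "\<gamma> w = \<gamma> w'" using e S by simp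
    then show "w = w'" using inj_onD[OF \<gamma>(2)] IZ w(1,2) by blast
  qed
  moreover have "u ` I \<subseteq> UF" using u by blast
  ultimately have "finite I" using finUF finite_imageD finite_subset by metis
  then show False using I(1,2) finite_imp_not_open by blast
qed

section \<open>Extended pointwise almost periodic flows\<close>

text \<open>Finite intersections of pairwise Hausdorff neighbourhoods. It keeps the saddle blocks
  apart from each other and from \<open>x\<close>.\<close>

lemma finite_separation:
  fixes F :: "'b::t2_space set"
  assumes "finite F"
  shows "\<exists>W. (\<forall>p\<in>F. open (W p) \<and> p \<in> W p) \<and> (\<forall>p\<in>F. \<forall>q\<in>F. p \<noteq> q \<longrightarrow> W p \<inter> W q = {})"
proof -
  define sep :: "'b \<Rightarrow> 'b \<Rightarrow> 'b set \<times> 'b set" where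
    "sep p q = (SOME U. open (fst U) \<and> open (snd U) \<and> p \<in> fst U \<and> q \<in> snd U \<and> fst U \<inter> snd U = {})" for p q
  define f where "f p q = fst (sep p q)" for p q
  define g where "g p q = snd (sep p q)" for p q
  have fg: "open (f p q) \<and> open (g p q) \<and> p \<in> f p q \<and> q \<in> g p q \<and> f p q \<inter> g p q = {}" if pq: "p \<noteq> q" for p q
  proof -
    obtain U V where "open U" "open V" "p \<in> U" "q \<in> V" "U \<inter> V = {}" using hausdorff[OF pq] by (elim exE conjE)
    then have "\<exists>U. open (fst U) \<and> open (snd U) \<and> p \<in> fst U \<and> q \<in> snd U \<and> fst U \<inter> snd U = {}"
      by (intro exI[of _ "(U, V)"]) simp
    from someI_ex[OF this] show ?thesis unfolding f_def g_def sep_def .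
  qed
  define W where "W p = (\<Inter>q\<in>F - {p}. f p q \<inter> g q p)" for p
  have "open (W p) \<and> p \<in> W p" for p
  proof
    show "open (W p)" unfolding W_def
    proof (intro open_INT ballI)
      fix q assume "q \<in> F - {p}"
      then show "open (f p q \<inter> g q p)" using fg[of p q] fg[of q p] by (intro open_Int) auto
    qed (use assms in simp)
    show "p \<in> W p" unfolding W_def
    proof
      fix q assume "q \<in> F - {p}"
      then show "p \<in> f p q \<inter> g q p" using fg[of p q] fg[of q p] by auto
    qed
  qed
  moreover have "W p \<inter> W q = {}" if "p \<in> F" "q \<in> F" "p \<noteq> q" for p q
  proof -
    have "W p \<subseteq> f p q" "W q \<subseteq> g p q" using that by (auto simp: W_def)
    then show ?thesis using fg[OF that(3)] by blast
  qed
  ultimately show ?thesis by (intro exI[of _ W]) simp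
qed

locale pap_flow = flow +
  assumes pap: "ext_pap S v"
begin

definition "cls x = closure (ext_orbit S v x)"

lemma pap_rev: "pap_flow S (rev_action v)"
  by (intro pap_flow.intro flow_rev pap_flow_axioms.intro) (simp add: ext_pap_rev action pap)

lemma cls_rev: "pap_flow.cls S (rev_action v) = cls"
proof -
  interpret r: pap_flow S "rev_action v" by (rule pap_rev)
  show ?thesis by (rule ext) (simp add: cls_def r.cls_def ext_orbit_rev action)
qed

lemma ext_neg_sub: "x \<in> S \<Longrightarrow> ext_neg_orbit S v x \<subseteq> S"
proof -
  interpret r: flow S "rev_action v" by (rule flow_rev)
  show "x \<in> S \<Longrightarrow> ext_neg_orbit S v x \<subseteq> S" using r.ext_pos_sub by (simp add: ext_neg_rev action)
qed

lemma orbit_in_ext: assumes "x \<in> S" shows "v t x \<in> ext_orbit S v x"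
proof (cases "0 \<le> t")
  case True
  then show ?thesis using ext_pos_base[of x] by (auto simp: ext_orbit_def pos_orbit_def)
next
  case False
  interpret r: flow S "rev_action v" by (rule flow_rev)
  have "v t x = rev_action v (- t) x" by (simp add: rev_action_def)
  then have "v t x \<in> pos_orbit (rev_action v) x" using False by (auto simp: pos_orbit_def)
  then show ?thesis using r.ext_pos_base[of x] by (auto simp: ext_orbit_def ext_neg_rev action)
qed

lemma cls_sub: "x \<in> S \<Longrightarrow> cls x \<subseteq> S"
  unfolding cls_def ext_orbit_def using ext_pos_sub ext_neg_sub by (intro closure_sub) auto

lemma ext_sub_cls: "ext_orbit S v x \<subseteq> cls x"
  unfolding cls_def by (rule closure_subset)

lemma orbit_in_cls: "x \<in> S \<Longrightarrow> v t x \<in> cls x"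
  using orbit_in_ext ext_sub_cls by blast

lemma self_in_cls: "x \<in> S \<Longrightarrow> x \<in> cls x"
  using orbit_in_cls[of x 0] by simp

lemma cls_closed: "closed (cls x)" by (simp add: cls_def)

lemma cls_eq: assumes "x \<in> S" "y \<in> cls x" shows "cls y = cls x"
proof -
  have yS: "y \<in> S" using assms cls_sub by blast
  have "disjoint {closure (ext_orbit S v x) | x. x \<in> S}" using pap unfolding ext_pap_def by (rule partition_onD2)
  moreover have "cls x \<in> {closure (ext_orbit S v x) | x. x \<in> S}" "cls y \<in> {closure (ext_orbit S v x) | x. x \<in> S}"
    using assms(1) yS by (auto simp: cls_def)
  ultimately have "cls x \<noteq> cls y \<Longrightarrow> cls x \<inter> cls y = {}" by (rule disjointD)
  then show ?thesis using self_in_cls[OF yS] assms(2) by blast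
qed

lemma cls_invariant: assumes "x \<in> S" "y \<in> cls x" shows "v t y \<in> cls x"
  using orbit_in_cls[of y t] cls_eq[OF assms] cls_sub[OF assms(1)] assms(2) by auto

lemma omega_sub_cls: "x \<in> S \<Longrightarrow> omega_limit v x \<subseteq> cls x"
  by (intro omega_sub_closed cls_closed orbit_in_cls)

text \<open>At such a point the extended orbit never branches, in either time direction, so it is
  the point itself.\<close>

lemma nonsaddle_cls: assumes p: "p \<in> Sing S v" "\<not> saddle S v p" shows "cls p = {p}"
proof -
  have pos: "ext_pos_orbit S w p \<subseteq> {p}" if "flow S w" "p \<in> Sing S w" "\<not> saddle S w p" for w
  proof -
    interpret w: flow S w by fact
    show ?thesis
    proof (rule w.ext_pos_least)
      show "pos_orbit w p \<subseteq> {p}" using w.SingD(2)[OF that(2)] by (auto simp: pos_orbit_def)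
      fix x' q assume "x' \<in> {p}" "omega_limit w x' = {q}" "saddle S w q"
      then show "Wu S w q \<subseteq> {p}" using w.omega_Sing[OF that(2)] that(3) by auto
    qed
  qed
  have "ext_orbit S v p \<subseteq> {p}"
    using pos[OF flow_axioms] pos[OF flow_rev] p by (simp add: ext_orbit_def ext_neg_rev action Sing_rev saddle_rev_iff)
  moreover have "p \<in> ext_orbit S v p" using orbit_in_ext[OF SingD(1)[OF p(1)], of 0] SingD[OF p(1)] by simp
  ultimately have "ext_orbit S v p = {p}" by blast
  then show ?thesis by (simp add: cls_def)
qed

lemma Wu_sub_cls: assumes "p \<in> Sing S v" "saddle S v p" shows "Wu S v p \<subseteq> cls p"
proof -
  have "p \<in> pos_orbit v p" using SingD(2)[OF assms(1), of 0] by (auto simp: pos_orbit_def intro!: image_eqI[of _ _ 0])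
  then have "p \<in> ext_pos_orbit S v p" using ext_pos_base by blast
  then have "Wu S v p \<subseteq> ext_pos_orbit S v p" using ext_pos_step omega_Sing assms by blast
  then show ?thesis using ext_sub_cls[of p] by (auto simp: ext_orbit_def)
qed

text \<open>A singularity in the block of a saddle stays there forever, hence is its own limit and
  equals the saddle by \<open>stays_omega\<close>. Near a regular point, some time map displaces all
  points.\<close>

lemma singular_isolated:
  assumes x: "x \<in> S" and sad: "\<forall>p\<in>Sing S v \<inter> cls x. saddle S v p" and z: "z \<in> cls x"
  shows "\<exists>N. open N \<and> z \<in> N \<and> N \<inter> S \<inter> Sing S v \<subseteq> {z}"
proof (cases "z \<in> Sing S v")
  case True
  then have "saddle S v z" using sad z by blast
  moreover have "openin (top_of_set S) S" "z \<in> S" using SingD(1)[OF True] by auto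
  ultimately obtain h k where "saddle_chart S v z h k" using saddle_chart_exists[OF action] by metis
  then interpret chart S v z h k by unfold_locales
  obtain N where N: "open N" "Bo = S \<inter> N" using open_Bo by (auto simp: openin_open)
  have "y = z" if y: "y \<in> N \<inter> S \<inter> Sing S v" for y
  proof -
    have "y \<in> B" using y N(2) B_sub(2) by blast
    then have "stays y" using y SingD(2)[of y] by (simp add: stays_def)
    then have "omega_limit v y = {z}" using stays_omega y by blast
    then show ?thesis using omega_Sing[of y] y by simp
  qed
  then show ?thesis using N p_B(1) by (intro exI[of _ N]) auto
next
  case False
  have zS: "z \<in> S" using z cls_sub x by blast
  obtain t where t: "v t z \<noteq> z" using False zS by (auto simp: Sing_def)
  obtain U V where UV: "open U" "open V" "v t z \<in> U" "z \<in> V" "U \<inter> V = {}" using hausdorff[OF t] by blast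
  have "openin (top_of_set S) (S \<inter> U)" "v t z \<in> S \<inter> U" using UV zS by (auto simp: openin_open)
  then obtain M where M: "openin (top_of_set S) M" "z \<in> M" "\<forall>y\<in>M. v t y \<in> S \<inter> U"
    using v_nbhd[OF _ zS, of "S \<inter> U" t] by (metis abs_zero diff_self)
  obtain M' where M': "open M'" "M = S \<inter> M'" using M(1) by (auto simp: openin_open)
  have "y \<notin> Sing S v" if "y \<in> (M' \<inter> V) \<inter> S" for y
  proof
    assume "y \<in> Sing S v"
    then have "v t y = y" by (rule SingD(2))
    then show False using M(3) M'(2) that UV(5) by auto
  qed
  then show ?thesis using M' M(2) UV by (intro exI[of _ "M' \<inter> V"]) auto
qed

lemma finite_Sing: assumes x: "x \<in> S" shows "finite (Sing S v \<inter> cls x)"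
proof (cases "\<forall>p\<in>Sing S v \<inter> cls x. saddle S v p")
  case False
  then obtain p where "p \<in> Sing S v" "p \<in> cls x" "\<not> saddle S v p" by blast
  then have "cls x = {p}" using nonsaddle_cls cls_eq[OF x] by metis
  then show ?thesis by simp
next
  case True
  obtain N where N: "\<forall>z\<in>cls x. open (N z) \<and> z \<in> N z \<and> N z \<inter> S \<inter> Sing S v \<subseteq> {z}"
    using singular_isolated[OF x True] by metis
  have "compact (cls x)" using compact_S cls_closed cls_sub[OF x] by (metis closed_Int_compact inf.absorb_iff1)
  then obtain F where F: "F \<subseteq> cls x" "finite F" "cls x \<subseteq> (\<Union>z\<in>F. N z)"
    using compactE_image[of "cls x" "cls x" N] N by blast
  have "Sing S v \<inter> cls x \<subseteq> F"
  proof
    fix p assume p: "p \<in> Sing S v \<inter> cls x"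
    then obtain z where "z \<in> F" "p \<in> N z" using F(3) by blast
    moreover have "N z \<inter> S \<inter> Sing S v \<subseteq> {z}" using N F(1) \<open>z \<in> F\<close> by blast
    ultimately show "p \<in> F" using p SingD(1)[of p] by blast
  qed
  then show ?thesis using F(2) finite_subset by blast
qed

text \<open>Orbits in the limit set have their own limit sets inside it, so without saddles the
  extended orbit of any of its points never branches and remains in it, forwards and backwards. The
  closed limit set thus contains the class of that point, which is the class of
  \<open>z\<close>.\<close>

lemma omega_saddle:
  assumes z: "z \<in> S" and no: "\<forall>p\<in>omega_limit v z. \<not> saddle S v p"
  shows "omega_limit v z = cls z"
proof -
  let ?K = "omega_limit v z"
  obtain y where y: "y \<in> ?K" using omega_nonempty[OF z] by blast
  have inv: "v t w \<in> ?K" if "w \<in> ?K" for t w using omega_invariant[OF z that] .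
  have sub: "ext_pos_orbit S w y \<subseteq> ?K" if w: "flow S w" "\<And>u t. u \<in> ?K \<Longrightarrow> w t u \<in> ?K" "\<And>p. saddle S w p = saddle S v p" for w
  proof -
    interpret w: flow S w by fact
    show ?thesis
    proof (rule w.ext_pos_least)
      show "pos_orbit w y \<subseteq> ?K" using w(2) y by (auto simp: pos_orbit_def)
      fix x' p assume x': "x' \<in> ?K" "omega_limit w x' = {p}" "saddle S w p"
      have "omega_limit w x' \<subseteq> ?K" by (intro w.omega_sub_closed omega_closed w(2) x'(1))
      then show "Wu S w p \<subseteq> ?K" using x' no w(3) by blast
    qed
  qed
  have "ext_pos_orbit S v y \<subseteq> ?K" by (rule sub[OF flow_axioms inv refl])
  moreover have "ext_neg_orbit S v y \<subseteq> ?K"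
    unfolding ext_neg_rev[OF action]
    by (rule sub[OF flow_rev _ saddle_rev_iff[OF action]]) (simp add: inv rev_action_def)
  ultimately have "cls y \<subseteq> ?K" unfolding cls_def ext_orbit_def using omega_closed by (intro closure_minimal) auto
  moreover have "?K \<subseteq> cls z" by (rule omega_sub_cls[OF z])
  moreover have "cls y = cls z" using cls_eq[OF z] y omega_sub_cls[OF z] by blast
  ultimately show ?thesis by blast
qed

lemma Wu_invariant: assumes "u \<in> Wu S v p" shows "v t u \<in> Wu S v p"
proof -
  interpret r: flow S "rev_action v" by (rule flow_rev)
  have u: "u \<in> S" "omega_limit (rev_action v) u = {p}" using assms by (auto simp: Wu_def alpha_rev)
  have "omega_limit (rev_action v) (rev_action v (- t) u) = {p}" using r.omega_shift[OF u(1)] u(2) by simp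
  then show ?thesis using u(1) by (simp add: Wu_def alpha_rev rev_action_def)
qed

lemma ext_pos_eq_pos_orbit:
  assumes w: "w \<in> S" and no: "\<And>p. omega_limit v w = {p} \<Longrightarrow> \<not> saddle S v p"
  shows "ext_pos_orbit S v w = pos_orbit v w"
proof (rule antisym[OF ext_pos_least ext_pos_base])
  fix x' p assume "x' \<in> pos_orbit v w" "omega_limit v x' = {p}" "saddle S v p"
  then show "Wu S v p \<subseteq> pos_orbit v w" using no omega_shift[OF w] by (auto simp: pos_orbit_def)
qed simp

theorem ext_pos_recurrent:
  assumes x: "x \<in> S" shows "ext_pos_recurrent_pt S v x"
proof (rule ccontr)
  assume not_rec: "\<not> ?thesis"
  let ?Ext = "ext_pos_orbit S v x"
  have x_om: "x \<notin> omega_limit v x" and x_cl: "x \<notin> closure (?Ext - pos_orbit v x)"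
    using not_rec by (auto simp: ext_pos_recurrent_pt_def)
  define C where "C = cls x"
  have CS: "C \<subseteq> S" and xC: "x \<in> C" using cls_sub self_in_cls x by (auto simp: C_def)
  have clsC: "cls y = C" if "y \<in> C" for y using cls_eq[OF x] that by (simp add: C_def)
  have not_Sing: "x \<notin> Sing S v" using omega_Sing[of x] x_om by auto
  define P where "P = Sing S v \<inter> C"
  have sad: "saddle S v p" if "p \<in> P" for p
  proof (rule ccontr)
    assume "\<not> saddle S v p"
    then have "cls p = {p}" using nonsaddle_cls that by (auto simp: P_def)
    then have "x = p" using clsC[of p] that xC by (auto simp: P_def)
    then show False using not_Sing that by (auto simp: P_def)
  qed
  have sadP: "p \<in> P" if "saddle S v p" "p \<in> C" for p using that by (auto simp: P_def saddle_def)
  have om_C: "omega_limit v z \<subseteq> C" if "z \<in> C" for z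
    using omega_sub_cls[of z] clsC[OF that] CS that by blast
  have om_alt: "omega_limit v z = C \<or> (\<exists>p\<in>P. p \<in> omega_limit v z)" if z: "z \<in> C" for z
    using omega_saddle[of z] clsC[OF z] sadP om_C[OF z] CS z by blast
  have P_ne: "P \<noteq> {}" using om_alt[OF xC] x_om xC by auto
  have finP: "finite P" using finite_Sing[OF x] by (simp add: P_def C_def)
  \<comment> \<open>If the limit set is all of \<open>C\<close>, it contains the saddles
    too.\<close>
  have om_P: "\<exists>p\<in>P. p \<in> omega_limit v z" if "z \<in> C" for z
    using om_alt[OF that] P_ne by (auto simp: P_def)
  have xP: "x \<notin> P" using not_Sing by (simp add: P_def)
  \<comment> \<open>Separating \<open>x\<close> along with the saddles makes its orbit start outside
    every block, so it has to cross a section on its way to the first visit.\<close>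
  obtain W where W: "\<forall>p\<in>insert x P. open (W p) \<and> p \<in> W p"
    "\<forall>p\<in>insert x P. \<forall>q\<in>insert x P. p \<noteq> q \<longrightarrow> W p \<inter> W q = {}"
    using finite_separation[of "insert x P"] finP by auto
  have "\<forall>p\<in>P. \<exists>h k. saddle_chart S v p h k \<and> k ` sq 2 \<subseteq> S \<inter> W p"
  proof
    fix p assume p: "p \<in> P"
    have "openin (top_of_set S) (S \<inter> W p)" "p \<in> S \<inter> W p" using W(1) p CS by (auto simp: P_def openin_open)
    then show "\<exists>h k. saddle_chart S v p h k \<and> k ` sq 2 \<subseteq> S \<inter> W p"
      using saddle_chart_exists[OF action sad[OF p]] by metis
  qed
  then obtain h k where hk: "\<forall>p\<in>P. saddle_chart S v p (h p) (k p) \<and> k p ` sq 2 \<subseteq> S \<inter> W p" by metis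
  have ch: "chart S v p (h p) (k p)" if "p \<in> P" for p using hk that by unfold_locales blast
  have UW: "chart.U (k p) \<subseteq> W p" if "p \<in> P" for p using hk that chart.U_def[OF ch[OF that]] by auto
  interpret saddle_boxes S v P h k
  proof (intro saddle_boxes.intro flow_axioms saddle_boxes_axioms.intro finP P_ne ch)
    show "chart.U (k p) \<inter> chart.U (k q) = {}" if "p \<in> P" "q \<in> P" "p \<noteq> q" for p q
    proof -
      have "W p \<inter> W q = {}" using W(2) that by simp
      then show ?thesis using UW[OF that(1)] UW[OF that(2)] by blast
    qed
  qed
  have vis: "visits z" if z: "z \<in> C" for z
  proof -
    obtain p where p: "p \<in> P" "p \<in> omega_limit v z" using om_P[OF z] by blast
    obtain N where N: "open N" "ibx p = S \<inter> N" using chart.open_Bo[OF ch[OF p(1)]] by (auto simp: openin_open)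
    have "p \<in> N" using chart.p_B(1)[OF ch[OF p(1)]] N(2) by blast
    then have "\<exists>t\<ge>T. v t z \<in> ibx p" for T using p(2) N CS z unfolding mem_omega_iff by (metis IntI subsetD v_in)
    then show ?thesis unfolding visits_def using p(1) by blast
  qed
  obtain t1 p1 where t1: "t1 \<ge> 1" "p1 \<in> P" "v t1 x \<in> ibx p1" using vis[OF xC] unfolding visits_def by blast
  have "v 0 x \<notin> bx p1"
  proof
    assume "v 0 x \<in> bx p1"
    then have "x \<in> W p1" using UW[OF t1(2)] ent_sub(2)[OF t1(2)] x by auto
    then show False using W t1(2) xP by (metis disjoint_iff insert_iff)
  qed
  moreover have "v t1 x \<in> bx p1" using t1(3) ent_sub(4)[OF t1(2)] by blast
  ultimately obtain t0 where t0: "0 < t0" "v t0 x \<in> Sec" using hit[OF t1(2) x, of 0 t1] t1(1) by auto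
  define x0 where "x0 = v t0 x"
  have x0S: "x0 \<in> S" using x by (simp add: x0_def)
  \<comment> \<open>Unlike a difference with the half orbit \<open>pos_orbit v x\<close>, this union
    of unstable sets is visibly invariant under the flow, and it accounts for everything in
    \<open>?Ext\<close> besides the positive orbit.\<close>
  define A where "A = \<Union>{Wu S v p | c p. c \<in> ?Ext \<and> omega_limit v c = {p} \<and> saddle S v p}"
  have AE: "A \<subseteq> ?Ext" unfolding A_def using ext_pos_step by blast
  have ExtA: "?Ext = pos_orbit v x \<union> A"
  proof (rule antisym)
    show "pos_orbit v x \<union> A \<subseteq> ?Ext" using AE ext_pos_base by blast
    then have sub: "pos_orbit v x \<union> A \<subseteq> ?Ext" .
    show "?Ext \<subseteq> pos_orbit v x \<union> A"
    proof (rule ext_pos_least)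
      fix x' p assume x': "x' \<in> pos_orbit v x \<union> A" "omega_limit v x' = {p}" "saddle S v p"
      then have "x' \<in> ?Ext" using sub by blast
      then have "Wu S v p \<subseteq> A" using x' unfolding A_def by blast
      then show "Wu S v p \<subseteq> pos_orbit v x \<union> A" by blast
    qed simp
  qed
  have A_inv: "v t y \<in> A" if "y \<in> A" for y t using that Wu_invariant unfolding A_def by blast
  have AS: "A \<subseteq> S" using AE ext_pos_sub[OF x] by blast
  have clA_inv: "v t y \<in> closure A" if "y \<in> closure A" for y t
    by (rule v_closure[OF that AS]) (use A_inv in blast)
  have not_per: "v t x \<noteq> x" if "0 < t" for t using periodic_omega[OF x that] x_om by blast
  \<comment> \<open>Non-recurrence only speaks of \<open>?Ext - pos_orbit v x\<close>, while
    \<open>A\<close> might overlap the positive orbit. If \<open>x\<close> were in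
    \<open>closure A\<close>, so would be \<open>v (- e) x\<close>; this point is off the closed
    positive orbit, as \<open>x\<close> is neither periodic nor in its omega limit set, and hence it
    is a limit of \<open>A - pos_orbit v x\<close>. Letting \<open>e\<close> tend to 0 gives the
    contradiction.\<close>
  have xA: "x \<notin> closure A"
  proof
    assume xA: "x \<in> closure A"
    have bw: "v (- e) x \<in> closure (?Ext - pos_orbit v x)" if e: "0 < e" for e
    proof -
      have "v (- e) x \<notin> closure (pos_orbit v x)"
      proof
        assume "v (- e) x \<in> closure (pos_orbit v x)"
        then consider "v (- e) x \<in> pos_orbit v x" | "v (- e) x \<in> omega_limit v x"
          unfolding closure_pos_orbit[OF x] by blast
        then show False
        proof cases
          case 1
          then obtain t where t: "0 \<le> t" "v (- e) x = v t x" by (auto simp: pos_orbit_def)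
          then have "v (e + t) x = x" using v_inverse(1)[OF x, of e] x by (simp add: v_add)
          then show False using not_per[of "e + t"] e t(1) by simp
        next
          case 2
          then have "v e (v (- e) x) \<in> omega_limit v x" by (rule omega_invariant[OF x])
          then show False using x x_om by simp
        qed
      qed
      moreover have "v (- e) x \<in> closure A" using clA_inv xA by blast
      moreover have "closure A \<subseteq> closure (A - pos_orbit v x) \<union> closure (pos_orbit v x)"
        by (metis Un_Diff_cancel2 Un_upper1 closure_Un closure_mono)
      moreover have "closure (A - pos_orbit v x) \<subseteq> closure (?Ext - pos_orbit v x)" using AE by (intro closure_mono) auto
      ultimately show ?thesis by blast
    qed
    have "(\<lambda>n. v (- inverse (real (Suc n))) x) \<longlonglongrightarrow> v (- 0) x"
      by (intro v_tendsto tendsto_intros LIMSEQ_inverse_real_of_nat x)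
    then have "(\<lambda>n. v (- inverse (real (Suc n))) x) \<longlonglongrightarrow> x" using x by simp
    then have "x \<in> closure (?Ext - pos_orbit v x)"
      by (rule Lim_in_closed_set[OF closed_closure, rotated -1]) (use bw in \<open>auto intro!: always_eventually simp del: of_nat_Suc\<close>)
    then show False using x_cl by simp
  qed
  define T0 where "T0 = omega_limit v x \<union> closure A"
  have T0_inv: "v t y \<in> T0" if "y \<in> T0" for t y
    using that omega_invariant[OF x] clA_inv by (auto simp: T0_def)
  show False
  proof (rule no_escape[of C x0 T0 A])
    show "C \<subseteq> S" by (rule CS)
    show "w \<in> C" if "w \<in> S" "y \<in> omega_limit v w" "y \<in> C" for w y
    proof -
      have "cls y = cls w" using cls_eq[OF that(1)] omega_sub_cls[OF that(1)] that(2) by blast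
      then show ?thesis using clsC[OF that(3)] self_in_cls[OF that(1)] by simp
    qed
    show "visits z" if "z \<in> C" for z using vis that .
    show "u \<in> C" if "p \<in> P" "u \<in> S" "alpha_limit v u = {p}" for p u
    proof -
      have "u \<in> cls p" using Wu_sub_cls[of p] sad[OF that(1)] that by (auto simp: P_def Wu_def)
      then show ?thesis using clsC[of p] that(1) by (simp add: P_def)
    qed
    \<comment> \<open>With no saddle as limit at either end, the extended orbit is the ordinary
      orbit, and its closure is the class.\<close>
    show "C \<subseteq> closure (range (\<lambda>t. v t w))"
      if w: "w \<in> C" "\<forall>p\<in>P. omega_limit v w \<noteq> {p}" "\<forall>p\<in>P. alpha_limit v w \<noteq> {p}" for w
    proof -
      interpret r: pap_flow S "rev_action v" by (rule pap_rev)
      have wS: "w \<in> S" using w CS by blast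
      have "ext_pos_orbit S v w = pos_orbit v w"
      proof (rule ext_pos_eq_pos_orbit[OF wS])
        fix p assume p: "omega_limit v w = {p}"
        then have "p \<in> C" using om_C[OF w(1)] by blast
        then show "\<not> saddle S v p" using sadP w(2) p by blast
      qed
      moreover have "ext_neg_orbit S v w = neg_orbit v w"
        unfolding ext_neg_rev[OF action] neg_orbit_rev
      proof (rule r.ext_pos_eq_pos_orbit[OF wS])
        fix p assume p: "omega_limit (rev_action v) w = {p}"
        then have "p \<in> C" using r.omega_sub_cls[OF wS] clsC[OF w(1)] by (simp add: cls_rev)
        then show "\<not> saddle S (rev_action v) p" using sadP w(3) p by (auto simp: saddle_rev_iff[OF action] alpha_rev)
      qed
      ultimately have "ext_orbit S v w \<subseteq> range (\<lambda>t. v t w)"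
        by (auto simp: ext_orbit_def pos_orbit_def neg_orbit_def)
      then show ?thesis using clsC[OF w(1)] closure_mono unfolding cls_def by metis
    qed
    show "x0 \<in> Sec" using t0 by (simp add: x0_def)
    show "x0 \<notin> T0"
    proof
      assume "x0 \<in> T0"
      then have "v (- t0) x0 \<in> T0" by (rule T0_inv)
      then have "x \<in> T0" using x by (simp add: x0_def)
      then show False using x_om xA by (simp add: T0_def)
    qed
    show "v t x0 \<noteq> x0" if "0 < t" for t
    proof
      assume "v t x0 = x0"
      then have "v t0 (v t x) = v t0 x" using x by (simp add: x0_def add.commute flip: v_add)
      then have "v (- t0) (v t0 (v t x)) = v (- t0) (v t0 x)" by simp
      then have "v t x = x" using x by (simp only: v_inverse(2) v_in)
      then show False using not_per[OF that] by blast
    qed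
    show "pos_orbit v x0 \<subseteq> C" using cls_invariant[OF x] xC x by (auto simp: pos_orbit_def x0_def C_def)
    show "closed T0" unfolding T0_def by (intro closed_Un omega_closed closed_closure)
    have "A \<subseteq> C" using AE ext_sub_cls[of x] by (auto simp: C_def ext_orbit_def)
    then have "closure A \<subseteq> C" using cls_closed[of x] by (intro closure_minimal) (simp_all add: C_def)
    then show "T0 \<subseteq> C" using om_C[OF xC] by (auto simp: T0_def)
    show "v t y \<in> T0" if "y \<in> T0" for y t using T0_inv[OF that] .
    show "omega_limit v x0 \<subseteq> T0" using omega_shift[OF x] by (auto simp: T0_def x0_def)
    show "A \<subseteq> T0" using closure_subset[of A] by (auto simp: T0_def)
    show "v t y \<in> A" if "y \<in> A" for y t using A_inv[OF that] .
    show "u \<in> A" if c: "c \<in> pos_orbit v x0 \<union> A" "omega_limit v c = {p}" "p \<in> P" "u \<in> S" "alpha_limit v u = {p}" for c p u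
    proof -
      have "pos_orbit v x0 \<subseteq> pos_orbit v x"
      proof
        fix y assume "y \<in> pos_orbit v x0"
        then obtain t where "0 \<le> t" "y = v (t + t0) x" using x by (auto simp: pos_orbit_def x0_def v_add)
        then show "y \<in> pos_orbit v x" using t0(1) by (auto simp: pos_orbit_def)
      qed
      then have "c \<in> ?Ext" using c(1) ExtA by blast
      moreover have "u \<in> Wu S v p" using c by (simp add: Wu_def)
      ultimately show ?thesis using c(2) sad[OF c(3)] unfolding A_def by blast
    qed
  qed
qed

end

theorem lemma3p1:
  fixes S :: "'a::t2_space set" and v :: "real \<Rightarrow> 'a \<Rightarrow> 'a"
  assumes "compact_surface S"
    and "continuous_action S v"
    and "ext_pap S v"
  shows "ext_recurrent S v \<and> (\<forall>x\<in>S. finite (Sing S v \<inter> closure (ext_orbit S v x)))"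
proof -
  interpret pap_flow S v
    using assms by unfold_locales (simp_all add: compact_surface_def)
  interpret r: pap_flow S "rev_action v" by (rule pap_rev)
  show ?thesis
    using ext_pos_recurrent r.ext_pos_recurrent finite_Sing assms(2)
    by (simp add: ext_recurrent_def ext_neg_recurrent_rev cls_def)
qed

end
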